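(* Let $\xi$, $f$, $\ell$ satisfy $(H_f)$, $(H_\xi)$ and $(H_\ell)$ (as written out in the context; in particular $y\mapsto\ell(t,y)$ is strictly increasing for all $t$). Suppose that the driver $f$ is of the form $$f:(t,y,z)\mapsto a_t\,y+h(t,z),$$ where $a:[0,T]\to\mathbb R$ is a deterministic and bounded measurable function (and $h$ may be random). Then a deterministic flat solution $(Y,Z,K)$ of the BSDE with mean reflection $$Y_t=\xi+\int_t^T f(s,Y_s,Z_s)\,ds-\int_t^T Z_s\cdot dB_s+K_T-K_t,\qquad \mathbb E[\ell(t,Y_t)]\ge0,\qquad 0\le t\le T,$$ is minimal among all the deterministic solutions: for every deterministic solution $(Y',Z',K')$ of the same equation, $\mathbb P$-a.s., $Y_t\le Y'_t$ for all $t\in[0,T]$.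
   Context: $T>0$ is finite; $(\Omega,\mathcal F,\mathbb P)$ is a complete probability space carrying a $d$-dimensional standard Brownian motion $B=(B_t)_{0\le t\le T}$, with usual augmented filtration $\{\mathcal F_t\}_{0\le t\le T}$. $\mathcal S^2$: real-valued adapted continuous processes $Y$ with $\mathbb E[\sup_{0\le t\le T}|Y_t|^2]<\infty$. $\mathcal H^2$: predictable $\mathbb R^d$-valued processes $Z$ with $\mathbb E[\int_0^T|Z_s|^2ds]<\infty$. $\mathcal A^2$: nondecreasing processes $K\in\mathcal S^2$ with $K_0=0$; $\mathcal A^2_D$: the deterministic elements of $\mathcal A^2$. A deterministic solution of the BSDE with mean reflection is a triple $(Y,Z,K)\in\mathcal S^2\times\mathcal H^2\times\mathcal A^2_D$ satisfying the equation and the constraint $\mathbb E[\ell(t,Y_t)]\ge0$, $0\le t\le T$; it is flat if moreover $\int_0^T\mathbb E[\ell(t,Y_t)]\,dK_t=0$. Assumptions: $(H_f)$: $f:\Omega\times[0,T]\times\mathbb R\times\mathbb R^d\to\mathbb R$ is measurable with respect to $\mathcal P\otimes\mathcal B(\mathbb R)\otimes\mathcal B(\mathbb R^d)$, $\mathcal P$ being the progressive $\sigma$-algebra on $\Omega\times[0,T]$; there is $\lambda\ge0$ such that $\mathbb P$-a.s., for all $t\in[0,T]$ and all $y,p\in\mathbb R$, $z,q\in\mathbb R^d$, $|f(t,y,z)-f(t,p,q)|\le\lambda(|y-p|+|z-q|)$; and $\mathbb E[\int_0^T|f(t,0,0)|^2dt]<\infty$. $(H_\xi)$: $\xi$ is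 a square-integrable $\mathcal F_T$-measurable random variable with $\mathbb E[\ell(T,\xi)]\ge0$. $(H_\ell)$: $\ell:\Omega\times[0,T]\times\mathbb R\to\mathbb R$ is $\mathcal F_T\otimes\mathcal B([0,T])\otimes\mathcal B(\mathbb R)$-measurable and there is $C\ge0$ such that $\mathbb P$-a.s.: (1) $(t,y)\mapsto\ell(t,y)$ is continuous; (2) for all $t$, $y\mapsto\ell(t,y)$ is strictly increasing; (3) for all $t$, $\mathbb E[\ell(t,\infty)]>0$, where $\ell(t,\infty)=\lim_{y\to\infty}\ell(t,y)$; (4) for all $t,y$, $|\ell(t,y)|\le C(1+|y|)$. *)

theory Defs
  imports "HOL-Probability.Probability"
begin

text \<open>
  Processes are curried functions of time and outcome, \<open>X t \<omega>\<close>; only the values for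
  \<open>t \<in> {0..T}\<close> matter. Random fields such as the driver \<open>f\<close> take the outcome first. The
  dimension of the Brownian motion is the cardinality of the index type \<open>'d\<close>.
\<close>


section \<open>Brownian motion and its filtration\<close>

definition standard_brownian_motion ::
    "'w measure \<Rightarrow> real \<Rightarrow> (real \<Rightarrow> 'w \<Rightarrow> real ^ 'd::finite) \<Rightarrow> bool" where
  "standard_brownian_motion M T B \<longleftrightarrow>
     (\<forall>t\<in>{0..T}. B t \<in> borel_measurable M) \<and>
     (AE \<omega> in M. B 0 \<omega> = 0) \<and>
     (AE \<omega> in M. continuous_on {0..T} (\<lambda>t. B t \<omega>)) \<and>
     (\<forall>(n::nat) (t::nat \<Rightarrow> real). mono t \<and> range t \<subseteq> {0..T} \<longrightarrow>
        prob_space.indep_vars M (\<lambda>_. borel) (\<lambda>i \<omega>. B (t (Suc i)) \<omega> - B (t i) \<omega>) {..<n}) \<and>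
     (\<forall>s t. 0 \<le> s \<and> s < t \<and> t \<le> T \<longrightarrow>
        prob_space.indep_vars M (\<lambda>_. borel) (\<lambda>(i::'d) \<omega>. B t \<omega> $ i - B s \<omega> $ i) UNIV \<and>
        (\<forall>i. distributed M lborel (\<lambda>\<omega>. B t \<omega> $ i - B s \<omega> $ i) (normal_density 0 (sqrt (t - s)))))"

definition completed_natural_filtration ::
    "'w measure \<Rightarrow> (real \<Rightarrow> 'w \<Rightarrow> 'b::topological_space) \<Rightarrow> real \<Rightarrow> 'w measure" where
  "completed_natural_filtration M B t =
     sigma (space M)
       ({B u -` S \<inter> space M | u S. 0 \<le> u \<and> u \<le> t \<and> S \<in> sets borel} \<union> null_sets M)"

text \<open>
  The usual augmentation is the right-continuous version of the completed natural filtration.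
  Truncating \<open>u\<close> at \<open>T\<close> makes the \<open>\<sigma>\<close>-algebra at the final time \<open>T\<close> the completed natural one.
\<close>

definition usual_filtration ::
    "'w measure \<Rightarrow> real \<Rightarrow> (real \<Rightarrow> 'w \<Rightarrow> 'b::topological_space) \<Rightarrow> real \<Rightarrow> 'w measure" where
  "usual_filtration M T B t =
     sigma (space M) (\<Inter>u\<in>{t<..}. sets (completed_natural_filtration M B (min u T)))"


section \<open>Progressive and predictable sigma-algebras on \<open>\<Omega> \<times> [0,T]\<close>\<close>

definition progressive_algebra :: "'w set \<Rightarrow> real \<Rightarrow> (real \<Rightarrow> 'w measure) \<Rightarrow> ('w \<times> real) measure" where
  "progressive_algebra \<Omega> T F =
     sigma (\<Omega> \<times> {0..T})
       {C. C \<subseteq> \<Omega> \<times> {0..T} \<and>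
           (\<forall>t\<in>{0..T}. C \<inter> (\<Omega> \<times> {0..t}) \<in> sets (F t \<Otimes>\<^sub>M restrict_space borel {0..t}))}"

definition predictable_algebra :: "'w set \<Rightarrow> real \<Rightarrow> (real \<Rightarrow> 'w measure) \<Rightarrow> ('w \<times> real) measure" where
  "predictable_algebra \<Omega> T F =
     sigma (\<Omega> \<times> {0..T})
       ({A \<times> {0} | A. A \<in> sets (F 0)} \<union>
        {A \<times> {s<..u} | A s u. 0 \<le> s \<and> s \<le> u \<and> u \<le> T \<and> A \<in> sets (F s)})"

definition adapted_process ::
    "real \<Rightarrow> (real \<Rightarrow> 'w measure) \<Rightarrow> (real \<Rightarrow> 'w \<Rightarrow> 'b::topological_space) \<Rightarrow> bool" where
  "adapted_process T F X \<longleftrightarrow> (\<forall>t\<in>{0..T}. X t \<in> borel_measurable (F t))"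


section \<open>The spaces \<open>S\<^sup>2\<close>, \<open>H\<^sup>2\<close>, \<open>A\<^sup>2\<close> and \<open>A\<^sup>2\<^sub>D\<close>\<close>

text \<open>
  Path properties are required almost surely, processes being identified up to
  indistinguishability.
\<close>

definition S2 :: "'w measure \<Rightarrow> real \<Rightarrow> (real \<Rightarrow> 'w measure) \<Rightarrow> (real \<Rightarrow> 'w \<Rightarrow> real) set" where
  "S2 M T F =
     {Y. adapted_process T F Y \<and>
         (AE \<omega> in M. continuous_on {0..T} (\<lambda>t. Y t \<omega>)) \<and>
         (\<integral>\<^sup>+\<omega>. (\<Squnion>t\<in>{0..T}. ennreal (\<bar>Y t \<omega>\<bar>\<^sup>2)) \<partial>M) < \<infinity>}"

definition H2 :: "'w measure \<Rightarrow> real \<Rightarrow> (real \<Rightarrow> 'w measure) \<Rightarrow> (real \<Rightarrow> 'w \<Rightarrow> real ^ 'd) set" where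
  "H2 M T F =
     {Z. (\<lambda>(\<omega>, t). Z t \<omega>) \<in> borel_measurable (predictable_algebra (space M) T F) \<and>
         (\<integral>\<^sup>+\<omega>. (\<integral>\<^sup>+s\<in>{0..T}. ennreal ((norm (Z s \<omega>))\<^sup>2) \<partial>lborel) \<partial>M) < \<infinity>}"

definition A2 :: "'w measure \<Rightarrow> real \<Rightarrow> (real \<Rightarrow> 'w measure) \<Rightarrow> (real \<Rightarrow> 'w \<Rightarrow> real) set" where
  "A2 M T F =
     {K \<in> S2 M T F. AE \<omega> in M. mono_on {0..T} (\<lambda>t. K t \<omega>) \<and> K 0 \<omega> = 0}"

definition A2D :: "'w measure \<Rightarrow> real \<Rightarrow> (real \<Rightarrow> 'w measure) \<Rightarrow> (real \<Rightarrow> real) set" where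
  "A2D M T F = {k. (\<lambda>t \<omega>. k t) \<in> A2 M T F}"


section \<open>The stochastic integral\<close>

text \<open>
  A simple integrand \<open>\<Sum>\<^sub>i H\<^sub>i 1\<^bsub>(s\<^sub>i, u\<^sub>i]\<^esub>\<close> with bounded \<open>\<F>\<^bsub>s\<^sub>i\<^esub>\<close>-measurable coefficients \<open>H\<^sub>i\<close> is
  represented by the list of the triples \<open>(s\<^sub>i, u\<^sub>i, H\<^sub>i)\<close>; the intervals may overlap.
\<close>

type_synonym ('w, 'd) simple_integrand = "(real \<times> real \<times> ('w \<Rightarrow> real ^ 'd)) list"

definition is_simple_integrand ::
    "'w measure \<Rightarrow> real \<Rightarrow> (real \<Rightarrow> 'w measure) \<Rightarrow> ('w, 'd::finite) simple_integrand \<Rightarrow> bool" where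
  "is_simple_integrand M T F xs \<longleftrightarrow>
     (\<forall>(s, u, H) \<in> set xs. 0 \<le> s \<and> s \<le> u \<and> u \<le> T \<and> H \<in> borel_measurable (F s) \<and>
        (\<exists>C. \<forall>\<omega>\<in>space M. norm (H \<omega>) \<le> C))"

definition simple_process :: "('w, 'd::finite) simple_integrand \<Rightarrow> real \<Rightarrow> 'w \<Rightarrow> real ^ 'd" where
  "simple_process xs t \<omega> = (\<Sum>(s, u, H)\<leftarrow>xs. indicat_real {s<..u} t *\<^sub>R H \<omega>)"

definition simple_integral ::
    "(real \<Rightarrow> 'w \<Rightarrow> real ^ 'd) \<Rightarrow> ('w, 'd::finite) simple_integrand \<Rightarrow> real \<Rightarrow> 'w \<Rightarrow> real" where
  "simple_integral B xs t \<omega> = (\<Sum>(s, u, H)\<leftarrow>xs. H \<omega> \<bullet> (B (min u t) \<omega> - B (min s t) \<omega>))"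

text \<open>
  \<open>has_ito_integral M T F B Z I\<close> says that the process \<open>I\<close> is \<open>\<integral>\<^sub>0 Z \<cdot> dB\<close>, that is, the continuous
  adapted process obtained as the \<open>L\<^sup>2\<close>-limit of the integrals of simple integrands converging
  to \<open>Z\<close>. For a Brownian motion \<open>B\<close> with its usual filtration \<open>F\<close> and \<open>Z \<in> H\<^sup>2\<close>, such an \<open>I\<close>
  exists and is unique up to indistinguishability.
\<close>

definition has_ito_integral ::
    "'w measure \<Rightarrow> real \<Rightarrow> (real \<Rightarrow> 'w measure) \<Rightarrow> (real \<Rightarrow> 'w \<Rightarrow> real ^ 'd::finite) \<Rightarrow>
     (real \<Rightarrow> 'w \<Rightarrow> real ^ 'd) \<Rightarrow> (real \<Rightarrow> 'w \<Rightarrow> real) \<Rightarrow> bool" where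
  "has_ito_integral M T F B Z I \<longleftrightarrow>
     adapted_process T F I \<and>
     (AE \<omega> in M. continuous_on {0..T} (\<lambda>t. I t \<omega>)) \<and>
     (\<exists>xs :: nat \<Rightarrow> ('w, 'd) simple_integrand.
        (\<forall>n. is_simple_integrand M T F (xs n)) \<and>
        (\<lambda>n. \<integral>\<^sup>+\<omega>. (\<integral>\<^sup>+s\<in>{0..T}. ennreal ((norm (simple_process (xs n) s \<omega> - Z s \<omega>))\<^sup>2) \<partial>lborel) \<partial>M)
          \<longlonglongrightarrow> 0 \<and>
        (\<forall>t\<in>{0..T}.
           (\<lambda>n. \<integral>\<^sup>+\<omega>. ennreal ((simple_integral B (xs n) t \<omega> - I t \<omega>)\<^sup>2) \<partial>M) \<longlonglongrightarrow> 0))"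


section \<open>Assumptions on the data\<close>

definition H_f ::
    "'w measure \<Rightarrow> real \<Rightarrow> (real \<Rightarrow> 'w measure) \<Rightarrow>
     ('w \<Rightarrow> real \<Rightarrow> real \<Rightarrow> real ^ 'd::finite \<Rightarrow> real) \<Rightarrow> bool" where
  "H_f M T F f \<longleftrightarrow>
     (\<lambda>((\<omega>, t), y, z). f \<omega> t y z)
        \<in> borel_measurable (progressive_algebra (space M) T F \<Otimes>\<^sub>M (borel \<Otimes>\<^sub>M borel)) \<and>
     (\<exists>L\<ge>0. AE \<omega> in M. \<forall>t\<in>{0..T}. \<forall>y p z q.
        \<bar>f \<omega> t y z - f \<omega> t p q\<bar> \<le> L * (\<bar>y - p\<bar> + norm (z - q))) \<and>
     (\<integral>\<^sup>+\<omega>. (\<integral>\<^sup>+t\<in>{0..T}. ennreal (\<bar>f \<omega> t 0 0\<bar>\<^sup>2) \<partial>lborel) \<partial>M) < \<infinity>"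

definition H_xi ::
    "'w measure \<Rightarrow> real \<Rightarrow> (real \<Rightarrow> 'w measure) \<Rightarrow> ('w \<Rightarrow> real \<Rightarrow> real \<Rightarrow> real) \<Rightarrow> ('w \<Rightarrow> real) \<Rightarrow> bool" where
  "H_xi M T F l \<xi> \<longleftrightarrow>
     \<xi> \<in> borel_measurable (F T) \<and> integrable M (\<lambda>\<omega>. (\<xi> \<omega>)\<^sup>2) \<and> (\<integral>\<omega>. l \<omega> T (\<xi> \<omega>) \<partial>M) \<ge> 0"

text \<open>
  Under the growth and monotonicity conditions in \<open>H_l\<close>, the variable \<open>l(t,\<infinity>)\<close> takes values in
  \<open>(-\<infinity>,\<infinity>]\<close> and has an integrable negative part, so its expectation is taken in the extended
  reals and the difference below is never of the form \<open>\<infinity> - \<infinity>\<close>.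
\<close>

definition ereal_expectation :: "'w measure \<Rightarrow> ('w \<Rightarrow> ereal) \<Rightarrow> ereal" where
  "ereal_expectation M X =
     enn2ereal (\<integral>\<^sup>+\<omega>. e2ennreal (X \<omega>) \<partial>M) - enn2ereal (\<integral>\<^sup>+\<omega>. e2ennreal (- X \<omega>) \<partial>M)"

definition H_l ::
    "'w measure \<Rightarrow> real \<Rightarrow> (real \<Rightarrow> 'w measure) \<Rightarrow> ('w \<Rightarrow> real \<Rightarrow> real \<Rightarrow> real) \<Rightarrow> bool" where
  "H_l M T F l \<longleftrightarrow>
     (\<lambda>(\<omega>, t, y). l \<omega> t y)
        \<in> borel_measurable (F T \<Otimes>\<^sub>M (restrict_space borel {0..T} \<Otimes>\<^sub>M borel)) \<and>
     (AE \<omega> in M. continuous_on ({0..T} \<times> UNIV) (\<lambda>(t, y). l \<omega> t y)) \<and>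
     (AE \<omega> in M. \<forall>t\<in>{0..T}. strict_mono (l \<omega> t)) \<and>
     (\<forall>t\<in>{0..T}. ereal_expectation M (\<lambda>\<omega>. Lim at_top (\<lambda>y. ereal (l \<omega> t y))) > 0) \<and>
     (\<exists>C\<ge>0. AE \<omega> in M. \<forall>t\<in>{0..T}. \<forall>y. \<bar>l \<omega> t y\<bar> \<le> C * (1 + \<bar>y\<bar>))"


section \<open>BSDEs with mean reflection\<close>

definition deterministic_solution ::
    "'w measure \<Rightarrow> real \<Rightarrow> (real \<Rightarrow> 'w measure) \<Rightarrow> (real \<Rightarrow> 'w \<Rightarrow> real ^ 'd::finite) \<Rightarrow>
     ('w \<Rightarrow> real) \<Rightarrow> ('w \<Rightarrow> real \<Rightarrow> real \<Rightarrow> real ^ 'd \<Rightarrow> real) \<Rightarrow> ('w \<Rightarrow> real \<Rightarrow> real \<Rightarrow> real) \<Rightarrow>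
     (real \<Rightarrow> 'w \<Rightarrow> real) \<Rightarrow> (real \<Rightarrow> 'w \<Rightarrow> real ^ 'd) \<Rightarrow> (real \<Rightarrow> real) \<Rightarrow> bool" where
  "deterministic_solution M T F B \<xi> f l Y Z K \<longleftrightarrow>
     Y \<in> S2 M T F \<and> Z \<in> H2 M T F \<and> K \<in> A2D M T F \<and>
     (\<exists>I. has_ito_integral M T F B Z I \<and>
        (AE \<omega> in M. \<forall>t\<in>{0..T}.
           Y t \<omega> = \<xi> \<omega> + (LINT s:{t..T}|lborel. f \<omega> s (Y s \<omega>) (Z s \<omega>))
                   - (I T \<omega> - I t \<omega>) + K T - K t)) \<and>
     (\<forall>t\<in>{0..T}. (\<integral>\<omega>. l \<omega> t (Y t \<omega>) \<partial>M) \<ge> 0)"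

text \<open>
  The Stieltjes integral against \<open>dK\<close> is taken with respect to the measure of the extension of
  \<open>K\<close> from \<open>[0,T]\<close> to the real line that is constant on both sides.
\<close>

definition flat ::
    "'w measure \<Rightarrow> real \<Rightarrow> ('w \<Rightarrow> real \<Rightarrow> real \<Rightarrow> real) \<Rightarrow> (real \<Rightarrow> 'w \<Rightarrow> real) \<Rightarrow> (real \<Rightarrow> real) \<Rightarrow> bool" where
  "flat M T l Y K \<longleftrightarrow>
     (LINT t:{0..T}|interval_measure (\<lambda>t. K (max 0 (min t T))). (\<integral>\<omega>. l \<omega> t (Y t \<omega>) \<partial>M)) = 0"

definition deterministic_flat_solution ::
    "'w measure \<Rightarrow> real \<Rightarrow> (real \<Rightarrow> 'w measure) \<Rightarrow> (real \<Rightarrow> 'w \<Rightarrow> real ^ 'd::finite) \<Rightarrow>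
     ('w \<Rightarrow> real) \<Rightarrow> ('w \<Rightarrow> real \<Rightarrow> real \<Rightarrow> real ^ 'd \<Rightarrow> real) \<Rightarrow> ('w \<Rightarrow> real \<Rightarrow> real \<Rightarrow> real) \<Rightarrow>
     (real \<Rightarrow> 'w \<Rightarrow> real) \<Rightarrow> (real \<Rightarrow> 'w \<Rightarrow> real ^ 'd) \<Rightarrow> (real \<Rightarrow> real) \<Rightarrow> bool" where
  "deterministic_flat_solution M T F B \<xi> f l Y Z K \<longleftrightarrow>
     deterministic_solution M T F B \<xi> f l Y Z K \<and> flat M T l Y K"

end

theory Submission
  imports Defs
begin

text \<open>
  Let \<open>D\<close> be the difference of the two solutions, \<open>J\<close> that of the stochastic integrals and \<open>z\<close> that
  of the integrands. The difference of the drivers is \<open>a D + g\<close> with \<open>\<bar>g\<bar> \<le> \<Lambda> \<bar>z\<bar>\<close>, so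
  \<open>D\<^sub>t - D\<^sub>r + (J\<^sub>r - J\<^sub>t)\<close> is \<open>\<integral> a (D - E D) + g\<close> over \<open>[t,r]\<close> up to a constant. Taking variances
  removes the constant, which contains the deterministic processes \<open>K\<close>, \<open>K'\<close>; as \<open>J\<^sub>r - J\<^sub>t\<close> is orthogonal
  to \<open>D\<^sub>t\<close>, this gives for \<open>D\<^sub>r\<close> deterministic
  \<open>Var D\<^sub>t + E (J\<^sub>r - J\<^sub>t)\<^sup>2 \<le> C (r - t) \<integral> (Var D + E \<bar>z\<bar>\<^sup>2)\<close>.
  By the Ito isometry the right-hand side is absorbed on short intervals. Going backwards from
  \<open>D\<^sub>T = 0\<close>, one finds \<open>z = 0\<close> and \<open>D = m\<close> deterministic, without the Ito formula or a change of measure.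
  If \<open>m\<close> were positive at \<open>t\<close>, let \<open>r\<close> be its next zero. On \<open>[t,r)\<close> the constraint is strictly
  satisfied by the flat solution, so \<open>K\<close> is constant there and
  \<open>m\<^sub>t \<le> \<integral> a m\<close> over \<open>[t,r]\<close>, which fails close to \<open>r\<close>.
\<close>

section \<open>Independence of the increments from the augmented filtration\<close>

text \<open>The form of the driver enters through one splitting. As \<open>a\<close> is
  deterministic and the driver is affine in \<open>y\<close>, the drift \<open>a D\<close> is
  \<open>a m + a (D - m)\<close> with \<open>m = E D\<close>. The first summand is deterministic and
  joins the increments of \<open>K - K'\<close> in one constant \<open>c t r\<close>; the second is
  controlled by the variance of \<open>D\<close>. If the dependence on \<open>y\<close> were
  nonlinear, the factor in front of \<open>D\<close> would be random and no deterministic part would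
  split off in this way. The square \<open>(m t - m r - c t r)\<^sup>2\<close> that also appears in
  the second moment is kept. Once variance and energy vanish, the same estimate makes it vanish too,
  and this is the scalar equation for \<open>m\<close> behind the final comparison. Two obstacles
  lie in the definitions. \<open>standard_brownian_motion\<close> gives independence among
  increments only, so independence from the completed right-continuous filtration has to be derived.
  Processes in \<open>S2\<close> are adapted with almost surely continuous paths, so the joint
  measurability that Fubini requires is obtained for a modification.\<close>

lemma sets_Collect_mem:
  assumes "f \<in> measurable M N" "A \<in> sets N"
  shows "{x\<in>space M. f x \<in> A} \<in> sets M"
proof -
  have "{x\<in>space M. f x \<in> A} = f -` A \<inter> space M" by auto
  then show ?thesis using assms by (simp add: measurable_sets)
qed

locale brownian_motion = prob_space M for M :: "'w measure" +
  fixes T :: real and B :: "real \<Rightarrow> 'w \<Rightarrow> real ^ 'd::finite"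
  assumes T_pos: "0 < T"
    and standard: "standard_brownian_motion M T B"
begin

abbreviation "G \<equiv> completed_natural_filtration M B"
abbreviation "F \<equiv> usual_filtration M T B"

lemma B_measurable: "0 \<le> t \<Longrightarrow> t \<le> T \<Longrightarrow> B t \<in> borel_measurable M"
  using standard by (auto simp: standard_brownian_motion_def)

lemma B_zero: "AE \<omega> in M. B 0 \<omega> = 0"
  using standard by (auto simp: standard_brownian_motion_def)

lemma space_G [simp]: "space (G t) = space M"
  unfolding completed_natural_filtration_def by (rule space_measure_of_conv)

lemma space_F [simp]: "space (F t) = space M"
  unfolding usual_filtration_def by (rule space_measure_of_conv)

lemma G_generator_subset:
  assumes "t \<le> T"
  shows "{B u -` S \<inter> space M | u S. 0 \<le> u \<and> u \<le> t \<and> S \<in> sets borel} \<union> null_sets M \<subseteq> events"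
  using B_measurable assms by (auto intro!: measurable_sets)

lemma sets_G:
  assumes "t \<le> T"
  shows "sets (G t) = sigma_sets (space M)
    ({B u -` S \<inter> space M | u S. 0 \<le> u \<and> u \<le> t \<and> S \<in> sets borel} \<union> null_sets M)"
  unfolding completed_natural_filtration_def
  using G_generator_subset[OF assms] sets.space_closed by (intro sets_measure_of) blast

lemma sets_G_subset: "t \<le> T \<Longrightarrow> sets (G t) \<subseteq> events"
  unfolding sets_G by (intro sets.sigma_sets_subset G_generator_subset)

text \<open>An intersection of sigma-algebras is a sigma-algebra, so the closure taken in the
  definition adds nothing.\<close>

lemma sets_F: "sets (F t) = (\<Inter>u\<in>{t<..}. sets (G (min u T)))"
proof -
  have sub: "(\<Inter>u\<in>{t<..}. sets (G (min u T))) \<subseteq> Pow (space M)"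
    using sets.space_closed[of "G (min (t+1) T)"] by (intro order_trans[OF INF_lower[of "t+1"]]) auto
  have "sigma_algebra (space M) (sets (G (min u T)))" for u
    using sets.sigma_algebra_axioms[of "G (min u T)"] by simp
  then have "sigma_sets (space M) (\<Inter>u\<in>{t<..}. sets (G (min u T))) \<subseteq> sets (G (min v T))" if "v > t" for v
    using that by (intro sigma_algebra.sigma_sets_subset) auto
  then show ?thesis
    unfolding usual_filtration_def sets_measure_of[OF sub] by (auto intro: sigma_sets.Basic)
qed

lemma sets_F_subset_G: "s < r \<Longrightarrow> r \<le> T \<Longrightarrow> sets (F s) \<subseteq> sets (G r)"
  unfolding sets_F by (auto dest!: bspec[where x=r] simp: min_absorb1)

lemma sets_F_subset: "sets (F s) \<subseteq> events"
  using sets_G_subset[of "min (s+1) T"] unfolding sets_F by (auto dest!: bspec[where x="s+1"])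

lemma sets_F_mono: "s \<le> t \<Longrightarrow> sets (F s) \<subseteq> sets (F t)"
  unfolding sets_F by auto

lemma measurable_F_mono: "s \<le> t \<Longrightarrow> X \<in> measurable (F s) N \<Longrightarrow> X \<in> measurable (F t) N"
  using sets_F_mono[of s t] by (auto simp: measurable_def)

lemma measurable_F_M: "X \<in> measurable (F s) N \<Longrightarrow> X \<in> measurable M N"
  using sets_F_subset[of s] by (auto simp: measurable_def)

lemma measurable_F_G: "s < r \<Longrightarrow> r \<le> T \<Longrightarrow> X \<in> measurable (F s) N \<Longrightarrow> X \<in> measurable (G r) N"
  using sets_F_subset_G[of s r] by (auto simp: measurable_def)

lemma B_measurable_G:
  assumes "0 \<le> u" "u \<le> t" "t \<le> T"
  shows "B u \<in> borel_measurable (G t)"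
proof (rule measurableI)
  fix A :: "(real ^ 'd) set" assume "A \<in> sets borel"
  then show "B u -` A \<inter> space (G t) \<in> sets (G t)"
    using assms by (auto simp: sets_G intro!: sigma_sets.Basic)
qed auto

lemma B_measurable_F:
  assumes "0 \<le> u" "u \<le> t" "t \<le> T"
  shows "B u \<in> borel_measurable (F t)"
proof (rule measurableI)
  fix A :: "(real ^ 'd) set" assume "A \<in> sets borel"
  then have "B u -` A \<inter> space M \<in> sets (G (min v T))" if "v > t" for v
    using that assms measurable_sets[OF B_measurable_G[of u "min v T"]] by auto
  then show "B u -` A \<inter> space (F t) \<in> sets (F t)"
    by (auto simp: sets_F)
qed auto

text \<open>The definition of Brownian motion gives independence along one monotone sequence of
  times. Sorting \<open>J\<close> turns every \<open>B j\<close> into a partial sum of such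
  increments, up to the null set where \<open>B 0\<close> is not zero, and the increment over
  \<open>[r,u]\<close> comes later in the same sequence.\<close>

lemma cylinder_indep_increment:
  assumes J: "finite J" "J \<subseteq> {0..r}" and S: "\<And>j. S j \<in> sets borel"
    and r: "0 \<le> r" "r \<le> u" "u \<le> T" and W: "W \<in> sets borel"
  shows "prob {\<omega>\<in>space M. (\<forall>j\<in>J. B j \<omega> \<in> S j) \<and> B u \<omega> - B r \<omega> \<in> W} =
         prob {\<omega>\<in>space M. \<forall>j\<in>J. B j \<omega> \<in> S j} * prob {\<omega>\<in>space M. B u \<omega> - B r \<omega> \<in> W}"
proof -
  define xs where "xs = sorted_list_of_set J"
  define n where "n = length xs"
  have xs: "sorted xs" "set xs = J" using J by (auto simp: xs_def)
  \<comment> \<open>the cylinder depends on the first \<open>n\<close> increments along \<open>t\<close>; increment \<open>n + 1\<close> is \<open>B u - B r\<close>\<close>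
  define t where "t i = (if i = 0 then 0 else if i \<le> n then xs ! (i - 1) else if i = n + 1 then r else u)" for i
  have xsr: "0 \<le> xs ! i" "xs ! i \<le> r" if "i < n" for i
    using J(2) xs(2) nth_mem[of i xs] that by (auto simp: n_def)
  have mono: "mono t"
  proof (rule monoI)
    fix i j :: nat assume "i \<le> j"
    moreover have "xs ! (i - 1) \<le> xs ! (j - 1)" if "j \<le> n" "0 < j"
      using \<open>i \<le> j\<close> that by (intro sorted_nth_mono[OF xs(1)]) (auto simp: n_def)
    moreover have "0 \<le> xs ! (j - 1)" if "j \<le> n" "0 < j" using xsr that by auto
    moreover have "xs ! (i - 1) \<le> r" if "i \<le> n" "0 < i" using xsr that by auto
    ultimately show "t i \<le> t j"
      using r by (cases "i = 0"; cases "i \<le> n"; cases "j \<le> n") (auto simp: t_def)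
  qed
  have rng: "range t \<subseteq> {0..T}"
  proof clarify
    fix i
    have "0 \<le> xs ! (i - 1) \<and> xs ! (i - 1) \<le> r" if "i \<le> n" "0 < i" using xsr[of "i - 1"] that by auto
    then show "t i \<in> {0..T}" using r by (cases "i = 0"; cases "i \<le> n") (auto simp: t_def)
  qed
  define X where "X = (\<lambda>i \<omega>. B (t (Suc i)) \<omega> - B (t i) \<omega>)"
  have ind: "indep_vars (\<lambda>_. borel) X {..<n+2}"
    using standard mono rng unfolding standard_brownian_motion_def X_def by blast
  define A1 where "A1 = {p \<in> space (PiM {..<n+1} (\<lambda>_. borel :: (real^'d) measure)). \<forall>k<n. (\<Sum>i<k+1. p i) \<in> S (xs ! k)}"
  define B1 where "B1 = {p \<in> space (PiM {n+1} (\<lambda>_. borel :: (real^'d) measure)). p (n+1) \<in> W}"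
  have "(\<lambda>p. \<Sum>i<k+1. p i) \<in> borel_measurable (PiM {..<n+1} (\<lambda>_. borel :: (real^'d) measure))" if "k < n" for k
    using that by (intro borel_measurable_sum measurable_component_singleton) auto
  then have A1: "A1 \<in> sets (PiM {..<n+1} (\<lambda>_. borel))"
    unfolding A1_def Ball_def[symmetric] lessThan_iff[symmetric]
    by (intro sets.sets_Collect_finite_All sets_Collect_mem[where N=borel]) (use S in auto)
  have B1: "B1 \<in> sets (PiM {n+1} (\<lambda>_. borel))"
    unfolding B1_def by (intro sets_Collect_mem[OF _ W] measurable_component_singleton) auto
  have iv: "indep_var (PiM {..<n+1} (\<lambda>_. borel)) (\<lambda>\<omega>. restrict (\<lambda>i. X i \<omega>) {..<n+1})
          (PiM {n+1} (\<lambda>_. borel)) (\<lambda>\<omega>. restrict (\<lambda>i. X i \<omega>) {n+1})"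
    by (rule indep_var_restrict[OF ind]) auto
  have tel: "(\<Sum>i<k+1. X i \<omega>) = B (xs ! k) \<omega> - B 0 \<omega>" if "k < n" for k \<omega>
    using that unfolding X_def by (subst sum_lessThan_telescope) (auto simp: t_def)
  have last: "X (n+1) \<omega> = B u \<omega> - B r \<omega>" for \<omega>
    by (auto simp: X_def t_def)
  have ball: "(\<forall>j\<in>J. P j) \<longleftrightarrow> (\<forall>k<n. P (xs ! k))" for P
    unfolding xs(2)[symmetric] n_def by (auto simp: all_set_conv_all_nth)
  have eqA: "(\<lambda>\<omega>. restrict (\<lambda>i. X i \<omega>) {..<n+1}) -` A1 \<inter> space M = {\<omega>\<in>space M. \<forall>k<n. (\<Sum>i<k+1. X i \<omega>) \<in> S (xs ! k)}"
    by (auto simp: A1_def space_PiM)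
  have eqB: "(\<lambda>\<omega>. restrict (\<lambda>i. X i \<omega>) {n+1}) -` B1 \<inter> space M = {\<omega>\<in>space M. B u \<omega> - B r \<omega> \<in> W}"
    by (auto simp: B1_def space_PiM last simp del: One_nat_def)
  have Bm: "B j \<in> borel_measurable M" if "j \<in> J" for j
    using that J r by (intro B_measurable) auto
  have Xm: "X i \<in> borel_measurable M" if "i < n + 2" for i
    using ind that by (auto simp: indep_vars_def)
  have Sm: "{\<omega>\<in>space M. \<forall>j\<in>J. B j \<omega> \<in> S j} \<in> events"
    using S Bm J by (intro sets.sets_Collect_finite_All sets_Collect_mem[where N=borel]) auto
  have Wm: "{\<omega>\<in>space M. B u \<omega> - B r \<omega> \<in> W} \<in> events"
    by (rule sets_Collect_mem[OF _ W]) (use B_measurable[of u] B_measurable[of r] r in auto)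
  have Cm: "(\<lambda>\<omega>. restrict (\<lambda>i. X i \<omega>) {..<n+1}) -` A1 \<inter> space M \<in> events"
    by (rule measurable_sets[OF _ A1]) (use iv in \<open>auto simp: indep_var_eq\<close>)
  have "prob ((\<lambda>\<omega>. (restrict (\<lambda>i. X i \<omega>) {..<n+1}, restrict (\<lambda>i. X i \<omega>) {n+1})) -` (A1 \<times> B1) \<inter> space M) =
    prob ((\<lambda>\<omega>. restrict (\<lambda>i. X i \<omega>) {..<n+1}) -` A1 \<inter> space M) *
    prob ((\<lambda>\<omega>. restrict (\<lambda>i. X i \<omega>) {n+1}) -` B1 \<inter> space M)"
    by (rule indep_varD[OF iv A1 B1])
  also have "(\<lambda>\<omega>. (restrict (\<lambda>i. X i \<omega>) {..<n+1}, restrict (\<lambda>i. X i \<omega>) {n+1})) -` (A1 \<times> B1) \<inter> space M =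
    ((\<lambda>\<omega>. restrict (\<lambda>i. X i \<omega>) {..<n+1}) -` A1 \<inter> space M) \<inter> ((\<lambda>\<omega>. restrict (\<lambda>i. X i \<omega>) {n+1}) -` B1 \<inter> space M)"
    by auto
  also have "prob \<dots> = prob {\<omega>\<in>space M. (\<forall>j\<in>J. B j \<omega> \<in> S j) \<and> B u \<omega> - B r \<omega> \<in> W}"
  proof (rule measure_eq_AE)
    show "AE \<omega> in M. (\<omega> \<in> (\<lambda>\<omega>. restrict (\<lambda>i. X i \<omega>) {..<n+1}) -` A1 \<inter> space M \<inter> ((\<lambda>\<omega>. restrict (\<lambda>i. X i \<omega>) {n+1}) -` B1 \<inter> space M))
      = (\<omega> \<in> {\<omega>\<in>space M. (\<forall>j\<in>J. B j \<omega> \<in> S j) \<and> B u \<omega> - B r \<omega> \<in> W})"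
      unfolding eqA eqB using B_zero by eventually_elim (auto simp: ball tel simp del: One_nat_def)
    have "{\<omega>\<in>space M. (\<forall>j\<in>J. B j \<omega> \<in> S j) \<and> B u \<omega> - B r \<omega> \<in> W} = {\<omega>\<in>space M. \<forall>j\<in>J. B j \<omega> \<in> S j} \<inter> {\<omega>\<in>space M. B u \<omega> - B r \<omega> \<in> W}"
      by auto
    then show "{\<omega>\<in>space M. (\<forall>j\<in>J. B j \<omega> \<in> S j) \<and> B u \<omega> - B r \<omega> \<in> W} \<in> events"
      using Sm Wm by simp
  qed (use Cm Wm eqB in auto)
  also have "prob ((\<lambda>\<omega>. restrict (\<lambda>i. X i \<omega>) {..<n+1}) -` A1 \<inter> space M) = prob {\<omega>\<in>space M. \<forall>j\<in>J. B j \<omega> \<in> S j}"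
  proof (rule measure_eq_AE)
    show "AE \<omega> in M. (\<omega> \<in> (\<lambda>\<omega>. restrict (\<lambda>i. X i \<omega>) {..<n+1}) -` A1 \<inter> space M)
      = (\<omega> \<in> {\<omega>\<in>space M. (\<forall>j\<in>J. B j \<omega> \<in> S j)})"
      unfolding eqA using B_zero by eventually_elim (auto simp: ball tel simp del: One_nat_def)
  qed (use Cm Sm in auto)
  finally show ?thesis unfolding eqB by simp
qed

text \<open>Dynkin's argument. The pi-system \<open>\<A>\<close> consists of the events that agree
  almost surely with a cylinder; working modulo null sets puts the completion into the pi-system
  itself, so both kinds of generators of \<open>G r\<close> are treated together.\<close>

lemma indep_increment_G:
  assumes r: "0 \<le> r" "r \<le> u" "u \<le> T" and X: "X \<in> measurable (G r) N"
    and g: "g \<in> measurable borel L"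
  shows "indep_var N X L (\<lambda>\<omega>. g (B u \<omega> - B r \<omega>))"
proof -
  let ?D = "\<lambda>\<omega>. B u \<omega> - B r \<omega>"
  have Dm: "?D \<in> borel_measurable M"
    using B_measurable[of u] B_measurable[of r] r by auto
  have Bm: "B j \<in> borel_measurable M" if "j \<in> {0..r}" for j
    using that r by (intro B_measurable) auto
  define \<A> where "\<A> = {A\<in>events. \<exists>J S. finite J \<and> J \<subseteq> {0..r} \<and> (\<forall>j. S j \<in> sets borel) \<and> 
      (AE \<omega> in M. \<omega> \<in> A \<longleftrightarrow> (\<forall>j\<in>J. B j \<omega> \<in> S j))}"
  define \<B> where "\<B> = {?D -` W \<inter> space M | W. W \<in> sets borel}"
  have "indep_set \<A> \<B>"
  proof (rule indep_setI)
    show "\<A> \<subseteq> events" by (auto simp: \<A>_def)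
    show "\<B> \<subseteq> events" unfolding \<B>_def using Dm by (auto intro: measurable_sets)
    fix a b assume a: "a \<in> \<A>" and b: "b \<in> \<B>"
    from a obtain J S where J: "finite J" "J \<subseteq> {0..r}" "\<And>j. S j \<in> sets borel" "a \<in> events"
      "AE \<omega> in M. \<omega> \<in> a \<longleftrightarrow> (\<forall>j\<in>J. B j \<omega> \<in> S j)"
      unfolding \<A>_def by blast
    from b obtain W where W: "b = ?D -` W \<inter> space M" "W \<in> sets borel" unfolding \<B>_def by blast
    have bm: "b \<in> events" using W Dm by (auto intro: measurable_sets)
    have Sm: "{\<omega>\<in>space M. \<forall>j\<in>J. B j \<omega> \<in> S j} \<in> events"
      using J Bm by (intro sets.sets_Collect_finite_All sets_Collect_mem[where N=borel]) auto
    have e: "{\<omega>\<in>space M. (\<forall>j\<in>J. B j \<omega> \<in> S j) \<and> ?D \<omega> \<in> W} = {\<omega>\<in>space M. \<forall>j\<in>J. B j \<omega> \<in> S j} \<inter> b"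
      using W by auto
    have "prob (a \<inter> b) = prob {\<omega>\<in>space M. (\<forall>j\<in>J. B j \<omega> \<in> S j) \<and> ?D \<omega> \<in> W}"
      unfolding e using J(5) by (intro measure_eq_AE) (use J(4) bm Sm in \<open>auto\<close>)
    also have "\<dots> = prob {\<omega>\<in>space M. \<forall>j\<in>J. B j \<omega> \<in> S j} * prob {\<omega>\<in>space M. ?D \<omega> \<in> W}"
      by (rule cylinder_indep_increment) (use J r W in auto)
    also have "{\<omega>\<in>space M. ?D \<omega> \<in> W} = b" using W by auto
    also have "prob {\<omega>\<in>space M. \<forall>j\<in>J. B j \<omega> \<in> S j} = prob a"
      using J(5) by (intro measure_eq_AE) (use J(4) bm Sm in \<open>auto\<close>)
    finally show "prob (a \<inter> b) = prob a * prob b" .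
  qed
  moreover have "Int_stable \<A>"
  proof (rule Int_stableI)
    fix a a' assume "a \<in> \<A>" "a' \<in> \<A>"
    then obtain J S J' S' where J: "finite J" "J \<subseteq> {0..r}" "\<And>j. S j \<in> sets borel" "a \<in> events"
      "AE \<omega> in M. \<omega> \<in> a \<longleftrightarrow> (\<forall>j\<in>J. B j \<omega> \<in> S j)" and
      J': "finite J'" "J' \<subseteq> {0..r}" "\<And>j. S' j \<in> sets borel" "a' \<in> events"
      "AE \<omega> in M. \<omega> \<in> a' \<longleftrightarrow> (\<forall>j\<in>J'. B j \<omega> \<in> S' j)"
      unfolding \<A>_def by blast
    define S'' where "S'' j = (if j \<in> J then S j else UNIV) \<inter> (if j \<in> J' then S' j else UNIV)" for j
    have "AE \<omega> in M. \<omega> \<in> a \<inter> a' \<longleftrightarrow> (\<forall>j\<in>J\<union>J'. B j \<omega> \<in> S'' j)"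
      using J(5) J'(5) by eventually_elim (auto simp: S''_def)
    moreover have "S'' j \<in> sets borel" for j using J(3) J'(3) by (auto simp: S''_def)
    ultimately show "a \<inter> a' \<in> \<A>"
      unfolding \<A>_def using J(1,2,4) J'(1,2,4) by (intro CollectI conjI exI[of _ "J \<union> J'"] exI[of _ S'']) auto
  qed
  moreover have "Int_stable \<B>"
  proof (rule Int_stableI)
    fix a b assume "a \<in> \<B>" "b \<in> \<B>"
    then obtain V W where "a = ?D -` V \<inter> space M" "b = ?D -` W \<inter> space M" "V \<in> sets borel" "W \<in> sets borel"
      unfolding \<B>_def by blast
    then show "a \<inter> b \<in> \<B>" unfolding \<B>_def by (intro CollectI exI[of _ "V \<inter> W"]) auto
  qed
  ultimately have ind: "indep_set (sigma_sets (space M) \<A>) (sigma_sets (space M) \<B>)"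
    by (rule indep_set_sigma_sets)
  have G\<A>: "sets (G r) \<subseteq> sigma_sets (space M) \<A>"
  proof -
    have "B v -` S \<inter> space M \<in> \<A>" if "0 \<le> v" "v \<le> r" "S \<in> sets borel" for v S
      unfolding \<A>_def using that r Bm[of v]
      by (intro CollectI conjI exI[of _ "{v}"] exI[of _ "\<lambda>_. S"]) (auto intro: measurable_sets)
    \<comment> \<open>A null set agrees almost surely with the cylinder that requires
      \<open>B 0\<close> to lie in the empty set.\<close>
    moreover have "N \<in> \<A>" if "N \<in> null_sets M" for N
      unfolding \<A>_def using that r AE_not_in[OF that]
      by (intro CollectI conjI exI[of _ "{0}"] exI[of _ "\<lambda>_. {}"]) auto
    ultimately show ?thesis
      using r by (subst sets_G) (auto intro!: sigma_sets_mono')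
  qed
  have "X \<in> measurable M N" using X sets_G_subset[of r] r by (auto simp: measurable_def)
  then show ?thesis
    unfolding indep_var_eq
  proof (intro conjI)
    have sub: "sigma_sets (space M) {X -` A \<inter> space M |A. A \<in> sets N} \<subseteq> sigma_sets (space M) \<A>"
    proof (rule sigma_sets_mono)
      show "{X -` A \<inter> space M |A. A \<in> sets N} \<subseteq> sigma_sets (space M) \<A>"
        using measurable_sets[OF X] G\<A> by auto
    qed
    have sub': "{(\<lambda>\<omega>. g (?D \<omega>)) -` A \<inter> space M |A. A \<in> sets L} \<subseteq> \<B>"
    proof clarify
      fix A assume "A \<in> sets L"
      then have "g -` A \<in> sets borel" using measurable_sets[OF g] by simp
      then show "(\<lambda>\<omega>. g (?D \<omega>)) -` A \<inter> space M \<in> \<B>"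
        unfolding \<B>_def by (intro CollectI exI[of _ "g -` A"]) auto
    qed
    show "indep_set (sigma_sets (space M) {X -` A \<inter> space M |A. A \<in> sets N})
     (sigma_sets (space M) {(\<lambda>\<omega>. g (?D \<omega>)) -` A \<inter> space M |A. A \<in> sets L})"
      unfolding indep_set_def
      by (rule indep_sets_mono_sets[OF ind[unfolded indep_set_def]])
        (use sub sigma_sets_mono'[OF sub'] in \<open>auto split: bool.split\<close>)
  qed (use measurable_compose[OF Dm g] in auto)
qed

lemma B_component_measurable_F:
  "0 \<le> u \<Longrightarrow> u \<le> t \<Longrightarrow> t \<le> T \<Longrightarrow> (\<lambda>\<omega>. B u \<omega> $ i) \<in> borel_measurable (F t)"
  by (rule measurable_compose[OF B_measurable_F borel_measurable_nth])

end

section \<open>Square integrable random variables and moments of the increments\<close>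

definition square_integrable :: "'a measure \<Rightarrow> ('a \<Rightarrow> real) \<Rightarrow> bool" where
  "square_integrable M X \<longleftrightarrow> X \<in> borel_measurable M \<and> integrable M (\<lambda>x. (X x)\<^sup>2)"

lemma square_integrable_measurable: "square_integrable M X \<Longrightarrow> X \<in> borel_measurable M"
  by (simp add: square_integrable_def)

lemma square_integrable_integrable_square: "square_integrable M X \<Longrightarrow> integrable M (\<lambda>x. (X x)\<^sup>2)"
  by (simp add: square_integrable_def)

lemma integrable_mult_square_integrable:
  assumes "square_integrable M X" "square_integrable M Y"
  shows "integrable M (\<lambda>x. X x * Y x)"
proof (rule Bochner_Integration.integrable_bound)
  show "integrable M (\<lambda>x. (X x)\<^sup>2 + (Y x)\<^sup>2)" "(\<lambda>x. X x * Y x) \<in> borel_measurable M"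
    using assms by (auto simp: square_integrable_def)
  have "\<bar>a * b\<bar> \<le> a\<^sup>2 + b\<^sup>2" for a b :: real
  proof -
    have "0 \<le> \<bar>a\<bar> * \<bar>b\<bar>" by simp
    then show ?thesis using sum_squares_bound[of "\<bar>a\<bar>" "\<bar>b\<bar>"] unfolding abs_mult power2_abs by linarith
  qed
  then show "AE x in M. norm (X x * Y x) \<le> norm ((X x)\<^sup>2 + (Y x)\<^sup>2)" by auto
qed

lemma square_integrable_add:
  assumes "square_integrable M X" "square_integrable M Y"
  shows "square_integrable M (\<lambda>x. X x + Y x)"
  using assms integrable_mult_square_integrable[OF assms]
  by (auto simp: square_integrable_def power2_sum mult.assoc)

lemma square_integrable_cmult:
  "square_integrable M X \<Longrightarrow> square_integrable M (\<lambda>x. c * X x)"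
  by (auto simp: square_integrable_def power_mult_distrib)

lemma square_integrable_diff:
  "square_integrable M X \<Longrightarrow> square_integrable M Y \<Longrightarrow> square_integrable M (\<lambda>x. X x - Y x)"
  using square_integrable_add[OF _ square_integrable_cmult[of M Y "-1"], of X] by simp

lemma square_integrable_zero [simp]: "square_integrable M (\<lambda>x. 0)"
  by (simp add: square_integrable_def)

lemma square_integrable_sum:
  "(\<And>i. i \<in> I \<Longrightarrow> square_integrable M (X i)) \<Longrightarrow> square_integrable M (\<lambda>x. \<Sum>i\<in>I. X i x)"
  by (induction I rule: infinite_finite_induct) (auto intro: square_integrable_add)

lemma square_integrable_sum_list:
  "(\<And>i. i \<in> set xs \<Longrightarrow> square_integrable M (X i)) \<Longrightarrow> square_integrable M (\<lambda>x. \<Sum>i\<leftarrow>xs. X i x)"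
  by (induction xs) (auto intro: square_integrable_add)

lemma square_integrable_mult_bounded:
  assumes "square_integrable M X" "Y \<in> borel_measurable M" "\<And>x. x \<in> space M \<Longrightarrow> \<bar>Y x\<bar> \<le> C"
  shows "square_integrable M (\<lambda>x. Y x * X x)"
  unfolding square_integrable_def
proof
  show "integrable M (\<lambda>x. (Y x * X x)\<^sup>2)"
  proof (rule Bochner_Integration.integrable_bound)
    show "integrable M (\<lambda>x. C\<^sup>2 * (X x)\<^sup>2)" using assms(1) by (auto simp: square_integrable_def)
    have "(Y x)\<^sup>2 \<le> C\<^sup>2" if "x \<in> space M" for x
      using power_mono[OF assms(3)[OF that] abs_ge_zero, of 2] by simp
    then show "AE x in M. norm ((Y x * X x)\<^sup>2) \<le> norm (C\<^sup>2 * (X x)\<^sup>2)"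
      by (intro AE_I2) (auto simp: power_mult_distrib intro!: mult_right_mono)
  qed (use assms in \<open>auto simp: square_integrable_def\<close>)
qed (use assms in \<open>auto simp: square_integrable_def\<close>)

text \<open>The integral of \<open>(X + c Y)\<^sup>2\<close> is a nonnegative quadratic polynomial
  in \<open>c\<close>; it is evaluated at its minimiser \<open>- P / Q\<close>.\<close>

lemma Cauchy_Schwarz_integral:
  assumes "square_integrable M X" "square_integrable M Y"
  shows "(\<integral>x. X x * Y x \<partial>M)\<^sup>2 \<le> (\<integral>x. (X x)\<^sup>2 \<partial>M) * (\<integral>x. (Y x)\<^sup>2 \<partial>M)"
proof -
  define P where "P = (\<integral>x. X x * Y x \<partial>M)"
  define A where "A = (\<integral>x. (X x)\<^sup>2 \<partial>M)"
  define Q where "Q = (\<integral>x. (Y x)\<^sup>2 \<partial>M)"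
  have i: "integrable M (\<lambda>x. (X x)\<^sup>2)" "integrable M (\<lambda>x. (Y x)\<^sup>2)" "integrable M (\<lambda>x. X x * Y x)"
    using assms integrable_mult_square_integrable[OF assms] by (auto simp: square_integrable_def)
  have nn: "0 \<le> A + 2 * c * P + c\<^sup>2 * Q" for c
  proof -
    have "0 \<le> (\<integral>x. (X x + c * Y x)\<^sup>2 \<partial>M)" by simp
    also have "\<dots> = (\<integral>x. ((X x)\<^sup>2 + (2 * c) * (X x * Y x)) + c\<^sup>2 * (Y x)\<^sup>2 \<partial>M)"
      by (intro Bochner_Integration.integral_cong) (auto simp: power2_eq_square algebra_simps)
    also have "\<dots> = A + 2 * c * P + c\<^sup>2 * Q"
      unfolding A_def P_def Q_def using i by simp
    finally show ?thesis .
  qed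
  have "P\<^sup>2 \<le> A * Q"
  proof (cases "Q = 0")
    case True
    have "P = 0"
    proof (rule ccontr)
      assume "P \<noteq> 0"
      \<comment> \<open>For \<open>Q = 0\<close> the polynomial is affine, and at this point it
        would take the value \<open>-1\<close>.\<close>
      then show False using nn[of "- (A + 1) / (2 * P)"] True by (simp add: field_simps)
    qed
    then show ?thesis using True by simp
  next
    case False
    then have "Q > 0" by (auto simp: Q_def less_le)
    then show ?thesis using nn[of "- P / Q"] by (simp add: field_simps power2_eq_square)
  qed
  then show ?thesis by (simp add: A_def P_def Q_def)
qed

text \<open>Carries orthogonality relations from simple integrals to their limits.\<close>

lemma tendsto_integral_mult_L2:
  assumes X: "\<And>n. square_integrable M (X n)" "square_integrable M Z" and Y: "square_integrable M Y"
    and lim: "(\<lambda>n. \<integral>x. (X n x - Z x)\<^sup>2 \<partial>M) \<longlonglongrightarrow> 0"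
  shows "(\<lambda>n. \<integral>x. Y x * X n x \<partial>M) \<longlonglongrightarrow> (\<integral>x. Y x * Z x \<partial>M)"
proof -
  have d: "square_integrable M (\<lambda>x. X n x - Z x)" for n using X by (intro square_integrable_diff)
  have eq: "(\<integral>x. Y x * X n x \<partial>M) - (\<integral>x. Y x * Z x \<partial>M) = (\<integral>x. Y x * (X n x - Z x) \<partial>M)" for n
    using integrable_mult_square_integrable[OF Y X(1)] integrable_mult_square_integrable[OF Y X(2)]
    by (simp add: right_diff_distrib)
  have "(\<lambda>n. ((\<integral>x. Y x * X n x \<partial>M) - (\<integral>x. Y x * Z x \<partial>M))\<^sup>2) \<longlonglongrightarrow> 0"
  proof (rule tendsto_sandwich[OF _ _ tendsto_const])
    show "\<forall>\<^sub>F n in sequentially. ((\<integral>x. Y x * X n x \<partial>M) - (\<integral>x. Y x * Z x \<partial>M))\<^sup>2 \<le> (\<integral>x. (Y x)\<^sup>2 \<partial>M) * (\<integral>x. (X n x - Z x)\<^sup>2 \<partial>M)"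
      unfolding eq by (intro always_eventually allI Cauchy_Schwarz_integral Y d)
    show "(\<lambda>n. (\<integral>x. (Y x)\<^sup>2 \<partial>M) * (\<integral>x. (X n x - Z x)\<^sup>2 \<partial>M)) \<longlonglongrightarrow> 0"
      using tendsto_mult_left[OF lim] by simp
  qed simp
  then show ?thesis by (subst LIM_zero_iff[symmetric]) (simp add: power_tendsto_0_iff)
qed

context finite_measure begin

lemma square_integrable_const [simp]: "square_integrable M (\<lambda>x. c)"
  by (simp add: square_integrable_def)

lemma square_integrable_integrable: "square_integrable M X \<Longrightarrow> integrable M X"
  using integrable_mult_square_integrable[OF _ square_integrable_const[of 1], of X] by simp

lemma square_integrable_bounded:
  "Y \<in> borel_measurable M \<Longrightarrow> (\<And>x. x \<in> space M \<Longrightarrow> \<bar>Y x\<bar> \<le> C) \<Longrightarrow> square_integrable M Y"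
  using square_integrable_mult_bounded[OF square_integrable_const[of 1], of Y C] by simp

end

section \<open>Moments of the Brownian increments\<close>

context brownian_motion begin

abbreviation (input) dB :: "real \<Rightarrow> real \<Rightarrow> 'd \<Rightarrow> 'w \<Rightarrow> real" where
  "dB s u i \<omega> \<equiv> B u \<omega> $ i - B s \<omega> $ i"

text \<open>The normal law and the independence of the coordinates are given for
  \<open>s < u\<close>; for \<open>s = u\<close> every term is zero.\<close>

lemma
  assumes "0 \<le> s" "s \<le> u" "u \<le> T"
  shows square_integrable_dB: "square_integrable M (dB s u i)"
    and expectation_dB: "expectation (dB s u i) = 0"
    and expectation_dB_mult: "expectation (\<lambda>\<omega>. dB s u i \<omega> * dB s u j \<omega>) = (if i = j then u - s else 0)"
proof -
  have *: "square_integrable M (dB s u i) \<and> expectation (dB s u i) = 0 \<and> expectation (\<lambda>\<omega>. (dB s u i \<omega>)\<^sup>2) = u - s" for i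
  proof (cases "s = u")
    case False
    with assms have su: "s < u" by simp
    then have D: "distributed M lborel (dB s u i) (normal_density 0 (sqrt (u - s)))"
      using standard assms by (auto simp: standard_brownian_motion_def)
    have e: "expectation (dB s u i) = 0"
      using normal_distributed_expectation[OF _ D] su by simp
    have "integrable lborel (\<lambda>x. normal_density 0 (sqrt (u - s)) x * (x - 0)^2)"
      using su by (intro integrable_normal_moment) simp
    then have "integrable M (\<lambda>\<omega>. (dB s u i \<omega>)\<^sup>2)"
      using distributed_integrable[OF D, of "\<lambda>x. x^2"] by simp
    moreover have "dB s u i \<in> borel_measurable M"
      using distributed_measurable[OF D] by simp
    moreover have "expectation (\<lambda>\<omega>. (dB s u i \<omega>)\<^sup>2) = u - s"
      using normal_distributed_variance[OF _ D] su e by simp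
    ultimately show ?thesis using e by (simp add: square_integrable_def)
  qed simp
  show "square_integrable M (dB s u i)" "expectation (dB s u i) = 0" using *[of i] by auto
  show "expectation (\<lambda>\<omega>. dB s u i \<omega> * dB s u j \<omega>) = (if i = j then u - s else 0)"
  proof (cases "i = j")
    case True
    then show ?thesis using *[of i] by (simp add: power2_eq_square)
  next
    case False
    show ?thesis
    proof (cases "s = u")
      case False
      with assms have "indep_vars (\<lambda>_. borel) (\<lambda>(i::'d) \<omega>. dB s u i \<omega>) UNIV"
        using standard by (auto simp: standard_brownian_motion_def)
      then have "indep_vars (\<lambda>_. borel) (\<lambda>(i::'d) \<omega>. dB s u i \<omega>) {i, j}"
        by (rule indep_vars_subset) auto
      then have "expectation (\<lambda>\<omega>. \<Prod>k\<in>{i,j}. dB s u k \<omega>) = (\<Prod>k\<in>{i,j}. expectation (dB s u k))"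
        using * by (intro indep_vars_lebesgue_integral square_integrable_integrable) auto
      then show ?thesis using \<open>i \<noteq> j\<close> * by simp
    qed simp
  qed
qed

text \<open>The function \<open>g\<close> will be a coordinate or a product of two
  coordinates.\<close>

lemma indep_F_increment:
  assumes "0 \<le> s" "s < r" "r \<le> u" "u \<le> T" and X: "X \<in> borel_measurable (F s)"
    and g: "g \<in> borel_measurable borel" and Y: "integrable M (\<lambda>\<omega>. g (B u \<omega> - B r \<omega>))" and iX: "integrable M X"
  shows "expectation (\<lambda>\<omega>. X \<omega> * g (B u \<omega> - B r \<omega>) :: real) = expectation X * expectation (\<lambda>\<omega>. g (B u \<omega> - B r \<omega>))"
proof -
  have "indep_var borel X borel (\<lambda>\<omega>. g (B u \<omega> - B r \<omega>))"
    using assms by (intro indep_increment_G measurable_F_G[OF _ _ X]) auto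
  from indep_var_lebesgue_integral[OF this iX Y] show ?thesis .
qed

text \<open>
  The filtration is right-continuous, so an \<open>\<F>\<^sub>s\<close>-measurable variable is only known to be measurable
  for the natural filtration at times \<open>r > s\<close>; hence the limits \<open>r \<down> s\<close> in the next two proofs.
\<close>

lemma expectation_mult_dB:
  assumes s: "0 \<le> s" "s \<le> u" "u \<le> T" and X: "X \<in> borel_measurable (F s)" "square_integrable M X"
  shows "expectation (\<lambda>\<omega>. X \<omega> * dB s u i \<omega>) = 0"
proof (cases "s = u")
  case False
  with s have su: "s < u" by simp
  \<comment> \<open>The increment is cut at \<open>r\<close>. The part after \<open>r\<close> is
    independent of \<open>X\<close> and has mean zero; the part before \<open>r\<close> is small by
    Cauchy-Schwarz.\<close>
  have bound: "(expectation (\<lambda>\<omega>. X \<omega> * dB s u i \<omega>))\<^sup>2 \<le> expectation (\<lambda>\<omega>. (X \<omega>)\<^sup>2) * (r - s)" if r: "s < r" "r < u" for r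
  proof -
    have sr: "square_integrable M (dB s r i)" "square_integrable M (dB r u i)"
      using s r by (auto intro!: square_integrable_dB)
    have "expectation (\<lambda>\<omega>. X \<omega> * dB r u i \<omega>) = expectation X * expectation (dB r u i)"
      using indep_F_increment[of s r u X "\<lambda>x. x $ i"] s r X sr square_integrable_integrable by auto
    also have "\<dots> = 0" using s r by (simp add: expectation_dB)
    finally have "expectation (\<lambda>\<omega>. X \<omega> * dB s r i \<omega>) = expectation (\<lambda>\<omega>. X \<omega> * dB s r i \<omega> + X \<omega> * dB r u i \<omega>)"
      using integrable_mult_square_integrable[OF X(2) sr(1)] integrable_mult_square_integrable[OF X(2) sr(2)]
      by simp
    also have "\<dots> = expectation (\<lambda>\<omega>. X \<omega> * dB s u i \<omega>)"
      by (intro Bochner_Integration.integral_cong) (auto simp: algebra_simps)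
    finally have "(expectation (\<lambda>\<omega>. X \<omega> * dB s u i \<omega>))\<^sup>2 \<le> expectation (\<lambda>\<omega>. (X \<omega>)\<^sup>2) * expectation (\<lambda>\<omega>. (dB s r i \<omega>)\<^sup>2)"
      using Cauchy_Schwarz_integral[OF X(2) sr(1)] by simp
    also have "expectation (\<lambda>\<omega>. (dB s r i \<omega>)\<^sup>2) = r - s"
      using expectation_dB_mult[of s r i i] s r by (simp add: power2_eq_square)
    finally show ?thesis .
  qed
  have "(expectation (\<lambda>\<omega>. X \<omega> * dB s u i \<omega>))\<^sup>2 \<le> 0"
  proof (rule tendsto_le[of "at_right s"])
    show "((\<lambda>r. expectation (\<lambda>\<omega>. (X \<omega>)\<^sup>2) * (r - s)) \<longlongrightarrow> 0) (at_right s)"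
      by (auto intro!: tendsto_eq_intros)
    show "\<forall>\<^sub>F r in at_right s. (expectation (\<lambda>\<omega>. X \<omega> * dB s u i \<omega>))\<^sup>2 \<le> expectation (\<lambda>\<omega>. (X \<omega>)\<^sup>2) * (r - s)"
      using su bound by (auto simp: eventually_at_right)
  qed auto
  then show ?thesis by simp
qed simp

lemma expectation_mult_dB_dB:
  assumes s: "0 \<le> s" "s \<le> u" "u \<le> T" and X: "X \<in> borel_measurable (F s)"
    and C: "\<And>\<omega>. \<omega> \<in> space M \<Longrightarrow> \<bar>X \<omega>\<bar> \<le> C"
  shows "expectation (\<lambda>\<omega>. X \<omega> * (dB s u i \<omega> * dB s u j \<omega>)) = (if i = j then u - s else 0) * expectation X"
proof (cases "s = u")
  case False
  with s have su: "s < u" by simp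
  have XM: "X \<in> borel_measurable M" by (rule measurable_F_M[OF X])
  have Xsq: "square_integrable M X" using XM C by (rule square_integrable_bounded)
  let ?d = "if i = j then 1 else (0::real)"
  \<comment> \<open>Both factors are cut at \<open>r\<close>. The mixed terms vanish by
    \<open>expectation_mult_dB\<close> at time \<open>r\<close>, the product over
    \<open>[r,u]\<close> is independent of \<open>X\<close>, and the product over
    \<open>[s,r]\<close> contributes at most \<open>C * (r - s)\<close>.\<close>
  have bound: "\<bar>expectation (\<lambda>\<omega>. X \<omega> * (dB s u i \<omega> * dB s u j \<omega>)) - ?d * (u - r) * expectation X\<bar> \<le> C * (r - s)" if r: "s < r" "r < u" for r
  proof -
    have sr: "square_integrable M (dB s r i)" "square_integrable M (dB r u i)" for i
      using s r by (auto intro!: square_integrable_dB)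
    have Xe: "square_integrable M (\<lambda>\<omega>. X \<omega> * dB s r i \<omega>)" "square_integrable M (\<lambda>\<omega>. X \<omega> * dB r u i \<omega>)" for i
      using square_integrable_mult_bounded[OF sr(1) XM C] square_integrable_mult_bounded[OF sr(2) XM C] by auto
    have XeF: "(\<lambda>\<omega>. X \<omega> * dB s r i \<omega>) \<in> borel_measurable (F r)" for i
      using measurable_F_mono[OF _ X, of r] B_component_measurable_F[of s r] B_component_measurable_F[of r r] r s 
      by auto
    have i0: "expectation (\<lambda>\<omega>. X \<omega> * dB s r i \<omega> * dB r u j \<omega>) = 0" for i j
      using s r Xe XeF by (intro expectation_mult_dB) auto
    have "expectation (\<lambda>\<omega>. X \<omega> * (dB r u i \<omega> * dB r u j \<omega>)) = expectation X * expectation (\<lambda>\<omega>. dB r u i \<omega> * dB r u j \<omega>)"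
      using indep_F_increment[of s r u X "\<lambda>x. x $ i * x $ j"] s r X Xsq integrable_mult_square_integrable[OF sr(2) sr(2), of i j] square_integrable_integrable by auto
    also have "\<dots> = ?d * (u - r) * expectation X"
      using s r by (simp add: expectation_dB_mult)
    finally have i1: "expectation (\<lambda>\<omega>. X \<omega> * (dB r u i \<omega> * dB r u j \<omega>)) = ?d * (u - r) * expectation X" .
    have int: "integrable M (\<lambda>\<omega>. X \<omega> * dB s r i \<omega> * dB s r j \<omega>)" "integrable M (\<lambda>\<omega>. X \<omega> * dB s r i \<omega> * dB r u j \<omega>)"
      "integrable M (\<lambda>\<omega>. X \<omega> * dB s r j \<omega> * dB r u i \<omega>)" "integrable M (\<lambda>\<omega>. X \<omega> * (dB r u i \<omega> * dB r u j \<omega>))"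
      using integrable_mult_square_integrable[OF Xe(1) sr(1), of i j] integrable_mult_square_integrable[OF Xe(1) sr(2), of i j]
        integrable_mult_square_integrable[OF Xe(1) sr(2), of j i] integrable_mult_square_integrable[OF Xe(2) sr(2), of i j] by (auto simp: mult.assoc)
    have "expectation (\<lambda>\<omega>. X \<omega> * (dB s u i \<omega> * dB s u j \<omega>)) =
      expectation (\<lambda>\<omega>. X \<omega> * dB s r i \<omega> * dB s r j \<omega> + X \<omega> * dB s r i \<omega> * dB r u j \<omega> + X \<omega> * dB s r j \<omega> * dB r u i \<omega> + X \<omega> * (dB r u i \<omega> * dB r u j \<omega>))"
      by (intro Bochner_Integration.integral_cong) (auto simp: algebra_simps)
    also have "\<dots> = expectation (\<lambda>\<omega>. X \<omega> * dB s r i \<omega> * dB s r j \<omega>) + ?d * (u - r) * expectation X"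
      using int by (simp add: i0 i1)
    finally have "\<bar>expectation (\<lambda>\<omega>. X \<omega> * (dB s u i \<omega> * dB s u j \<omega>)) - ?d * (u - r) * expectation X\<bar> = 
      \<bar>expectation (\<lambda>\<omega>. X \<omega> * dB s r i \<omega> * dB s r j \<omega>)\<bar>" by simp
    also have "\<dots> \<le> expectation (\<lambda>\<omega>. C * (((dB s r i \<omega>)\<^sup>2 + (dB s r j \<omega>)\<^sup>2) / 2))"
      unfolding real_norm_def[symmetric]
    proof (rule order_trans[OF integral_norm_bound integral_mono])
      fix \<omega> assume "\<omega> \<in> space M"
      then have "\<bar>X \<omega>\<bar> \<le> C" by (rule C)
      moreover have "\<bar>dB s r i \<omega> * dB s r j \<omega>\<bar> \<le> ((dB s r i \<omega>)\<^sup>2 + (dB s r j \<omega>)\<^sup>2) / 2"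
        using sum_squares_bound[of "\<bar>dB s r i \<omega>\<bar>" "\<bar>dB s r j \<omega>\<bar>"] by (simp add: abs_mult)
      ultimately show "norm (X \<omega> * dB s r i \<omega> * dB s r j \<omega>) \<le> C * (((dB s r i \<omega>)\<^sup>2 + (dB s r j \<omega>)\<^sup>2) / 2)"
        unfolding real_norm_def mult.assoc abs_mult[of "X \<omega>"] by (intro mult_mono) auto
    qed (use int sr in \<open>auto simp: square_integrable_def\<close>)
    also have "\<dots> = C * (r - s)"
      using sr expectation_dB_mult[of s r i i] expectation_dB_mult[of s r j j] s r
      by (simp add: power2_eq_square[symmetric] square_integrable_def)
    finally show ?thesis .
  qed
  have lim: "((\<lambda>r. expectation (\<lambda>\<omega>. X \<omega> * (dB s u i \<omega> * dB s u j \<omega>)) - ?d * (u - r) * expectation X)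
     \<longlongrightarrow> expectation (\<lambda>\<omega>. X \<omega> * (dB s u i \<omega> * dB s u j \<omega>)) - ?d * (u - s) * expectation X) (at_right s)"
    by (intro tendsto_intros)
  have "\<bar>expectation (\<lambda>\<omega>. X \<omega> * (dB s u i \<omega> * dB s u j \<omega>)) - ?d * (u - s) * expectation X\<bar> \<le> 0"
  proof (rule tendsto_le[OF _ _ tendsto_rabs[OF lim]])
    show "((\<lambda>r. C * (r - s)) \<longlongrightarrow> 0) (at_right s)"
      by (auto intro!: tendsto_eq_intros)
    show "\<forall>\<^sub>F r in at_right s. \<bar>expectation (\<lambda>\<omega>. X \<omega> * (dB s u i \<omega> * dB s u j \<omega>)) - ?d * (u - r) * expectation X\<bar> \<le> C * (r - s)"
      using su bound by (auto simp: eventually_at_right)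
  qed auto
  then show ?thesis by auto
qed simp

end

section \<open>Integrals of simple integrands\<close>

context brownian_motion begin

abbreviation (input) inc :: "real \<Rightarrow> real \<Rightarrow> ('w \<Rightarrow> real ^ 'd) \<Rightarrow> 'w \<Rightarrow> real" where
  "inc s u H \<omega> \<equiv> H \<omega> \<bullet> (B u \<omega> - B s \<omega>)"

definition bounded_at :: "real \<Rightarrow> ('w \<Rightarrow> real ^ 'd) \<Rightarrow> bool" where
  "bounded_at s H \<longleftrightarrow> H \<in> borel_measurable (F s) \<and> (\<exists>C. \<forall>\<omega>\<in>space M. norm (H \<omega>) \<le> C)"

lemma bounded_at_mono: "bounded_at s H \<Longrightarrow> s \<le> t \<Longrightarrow> bounded_at t H"
  unfolding bounded_at_def using measurable_F_mono by blast

lemma inc_eq_sum: "x \<bullet> (B u \<omega> - B s \<omega>) = (\<Sum>i\<in>UNIV. x $ i * dB s u i \<omega>)"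
  by (simp add: inner_vec_def)

lemma bounded_at_component:
  assumes "bounded_at s H"
  shows "(\<lambda>\<omega>. H \<omega> $ i) \<in> borel_measurable (F s)" "(\<lambda>\<omega>. H \<omega> $ i) \<in> borel_measurable M"
    "\<exists>C. \<forall>i. \<forall>\<omega>\<in>space M. \<bar>H \<omega> $ i\<bar> \<le> C"
proof -
  show m: "(\<lambda>\<omega>. H \<omega> $ i) \<in> borel_measurable (F s)"
    using assms by (intro measurable_compose[OF _ borel_measurable_nth]) (auto simp: bounded_at_def)
  show "(\<lambda>\<omega>. H \<omega> $ i) \<in> borel_measurable M" by (rule measurable_F_M[OF m])
  obtain C where "\<forall>\<omega>\<in>space M. norm (H \<omega>) \<le> C"
    using assms by (auto simp: bounded_at_def)
  then show "\<exists>C. \<forall>i. \<forall>\<omega>\<in>space M. \<bar>H \<omega> $ i\<bar> \<le> C"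
    using component_le_norm_cart order_trans by (metis (no_types))
qed

lemma square_integrable_inc:
  assumes "bounded_at s H" "0 \<le> s" "s \<le> u" "u \<le> T"
  shows "square_integrable M (inc s u H)"
proof -
  obtain C where C_bound: "\<forall>i. \<forall>\<omega>\<in>space M. \<bar>H \<omega> $ i\<bar> \<le> C"
    using bounded_at_component(3)[OF assms(1)] ..
  note C = bounded_at_component(1,2)[OF assms(1)] C_bound[rule_format]
  have "square_integrable M (\<lambda>\<omega>. H \<omega> $ i * dB s u i \<omega>)" for i
    by (rule square_integrable_mult_bounded[OF square_integrable_dB C(2,3)]) (fact assms)+
  then show ?thesis
    unfolding inc_eq_sum by (rule square_integrable_sum)
qed

lemma inc_measurable_F:
  assumes "bounded_at s H" "0 \<le> s" "s \<le> u" "u \<le> T"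
  shows "inc s u H \<in> borel_measurable (F u)"
proof -
  have "H \<in> borel_measurable (F u)" using assms bounded_at_mono[of s H u] by (auto simp: bounded_at_def)
  then show ?thesis
    using B_measurable_F[of s u] B_measurable_F[of u u] assms by (intro borel_measurable_inner) auto
qed

lemma expectation_mult_inc:
  assumes s: "0 \<le> s" "s \<le> u" "u \<le> T" and X: "X \<in> borel_measurable (F s)" "square_integrable M X"
    and H: "bounded_at s H"
  shows "expectation (\<lambda>\<omega>. X \<omega> * inc s u H \<omega>) = 0"
proof -
  obtain C where C_bound: "\<forall>i. \<forall>\<omega>\<in>space M. \<bar>H \<omega> $ i\<bar> \<le> C"
    using bounded_at_component(3)[OF H] ..
  note C = bounded_at_component(1,2)[OF H] C_bound[rule_format]
  have sq: "square_integrable M (\<lambda>\<omega>. H \<omega> $ i * X \<omega>)" for i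
    by (rule square_integrable_mult_bounded[OF X(2) C(2) C(3)])
  have "expectation (\<lambda>\<omega>. X \<omega> * inc s u H \<omega>) = expectation (\<lambda>\<omega>. \<Sum>i\<in>UNIV. (H \<omega> $ i * X \<omega>) * dB s u i \<omega>)"
    unfolding inc_eq_sum by (intro Bochner_Integration.integral_cong) (auto simp: sum_distrib_left mult_ac)
  also have "\<dots> = (\<Sum>i\<in>UNIV. expectation (\<lambda>\<omega>. (H \<omega> $ i * X \<omega>) * dB s u i \<omega>))"
    by (intro Bochner_Integration.integral_sum integrable_mult_square_integrable[OF sq] square_integrable_dB s)
  also have "\<dots> = 0"
    by (intro sum.neutral ballI expectation_mult_dB s sq borel_measurable_times C X)
  finally show ?thesis .
qed

text \<open>In coordinates the products with \<open>i \<noteq> j\<close> average to zero, and the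
  diagonal that remains is the inner product.\<close>

lemma expectation_inc_same:
  assumes s: "0 \<le> s" "s \<le> u" "u \<le> T" and H: "bounded_at s H" and H': "bounded_at s H'"
  shows "expectation (\<lambda>\<omega>. inc s u H \<omega> * inc s u H' \<omega>) = (u - s) * expectation (\<lambda>\<omega>. H \<omega> \<bullet> H' \<omega>)"
proof -
  obtain C where C_bound: "\<forall>i. \<forall>\<omega>\<in>space M. \<bar>H \<omega> $ i\<bar> \<le> C"
    using bounded_at_component(3)[OF H] ..
  note C = bounded_at_component(1,2)[OF H] C_bound[rule_format]
  obtain C' where C'_bound: "\<forall>i. \<forall>\<omega>\<in>space M. \<bar>H' \<omega> $ i\<bar> \<le> C'"
    using bounded_at_component(3)[OF H'] ..
  note C' = bounded_at_component(1,2)[OF H'] C'_bound[rule_format]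
  have bd: "\<bar>H \<omega> $ i * H' \<omega> $ j\<bar> \<le> C * C'" if "\<omega> \<in> space M" for \<omega> i j
    unfolding abs_mult using C(3)[OF that] C'(3)[OF that]
    by (intro mult_mono) (auto intro: order_trans[OF abs_ge_zero])
  have sq1: "square_integrable M (\<lambda>\<omega>. H \<omega> $ i * dB s u i' \<omega>)" for i i'
    by (rule square_integrable_mult_bounded[OF square_integrable_dB[OF s] C(2) C(3)])
  have sq2: "square_integrable M (\<lambda>\<omega>. H' \<omega> $ i * dB s u i' \<omega>)" for i i'
    by (rule square_integrable_mult_bounded[OF square_integrable_dB[OF s] C'(2) C'(3)])
  have int: "integrable M (\<lambda>\<omega>. (H \<omega> $ i * H' \<omega> $ j) * (dB s u i \<omega> * dB s u j \<omega>))" for i j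
    using integrable_mult_square_integrable[OF sq1[of i i] sq2[of j j]] by (simp add: mult_ac)
  have intH: "integrable M (\<lambda>\<omega>. H \<omega> $ i * H' \<omega> $ j)" for i j
    by (intro square_integrable_integrable square_integrable_bounded[OF _ bd] borel_measurable_times C C')
  have "expectation (\<lambda>\<omega>. inc s u H \<omega> * inc s u H' \<omega>) = 
      expectation (\<lambda>\<omega>. \<Sum>i\<in>UNIV. \<Sum>j\<in>UNIV. (H \<omega> $ i * H' \<omega> $ j) * (dB s u i \<omega> * dB s u j \<omega>))"
    unfolding inc_eq_sum sum_product by (intro Bochner_Integration.integral_cong sum.cong) (auto simp: mult_ac)
  also have "\<dots> = (\<Sum>i\<in>UNIV. \<Sum>j\<in>UNIV. expectation (\<lambda>\<omega>. (H \<omega> $ i * H' \<omega> $ j) * (dB s u i \<omega> * dB s u j \<omega>)))"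
    using int by (simp add: Bochner_Integration.integral_sum)
  also have "\<dots> = (\<Sum>i\<in>UNIV. \<Sum>j\<in>UNIV. (if i = j then u - s else 0) * expectation (\<lambda>\<omega>. H \<omega> $ i * H' \<omega> $ j))"
    by (intro sum.cong refl expectation_mult_dB_dB[OF s _ bd] borel_measurable_times C C')
  also have "\<dots> = (\<Sum>i\<in>UNIV. (u - s) * expectation (\<lambda>\<omega>. H \<omega> $ i * H' \<omega> $ i))"
    by (simp add: if_distrib[where f="\<lambda>x. x * _"] cong: if_cong)
  also have "\<dots> = (u - s) * expectation (\<lambda>\<omega>. H \<omega> \<bullet> H' \<omega>)"
    unfolding inner_vec_def using intH by (simp add: Bochner_Integration.integral_sum sum_distrib_left)
  finally show ?thesis .
qed

lemma expectation_inc_disjoint: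
  assumes "0 \<le> s" "s \<le> u" "u \<le> s'" "s' \<le> u'" "u' \<le> T" "bounded_at s H" "bounded_at s' H'"
  shows "expectation (\<lambda>\<omega>. inc s u H \<omega> * inc s' u' H' \<omega>) = 0"
  by (rule expectation_mult_inc) (use assms inc_measurable_F[of s H u] measurable_F_mono[of u s'] square_integrable_inc in auto)

text \<open>Both intervals are cut at \<open>s'\<close> and at \<open>m = min u u'\<close>. Products
  over successive intervals have mean zero, so that only the common piece \<open>[s',m]\<close>
  contributes.\<close>

lemma expectation_inc_inc_aux:
  assumes s: "0 \<le> s" "s \<le> u" "u \<le> T" and H: "bounded_at s H"
    and s': "s \<le> s'" "s' \<le> u'" "u' \<le> T" and H': "bounded_at s' H'"
  shows "expectation (\<lambda>\<omega>. inc s u H \<omega> * inc s' u' H' \<omega>) = 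
    max 0 (min u u' - max s s') * expectation (\<lambda>\<omega>. H \<omega> \<bullet> H' \<omega>)"
proof (cases "u \<le> s'")
  case True
  then show ?thesis using expectation_inc_disjoint[of s u s' u' H H'] assms by (simp add: max_def)
next
  case False
  define m where "m = min u u'"
  have m: "s' \<le> m" "m \<le> u" "m \<le> u'" using False assms by (auto simp: m_def)
  have Hs': "bounded_at s' H" "bounded_at m H" "bounded_at m H'"
    using bounded_at_mono[OF H, of s'] bounded_at_mono[OF H, of m] bounded_at_mono[OF H', of m] s' m by auto
  have sq: "square_integrable M (inc s s' H)" "square_integrable M (inc s' m H)" "square_integrable M (inc m u H)"
     "square_integrable M (inc s' m H')" "square_integrable M (inc m u' H')"
    using assms m Hs' by (auto intro!: square_integrable_inc)
  note int = integrable_mult_square_integrable[OF sq(1) sq(4)] integrable_mult_square_integrable[OF sq(1) sq(5)]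
    integrable_mult_square_integrable[OF sq(2) sq(4)] integrable_mult_square_integrable[OF sq(2) sq(5)]
    integrable_mult_square_integrable[OF sq(4) sq(3)] integrable_mult_square_integrable[OF sq(3) sq(5)]
  \<comment> \<open>One of the intervals \<open>[m,u]\<close> and \<open>[m,u']\<close> is a single
    point.\<close>
  have zero: "inc m u H \<omega> * inc m u' H' \<omega> = 0" for \<omega>
    by (cases "u \<le> u'") (auto simp: m_def)
  have "expectation (\<lambda>\<omega>. inc s u H \<omega> * inc s' u' H' \<omega>) =
    expectation (\<lambda>\<omega>. inc s s' H \<omega> * inc s' m H' \<omega> + inc s s' H \<omega> * inc m u' H' \<omega> +
      inc s' m H \<omega> * inc s' m H' \<omega> + inc s' m H \<omega> * inc m u' H' \<omega> + 
      inc s' m H' \<omega> * inc m u H \<omega> + inc m u H \<omega> * inc m u' H' \<omega>)"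
  proof (intro Bochner_Integration.integral_cong refl)
    fix \<omega>
    have eq: "inc s u H \<omega> = inc s s' H \<omega> + inc s' m H \<omega> + inc m u H \<omega>" "inc s' u' H' \<omega> = inc s' m H' \<omega> + inc m u' H' \<omega>"
      by (simp_all add: inner_diff_right)
    have "(a + b + c) * (d + e) = a * d + a * e + b * d + b * e + d * c + c * e" for a b c d e :: real
      by (simp add: algebra_simps)
    then show "inc s u H \<omega> * inc s' u' H' \<omega> =
      inc s s' H \<omega> * inc s' m H' \<omega> + inc s s' H \<omega> * inc m u' H' \<omega> +
      inc s' m H \<omega> * inc s' m H' \<omega> + inc s' m H \<omega> * inc m u' H' \<omega> + 
      inc s' m H' \<omega> * inc m u H \<omega> + inc m u H \<omega> * inc m u' H' \<omega>"
      unfolding eq .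
  qed
  also have "\<dots> = expectation (\<lambda>\<omega>. inc s s' H \<omega> * inc s' m H' \<omega>) + expectation (\<lambda>\<omega>. inc s s' H \<omega> * inc m u' H' \<omega>) +
      expectation (\<lambda>\<omega>. inc s' m H \<omega> * inc s' m H' \<omega>) + expectation (\<lambda>\<omega>. inc s' m H \<omega> * inc m u' H' \<omega>) + 
      expectation (\<lambda>\<omega>. inc s' m H' \<omega> * inc m u H \<omega>) + expectation (\<lambda>\<omega>. inc m u H \<omega> * inc m u' H' \<omega>)"
    using int by (simp only: Bochner_Integration.integral_add Bochner_Integration.integrable_add)
  also have "\<dots> = (m - s') * expectation (\<lambda>\<omega>. H \<omega> \<bullet> H' \<omega>)"
    using assms m Hs' unfolding zero
    by (simp add: expectation_inc_disjoint expectation_inc_same)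
  also have "m - s' = max 0 (min u u' - max s s')" using m s' by (auto simp: m_def)
  finally show ?thesis .
qed

text \<open>\<open>bounded_at\<close> is asked of nondegenerate intervals only, with clipped
  intervals in view: clipping to \<open>[t0,t1]\<close> moves an interval that lies beyond
  \<open>t1\<close> to the point \<open>t1\<close>, where its coefficient need not be
  measurable.\<close>

lemma expectation_inc_inc:
  assumes s: "0 \<le> s" "s \<le> u" "u \<le> T" and H: "s < u \<Longrightarrow> bounded_at s H"
    and s': "0 \<le> s'" "s' \<le> u'" "u' \<le> T" and H': "s' < u' \<Longrightarrow> bounded_at s' H'"
  shows "expectation (\<lambda>\<omega>. inc s u H \<omega> * inc s' u' H' \<omega>) = 
    max 0 (min u u' - max s s') * expectation (\<lambda>\<omega>. H \<omega> \<bullet> H' \<omega>)"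
proof (cases "s = u \<or> s' = u'")
  case True
  then have "max 0 (min u u' - max s s') = 0" by auto
  then show ?thesis using True by auto
next
  case False
  then have H: "bounded_at s H" and H': "bounded_at s' H'" using assms by auto
  show ?thesis
  proof (cases "s \<le> s'")
    case True
    then show ?thesis using expectation_inc_inc_aux[OF s H True s'(2,3) H'] by simp
  next
    case False
    then have le: "s' \<le> s" by simp
    show ?thesis using expectation_inc_inc_aux[OF s' H' le s(2,3) H]
      by (simp add: mult.commute min.commute max.commute inner_commute)
  qed
qed

section \<open>Simple integrals over a time window\<close>

abbreviation (input) "clip t0 t1 x \<equiv> max t0 (min x t1) :: real"

lemma simple_integrand_memD:
  assumes "is_simple_integrand M T F xs" "(s, u, H) \<in> set xs"
  shows "0 \<le> s" "s \<le> u" "u \<le> T" "bounded_at s H"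
  using assms by (auto simp: is_simple_integrand_def bounded_at_def)

lemma simple_integral_diff:
  assumes "t0 \<le> t1" "is_simple_integrand M T F xs"
  shows "simple_integral B xs t1 \<omega> - simple_integral B xs t0 \<omega> =
    (\<Sum>(s, u, H)\<leftarrow>xs. inc (clip t0 t1 s) (clip t0 t1 u) H \<omega>)"
  using assms(2) unfolding simple_integral_def is_simple_integrand_def
proof (induction xs)
  case (Cons x xs)
  obtain s u H where x: "x = (s, u, H)" by (cases x)
  have "H \<omega> \<bullet> (B (min u t1) \<omega> - B (min s t1) \<omega>) - H \<omega> \<bullet> (B (min u t0) \<omega> - B (min s t0) \<omega>) = inc (clip t0 t1 s) (clip t0 t1 u) H \<omega>"
    using Cons.prems assms(1) by (auto simp: x min_def max_def inner_diff_right)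
  then show ?case using Cons by (auto simp: x)
qed simp

lemma clip_bounded:
  assumes "0 \<le> t0" "t0 \<le> t1" "t1 \<le> T" "is_simple_integrand M T F xs" "(s, u, H) \<in> set xs"
  shows "0 \<le> clip t0 t1 s" "clip t0 t1 s \<le> clip t0 t1 u" "clip t0 t1 u \<le> T" "t0 \<le> clip t0 t1 s"
    "clip t0 t1 s < clip t0 t1 u \<Longrightarrow> bounded_at (clip t0 t1 s) H"
proof -
  note m = simple_integrand_memD[OF assms(4,5)]
  show "0 \<le> clip t0 t1 s" "clip t0 t1 s \<le> clip t0 t1 u" "clip t0 t1 u \<le> T" "t0 \<le> clip t0 t1 s"
    using m(1-3) assms(1-3) by (auto simp: min_def max_def)
  assume "clip t0 t1 s < clip t0 t1 u"
  then have "s \<le> clip t0 t1 s" using m(1-3) assms(1-3) by (auto simp: min_def max_def split: if_splits)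
  then show "bounded_at (clip t0 t1 s) H" by (rule bounded_at_mono[OF m(4)])
qed

lemma square_integrable_inc_clip:
  assumes "0 \<le> s" "s \<le> u" "u \<le> T" "s < u \<Longrightarrow> bounded_at s H"
  shows "square_integrable M (inc s u H)"
  using assms square_integrable_inc[of s H u] by (cases "s = u") auto

lemma square_integrable_simple_integral_diff:
  assumes t: "0 \<le> t0" "t0 \<le> t1" "t1 \<le> T" and xs: "is_simple_integrand M T F xs"
  shows "square_integrable M (\<lambda>\<omega>. simple_integral B xs t1 \<omega> - simple_integral B xs t0 \<omega>)"
  unfolding simple_integral_diff[OF t(2) xs]
proof (rule square_integrable_sum_list, clarify)
  fix s u H assume "(s, u, H) \<in> set xs"
  then show "square_integrable M (inc (clip t0 t1 s) (clip t0 t1 u) H)"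
    using clip_bounded[OF t xs] by (intro square_integrable_inc_clip) blast+
qed

lemma simple_integral_0: "is_simple_integrand M T F xs \<Longrightarrow> simple_integral B xs 0 \<omega> = 0"
  unfolding simple_integral_def is_simple_integrand_def by (induction xs) (auto simp: min_absorb2)

lemma square_integrable_simple_integral:
  assumes t: "0 \<le> t" "t \<le> T" and xs: "is_simple_integrand M T F xs"
  shows "square_integrable M (simple_integral B xs t)"
  using square_integrable_simple_integral_diff[of 0 t xs] assms by (simp add: simple_integral_0)

text \<open>The martingale property, in the form of orthogonality. Every clipped interval begins at
  or after \<open>t0\<close>, so \<open>X\<close> is measurable at its left end.\<close>

lemma expectation_mult_simple_integral:
  assumes t: "0 \<le> t0" "t0 \<le> t1" "t1 \<le> T" and xs: "is_simple_integrand M T F xs"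
    and X: "X \<in> borel_measurable (F t0)" "square_integrable M X"
  shows "expectation (\<lambda>\<omega>. X \<omega> * (simple_integral B xs t1 \<omega> - simple_integral B xs t0 \<omega>)) = 0"
proof -
  have *: "integrable M (\<lambda>\<omega>. X \<omega> * inc (clip t0 t1 s) (clip t0 t1 u) H \<omega>) \<and>
      expectation (\<lambda>\<omega>. X \<omega> * inc (clip t0 t1 s) (clip t0 t1 u) H \<omega>) = 0" if "(s, u, H) \<in> set xs" for s u H
  proof (cases "clip t0 t1 s = clip t0 t1 u")
    case False
    note c = clip_bounded[OF t xs that]
    from False c(2) have b: "bounded_at (clip t0 t1 s) H" by (intro c(5)) linarith
    have XF: "X \<in> borel_measurable (F (clip t0 t1 s))" by (rule measurable_F_mono[OF c(4) X(1)])
    show ?thesis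
      by (intro conjI integrable_mult_square_integrable[OF X(2)] square_integrable_inc[OF b c(1-3)]
          expectation_mult_inc[OF c(1-3) XF X(2) b])
  qed simp
  have "integrable M (\<lambda>\<omega>. \<Sum>(s,u,H)\<leftarrow>ys. X \<omega> * inc (clip t0 t1 s) (clip t0 t1 u) H \<omega>) \<and>
     expectation (\<lambda>\<omega>. \<Sum>(s,u,H)\<leftarrow>ys. X \<omega> * inc (clip t0 t1 s) (clip t0 t1 u) H \<omega>) = 0" if "set ys \<subseteq> set xs" for ys
    using that
  proof (induction ys)
    case (Cons y ys)
    then show ?case using * by (cases y) auto
  qed simp
  from this[of xs] show ?thesis
    unfolding simple_integral_diff[OF t(2) xs] sum_list_const_mult[symmetric] by (simp add: split_def)
qed

end

section \<open>Isometry and stochastic integrals\<close>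

lemma sum_list_triples:
  "(\<Sum>(s, u, H)\<leftarrow>xs. f s u H) = (\<Sum>i<length xs. f (fst (xs ! i)) (fst (snd (xs ! i))) (snd (snd (xs ! i))))"
  by (simp add: sum_list_sum_nth split_def atLeast0LessThan)

lemma norm_add_square_le:
  fixes x y :: "'a::real_inner"
  shows "(norm (x + y))\<^sup>2 \<le> 2 * (norm x)\<^sup>2 + 2 * (norm y)\<^sup>2"
proof -
  have "(norm (x + y))\<^sup>2 \<le> (norm (x + y))\<^sup>2 + (norm (x - y))\<^sup>2" by simp
  also have "\<dots> = 2 * (norm x)\<^sup>2 + 2 * (norm y)\<^sup>2"
    by (simp add: power2_norm_eq_inner inner_diff_left inner_diff_right inner_add_left inner_add_right)
  finally show ?thesis .
qed

lemma ennreal_norm_add_square_le: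
  fixes x y :: "'a::real_inner"
  shows "ennreal ((norm (x + y))\<^sup>2) \<le> 2 * ennreal ((norm x)\<^sup>2) + 2 * ennreal ((norm y)\<^sup>2)"
  using ennreal_leI[OF norm_add_square_le[of x y]]
  by (simp add: ennreal_plus ennreal_mult del: norm_add_square_le)

lemma diff_square_le: "(a - b)\<^sup>2 \<le> 2 * a\<^sup>2 + 2 * b\<^sup>2" for a b :: real
  using norm_add_square_le[of a "- b"] by simp

lemma ennreal_diff_square_le: "ennreal ((a - b)\<^sup>2) \<le> 2 * ennreal (a\<^sup>2) + 2 * ennreal (b\<^sup>2)"
  using ennreal_norm_add_square_le[of a "- b"] by simp

lemma indicator_Ioc_has_integral:
  "has_bochner_integral lborel (indicat_real {a<..b}) (max 0 (b - a))"
proof -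
  have "emeasure lborel {a<..b} < \<infinity>" by (cases "a \<le> b") auto
  moreover have "measure lborel {a<..b} = max 0 (b - a)" by (cases "a \<le> b") auto
  ultimately show ?thesis
    using has_bochner_integral_real_indicator[of "{a<..b}" lborel] by auto
qed

text \<open>A process may take arbitrary values at times outside \<open>A\<close>, so measurability
  is asked of its extension by zero.\<close>

definition jointly_measurable :: "'w measure \<Rightarrow> real set \<Rightarrow> (real \<Rightarrow> 'w \<Rightarrow> 'b::{real_normed_vector, second_countable_topology}) \<Rightarrow> bool" where
  "jointly_measurable M A f \<longleftrightarrow> (\<lambda>(\<omega>, s). indicat_real A s *\<^sub>R f s \<omega>) \<in> borel_measurable (M \<Otimes>\<^sub>M lborel)"

lemma jointly_measurable_subset:
  assumes "jointly_measurable M A f" "A' \<subseteq> A" "A' \<in> sets borel"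
  shows "jointly_measurable M A' f"
proof -
  have "(\<lambda>(\<omega>, s). indicat_real A' s *\<^sub>R f s \<omega>) = (\<lambda>p. indicat_real A' (snd p) *\<^sub>R (\<lambda>(\<omega>, s). indicat_real A s *\<^sub>R f s \<omega>) p)"
    using assms(2) by (auto simp: fun_eq_iff indicator_def)
  also have "\<dots> \<in> borel_measurable (M \<Otimes>\<^sub>M lborel)"
    using assms(1,3) unfolding jointly_measurable_def by measurable
  finally show ?thesis by (simp add: jointly_measurable_def)
qed

lemma jointly_measurable_add:
  "jointly_measurable M A f \<Longrightarrow> jointly_measurable M A g \<Longrightarrow> jointly_measurable M A (\<lambda>s \<omega>. f s \<omega> + g s \<omega>)"
  unfolding jointly_measurable_def using borel_measurable_add[of _ "M \<Otimes>\<^sub>M lborel"]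
  by (simp add: split_def scaleR_add_right)

lemma jointly_measurable_diff:
  "jointly_measurable M A f \<Longrightarrow> jointly_measurable M A g \<Longrightarrow> jointly_measurable M A (\<lambda>s \<omega>. f s \<omega> - g s \<omega>)"
  unfolding jointly_measurable_def using borel_measurable_diff[of _ "M \<Otimes>\<^sub>M lborel"]
  by (simp add: split_def scaleR_diff_right)

lemma jointly_measurable_nn_integrand:
  assumes "jointly_measurable M A f"
  shows "(\<lambda>(\<omega>, s). ennreal ((norm (f s \<omega>))\<^sup>2) * indicator A s) \<in> borel_measurable (M \<Otimes>\<^sub>M lborel)"
proof -
  have "(\<lambda>(\<omega>, s). ennreal ((norm (f s \<omega>))\<^sup>2) * indicator A s) = (\<lambda>p. ennreal ((norm ((\<lambda>(\<omega>, s). indicat_real A s *\<^sub>R f s \<omega>) p))\<^sup>2))"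
    by (auto simp: fun_eq_iff indicator_def)
  also have "\<dots> \<in> borel_measurable (M \<Otimes>\<^sub>M lborel)"
    using assms unfolding jointly_measurable_def by measurable
  finally show ?thesis .
qed

text \<open>The squared L2 norm on the product of \<open>M\<close> with Lebesgue measure on
  \<open>A\<close>. Values in \<open>ennreal\<close> allow it to be estimated before it is known to
  be finite.\<close>

abbreviation (input) energy :: "'w measure \<Rightarrow> real set \<Rightarrow> (real \<Rightarrow> 'w \<Rightarrow> 'b::real_normed_vector) \<Rightarrow> ennreal" where
  "energy M A f \<equiv> \<integral>\<^sup>+\<omega>. (\<integral>\<^sup>+s\<in>A. ennreal ((norm (f s \<omega>))\<^sup>2) \<partial>lborel) \<partial>M"

lemma energy_eq_pair:
  assumes "jointly_measurable M A f"
  shows "energy M A f = (\<integral>\<^sup>+(\<omega>, s). ennreal ((norm (f s \<omega>))\<^sup>2) * indicator A s \<partial>(M \<Otimes>\<^sub>M lborel))"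
  using lborel.nn_integral_fst[OF jointly_measurable_nn_integrand[OF assms]] by (simp add: split_def)

lemma energy_mono:
  assumes "A \<subseteq> A'"
  shows "energy M A f \<le> energy M A' f"
  using assms by (intro nn_integral_mono mult_left_mono) (auto split: split_indicator)

lemma energy_add_le:
  fixes f g :: "real \<Rightarrow> 'w \<Rightarrow> 'b::{real_inner, second_countable_topology}"
  assumes f: "jointly_measurable M A f" and g: "jointly_measurable M A g"
  shows "energy M A (\<lambda>s \<omega>. f s \<omega> + g s \<omega>) \<le> 2 * energy M A f + 2 * energy M A g"
proof -
  note [measurable] = jointly_measurable_nn_integrand[OF f] jointly_measurable_nn_integrand[OF g]
  have "energy M A (\<lambda>s \<omega>. f s \<omega> + g s \<omega>) = (\<integral>\<^sup>+(\<omega>, s). ennreal ((norm (f s \<omega> + g s \<omega>))\<^sup>2) * indicator A s \<partial>(M \<Otimes>\<^sub>M lborel))"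
    by (rule energy_eq_pair[OF jointly_measurable_add[OF f g]])
  also have "\<dots> \<le> (\<integral>\<^sup>+p. 2 * (\<lambda>(\<omega>, s). ennreal ((norm (f s \<omega>))\<^sup>2) * indicator A s) p + 
       2 * (\<lambda>(\<omega>, s). ennreal ((norm (g s \<omega>))\<^sup>2) * indicator A s) p \<partial>(M \<Otimes>\<^sub>M lborel))"
    using ennreal_norm_add_square_le by (intro nn_integral_mono) (auto split: split_indicator)
  also have "\<dots> = 2 * energy M A f + 2 * energy M A g"
    unfolding energy_eq_pair[OF f] energy_eq_pair[OF g] by (subst nn_integral_add) (simp_all add: nn_integral_cmult)
  finally show ?thesis .
qed

section \<open>The isometry for simple integrands\<close>

context brownian_motion begin

text \<open>The intervals of a simple integrand may overlap, so the squared norm is expanded over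
  all pairs. The coefficient of a pair is the integral of the product of two indicators, that is,
  the length of the common part of the clipped intervals.\<close>

lemma simple_process_energy_path:
  assumes t: "t0 \<le> t1"
  shows "(\<integral>\<^sup>+s\<in>{t0<..t1}. ennreal ((norm (simple_process xs s \<omega>))\<^sup>2) \<partial>lborel) =
    ennreal (\<Sum>(s, u, H)\<leftarrow>xs. \<Sum>(s', u', H')\<leftarrow>xs. 
      max 0 (min (clip t0 t1 u) (clip t0 t1 u') - max (clip t0 t1 s) (clip t0 t1 s')) * (H \<omega> \<bullet> H' \<omega>))"
    (is "_ = ennreal ?q")
    and simple_process_energy_path_nonneg:
    "0 \<le> (\<Sum>(s, u, H)\<leftarrow>xs. \<Sum>(s', u', H')\<leftarrow>xs. 
      max 0 (min (clip t0 t1 u) (clip t0 t1 u') - max (clip t0 t1 s) (clip t0 t1 s')) * (H \<omega> \<bullet> H' \<omega>))"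
proof -
  define S U H where "S i = fst (xs ! i)" and "U i = fst (snd (xs ! i))" and "H i = snd (snd (xs ! i))" for i
  define n where "n = length xs"
  define ov where "ov i j = max 0 (min (clip t0 t1 (U i)) (clip t0 t1 (U j)) - max (clip t0 t1 (S i)) (clip t0 t1 (S j)))" for i j
  have q: "?q = (\<Sum>i<n. \<Sum>j<n. ov i j * (H i \<omega> \<bullet> H j \<omega>))"
    unfolding sum_list_triples S_def U_def H_def n_def ov_def ..
  have sp: "simple_process xs s \<omega> = (\<Sum>i<n. indicat_real {S i<..U i} s *\<^sub>R H i \<omega>)" for s
    unfolding simple_process_def sum_list_triples S_def U_def H_def n_def ..
  have "has_bochner_integral lborel (\<lambda>s. \<Sum>i<n. \<Sum>j<n. indicat_real {max (clip t0 t1 (S i)) (clip t0 t1 (S j))<..min (clip t0 t1 (U i)) (clip t0 t1 (U j))} s * (H i \<omega> \<bullet> H j \<omega>)) ?q"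
    unfolding q ov_def by (intro has_bochner_integral_sum has_bochner_integral_mult_left indicator_Ioc_has_integral)
  also have "(\<lambda>s. \<Sum>i<n. \<Sum>j<n. indicat_real {max (clip t0 t1 (S i)) (clip t0 t1 (S j))<..min (clip t0 t1 (U i)) (clip t0 t1 (U j))} s * (H i \<omega> \<bullet> H j \<omega>)) =
    (\<lambda>s. (norm (simple_process xs s \<omega>))\<^sup>2 * indicator {t0<..t1} s)"
  proof
    fix s
    \<comment> \<open>Inside the window clipping does not change how an endpoint compares with
      \<open>s\<close>; outside it no clipped interval contains \<open>s\<close>.\<close>
    have ind: "indicat_real {max (clip t0 t1 (S i)) (clip t0 t1 (S j))<..min (clip t0 t1 (U i)) (clip t0 t1 (U j))} s =
        indicat_real {S i<..U i} s * indicat_real {S j<..U j} s * indicat_real {t0<..t1} s" for i j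
    proof (cases "s \<in> {t0<..t1}")
      case True
      then have "(clip t0 t1 a < s) = (a < s)" "(s \<le> clip t0 t1 a) = (s \<le> a)" for a by auto
      then show ?thesis using True by (auto simp: indicator_def)
    next
      case False
      have "t0 \<le> clip t0 t1 a" "clip t0 t1 a \<le> t1" for a using t by auto
      then have "s \<notin> {max (clip t0 t1 (S i)) (clip t0 t1 (S j))<..min (clip t0 t1 (U i)) (clip t0 t1 (U j))}"
        using False by (metis greaterThanAtMost_iff le_less_trans max.strict_boundedE min.boundedE order_trans)
      then show ?thesis using False by simp
    qed
    show "(\<Sum>i<n. \<Sum>j<n. indicat_real {max (clip t0 t1 (S i)) (clip t0 t1 (S j))<..min (clip t0 t1 (U i)) (clip t0 t1 (U j))} s * (H i \<omega> \<bullet> H j \<omega>)) =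
       (norm (simple_process xs s \<omega>))\<^sup>2 * indicator {t0<..t1} s"
      unfolding ind sp power2_norm_eq_inner inner_sum_left inner_sum_right sum_distrib_right
      by (subst sum.swap) (simp add: mult_ac inner_commute)
  qed
  finally have hb: "has_bochner_integral lborel (\<lambda>s. (norm (simple_process xs s \<omega>))\<^sup>2 * indicator {t0<..t1} s) ?q" .
  have "(\<integral>\<^sup>+s\<in>{t0<..t1}. ennreal ((norm (simple_process xs s \<omega>))\<^sup>2) \<partial>lborel) = 
    (\<integral>\<^sup>+s. ennreal ((norm (simple_process xs s \<omega>))\<^sup>2 * indicator {t0<..t1} s) \<partial>lborel)"
    by (intro nn_integral_cong) (auto split: split_indicator)
  also have "\<dots> = ennreal ?q"
    using hb has_bochner_integral_integral_eq[OF hb] by (subst nn_integral_eq_integral) (auto simp: has_bochner_integral_iff)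
  finally show "(\<integral>\<^sup>+s\<in>{t0<..t1}. ennreal ((norm (simple_process xs s \<omega>))\<^sup>2) \<partial>lborel) = ennreal ?q" .
  have "0 \<le> (\<integral>s. (norm (simple_process xs s \<omega>))\<^sup>2 * indicator {t0<..t1} s \<partial>lborel)"
    by (rule Bochner_Integration.integral_nonneg) auto
  then show "0 \<le> ?q" unfolding has_bochner_integral_integral_eq[OF hb] .
qed

lemma integrable_inner_bounded_at:
  assumes "bounded_at s H" "bounded_at s' H'"
  shows "integrable M (\<lambda>\<omega>. H \<omega> \<bullet> H' \<omega>)"
proof -
  obtain C C' where C: "\<forall>\<omega>\<in>space M. norm (H \<omega>) \<le> C" "\<forall>\<omega>\<in>space M. norm (H' \<omega>) \<le> C'"
    using assms unfolding bounded_at_def by blast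
  have m: "H \<in> borel_measurable M" "H' \<in> borel_measurable M"
    using assms measurable_F_M unfolding bounded_at_def by blast+
  have "\<bar>H \<omega> \<bullet> H' \<omega>\<bar> \<le> C * C'" if "\<omega> \<in> space M" for \<omega>
    using C that by (intro order_trans[OF Cauchy_Schwarz_ineq2] mult_mono) (auto intro: order_trans[OF norm_ge_zero])
  then show ?thesis using m by (intro square_integrable_integrable square_integrable_bounded) auto
qed

text \<open>Both sides expand over the same pairs of intervals with the same overlap coefficients:
  on the left by \<open>simple_process_energy_path\<close>, on the right by
  \<open>expectation_inc_inc\<close>.\<close>

lemma simple_integral_isometry:
  assumes t: "0 \<le> t0" "t0 \<le> t1" "t1 \<le> T" and xs: "is_simple_integrand M T F xs"
  shows "energy M {t0<..t1} (simple_process xs) =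
    ennreal (expectation (\<lambda>\<omega>. (simple_integral B xs t1 \<omega> - simple_integral B xs t0 \<omega>)\<^sup>2))"
proof -
  define S U H where "S i = clip t0 t1 (fst (xs ! i))" and "U i = clip t0 t1 (fst (snd (xs ! i)))" and "H i = snd (snd (xs ! i))" for i
  define n where "n = length xs"
  have mem: "(fst (xs ! i), fst (snd (xs ! i)), H i) \<in> set xs" if "i < n" for i
    using that by (simp add: H_def n_def)
  have SU: "0 \<le> S i" "S i \<le> U i" "U i \<le> T" "S i < U i \<Longrightarrow> bounded_at (S i) (H i)" if "i < n" for i
    using clip_bounded[OF t xs mem[OF that]] unfolding S_def U_def by auto
  have b: "bounded_at (fst (xs ! i)) (H i)" if "i < n" for i
    using simple_integrand_memD[OF xs mem[OF that]] by auto
  define ov where "ov i j = max 0 (min (U i) (U j) - max (S i) (S j))" for i j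
  define q where "q \<omega> = (\<Sum>i<n. \<Sum>j<n. ov i j * (H i \<omega> \<bullet> H j \<omega>))" for \<omega>
  have q: "(\<Sum>(s, u, H)\<leftarrow>xs. \<Sum>(s', u', H')\<leftarrow>xs. 
      max 0 (min (clip t0 t1 u) (clip t0 t1 u') - max (clip t0 t1 s) (clip t0 t1 s')) * (H \<omega> \<bullet> H' \<omega>)) = q \<omega>" for \<omega>
    unfolding sum_list_triples S_def U_def H_def n_def ov_def q_def ..
  have int: "integrable M (\<lambda>\<omega>. H i \<omega> \<bullet> H j \<omega>)" if "i < n" "j < n" for i j
    by (rule integrable_inner_bounded_at[OF b[OF that(1)] b[OF that(2)]])
  have sq: "square_integrable M (inc (S i) (U i) (H i))" if "i < n" for i
    using SU[OF that] by (intro square_integrable_inc_clip)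
  have iq: "integrable M q" unfolding q_def[abs_def] using int by (intro Bochner_Integration.integrable_sum integrable_mult_right) auto
  have "energy M {t0<..t1} (simple_process xs) = (\<integral>\<^sup>+\<omega>. ennreal (q \<omega>) \<partial>M)"
    unfolding simple_process_energy_path[OF t(2)] q ..
  also have "\<dots> = ennreal (expectation q)"
    by (intro nn_integral_eq_integral iq AE_I2) (unfold q[symmetric], rule simple_process_energy_path_nonneg[OF t(2)])
  also have "expectation q = (\<Sum>i<n. \<Sum>j<n. ov i j * expectation (\<lambda>\<omega>. H i \<omega> \<bullet> H j \<omega>))"
  proof -
    have i: "integrable M (\<lambda>\<omega>. ov i j * (H i \<omega> \<bullet> H j \<omega>))" if "i \<in> {..<n}" "j \<in> {..<n}" for i j
      using int that by (intro integrable_mult_right) auto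
    have "expectation q = (\<Sum>i<n. expectation (\<lambda>\<omega>. \<Sum>j<n. ov i j * (H i \<omega> \<bullet> H j \<omega>)))"
      unfolding q_def by (intro Bochner_Integration.integral_sum Bochner_Integration.integrable_sum i)
    also have "\<dots> = (\<Sum>i<n. \<Sum>j<n. expectation (\<lambda>\<omega>. ov i j * (H i \<omega> \<bullet> H j \<omega>)))"
      by (intro sum.cong refl Bochner_Integration.integral_sum i)
    finally show ?thesis by simp
  qed
  also have "\<dots> = (\<Sum>i<n. \<Sum>j<n. expectation (\<lambda>\<omega>. inc (S i) (U i) (H i) \<omega> * inc (S j) (U j) (H j) \<omega>))"
    unfolding ov_def by (intro sum.cong refl expectation_inc_inc[symmetric] SU) auto
  also have "\<dots> = expectation (\<lambda>\<omega>. \<Sum>i<n. \<Sum>j<n. inc (S i) (U i) (H i) \<omega> * inc (S j) (U j) (H j) \<omega>)"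
  proof -
    have i: "integrable M (\<lambda>\<omega>. inc (S i) (U i) (H i) \<omega> * inc (S j) (U j) (H j) \<omega>)" if "i \<in> {..<n}" "j \<in> {..<n}" for i j
      using sq that by (intro integrable_mult_square_integrable) auto
    have "expectation (\<lambda>\<omega>. \<Sum>i<n. \<Sum>j<n. inc (S i) (U i) (H i) \<omega> * inc (S j) (U j) (H j) \<omega>) =
      (\<Sum>i<n. expectation (\<lambda>\<omega>. \<Sum>j<n. inc (S i) (U i) (H i) \<omega> * inc (S j) (U j) (H j) \<omega>))"
      by (intro Bochner_Integration.integral_sum Bochner_Integration.integrable_sum i)
    also have "\<dots> = (\<Sum>i<n. \<Sum>j<n. expectation (\<lambda>\<omega>. inc (S i) (U i) (H i) \<omega> * inc (S j) (U j) (H j) \<omega>))"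
      by (intro sum.cong refl Bochner_Integration.integral_sum i)
    finally show ?thesis by simp
  qed
  also have "\<dots> = expectation (\<lambda>\<omega>. (simple_integral B xs t1 \<omega> - simple_integral B xs t0 \<omega>)\<^sup>2)"
    unfolding simple_integral_diff[OF t(2) xs] sum_list_triples power2_eq_square sum_product S_def U_def H_def n_def ..
  finally show ?thesis .
qed

lemma jointly_measurable_simple_process:
  fixes xs :: "('w, 'd) simple_integrand"
  assumes xs: "is_simple_integrand M T F xs" and A: "A \<in> sets borel"
  shows "jointly_measurable M A (simple_process xs)"
proof -
  have "(\<lambda>(\<omega>, s). indicat_real A s *\<^sub>R simple_process ys s \<omega>) \<in> borel_measurable (M \<Otimes>\<^sub>M lborel)" if "set ys \<subseteq> set xs" for ys
    using that
  proof (induction ys)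
    case (Cons y ys)
    obtain s u H where y: "y = (s, u, H)" by (cases y)
    have "H \<in> borel_measurable (F s)"
      using simple_integrand_memD(4)[OF xs, of s u H] Cons.prems y by (auto simp: bounded_at_def)
    then have [measurable]: "H \<in> borel_measurable M" by (rule measurable_F_M)
    have [measurable]: "(\<lambda>(\<omega>, s). indicat_real A s *\<^sub>R simple_process ys s \<omega>) \<in> borel_measurable (M \<Otimes>\<^sub>M lborel)"
      using Cons by simp
    note [measurable] = A
    have "(\<lambda>(\<omega>, r). indicat_real A r *\<^sub>R simple_process (y # ys) r \<omega>) = 
      (\<lambda>p. indicat_real A (snd p) *\<^sub>R (indicat_real {s<..u} (snd p) *\<^sub>R H (fst p)) + (\<lambda>(\<omega>, s). indicat_real A s *\<^sub>R simple_process ys s \<omega>) p)"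
      by (auto simp: y simple_process_def scaleR_add_right)
    also have "\<dots> \<in> borel_measurable (M \<Otimes>\<^sub>M lborel)"
      by measurable
    finally show ?case .
  qed (simp add: simple_process_def)
  then show ?thesis by (simp add: jointly_measurable_def)
qed


section \<open>Passage to the Ito integral\<close>

lemma nn_integral_square_finite_iff:
  "X \<in> borel_measurable M \<Longrightarrow> (\<integral>\<^sup>+\<omega>. ennreal ((X \<omega>)\<^sup>2) \<partial>M) < \<infinity> \<longleftrightarrow> square_integrable M X"
  unfolding square_integrable_def by (auto simp: integrable_iff_bounded)

lemma nn_integral_square_eq:
  "square_integrable M X \<Longrightarrow> (\<integral>\<^sup>+\<omega>. ennreal ((X \<omega>)\<^sup>2) \<partial>M) = ennreal (expectation (\<lambda>\<omega>. (X \<omega>)\<^sup>2))"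
  unfolding square_integrable_def by (intro nn_integral_eq_integral) auto

text \<open>\<open>has_ito_integral\<close> expresses convergence by integrals in
  \<open>ennreal\<close> and does not state that the limit is square integrable. One index at which
  the distance is finite supplies this.\<close>

lemma L2_limit:
  assumes X: "\<And>n. square_integrable M (X n)" and Y: "Y \<in> borel_measurable M"
    and lim: "(\<lambda>n. \<integral>\<^sup>+\<omega>. ennreal ((X n \<omega> - Y \<omega>)\<^sup>2) \<partial>M) \<longlonglongrightarrow> 0"
  shows "square_integrable M Y" "(\<lambda>n. expectation (\<lambda>\<omega>. (X n \<omega> - Y \<omega>)\<^sup>2)) \<longlonglongrightarrow> 0"
proof -
  have "\<forall>\<^sub>F n in sequentially. (\<integral>\<^sup>+\<omega>. ennreal ((X n \<omega> - Y \<omega>)\<^sup>2) \<partial>M) < 1"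
    by (rule order_tendstoD(2)[OF lim]) simp
  then obtain n where "(\<integral>\<^sup>+\<omega>. ennreal ((X n \<omega> - Y \<omega>)\<^sup>2) \<partial>M) < 1"
    by (auto simp: eventually_sequentially)
  then have "square_integrable M (\<lambda>\<omega>. X n \<omega> - Y \<omega>)"
    using borel_measurable_diff[OF square_integrable_measurable[OF X] Y]
    by (subst nn_integral_square_finite_iff[symmetric]) (auto intro: less_trans)
  from square_integrable_diff[OF X[of n] this] show Yq: "square_integrable M Y" by simp
  show "(\<lambda>n. expectation (\<lambda>\<omega>. (X n \<omega> - Y \<omega>)\<^sup>2)) \<longlonglongrightarrow> 0"
    using lim nn_integral_square_eq[OF square_integrable_diff[OF X Yq]]
    by (simp add: tendsto_ennreal_iff[of _ _ 0, simplified] flip: ennreal_0)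
qed

text \<open>One half of the Ito isometry, with a non-optimal constant, is all that is needed.\<close>

lemma ito_integral_properties:
  fixes Z :: "real \<Rightarrow> 'w \<Rightarrow> real ^ 'd"
  assumes I: "has_ito_integral M T F B Z I"
  shows square_integrable_ito_integral: "\<And>t. 0 \<le> t \<Longrightarrow> t \<le> T \<Longrightarrow> square_integrable M (I t)"
    and expectation_mult_ito_integral: "\<And>X t0 t1. 0 \<le> t0 \<Longrightarrow> t0 \<le> t1 \<Longrightarrow> t1 \<le> T \<Longrightarrow>
      X \<in> borel_measurable (F t0) \<Longrightarrow> square_integrable M X \<Longrightarrow> expectation (\<lambda>\<omega>. X \<omega> * (I t1 \<omega> - I t0 \<omega>)) = 0"
    and energy_le_ito_integral: "\<And>t0 t1. jointly_measurable M {0..T} Z \<Longrightarrow> 0 \<le> t0 \<Longrightarrow> t0 \<le> t1 \<Longrightarrow> t1 \<le> T \<Longrightarrow>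
      energy M {t0<..t1} Z \<le> 4 * ennreal (expectation (\<lambda>\<omega>. (I t1 \<omega> - I t0 \<omega>)\<^sup>2))"
proof -
  obtain xs :: "nat \<Rightarrow> ('w, 'd) simple_integrand" where xs: "\<And>n. is_simple_integrand M T F (xs n)"
    and lim1: "(\<lambda>n. energy M {0..T} (\<lambda>s \<omega>. simple_process (xs n) s \<omega> - Z s \<omega>)) \<longlonglongrightarrow> 0"
    and lim2: "\<And>t. t \<in> {0..T} \<Longrightarrow> (\<lambda>n. \<integral>\<^sup>+\<omega>. ennreal ((simple_integral B (xs n) t \<omega> - I t \<omega>)\<^sup>2) \<partial>M) \<longlonglongrightarrow> 0"
    using I unfolding has_ito_integral_def by blast
  have Im: "I t \<in> borel_measurable M" if "0 \<le> t" "t \<le> T" for t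
    using I that unfolding has_ito_integral_def adapted_process_def by (intro measurable_F_M[of "I t" t]) auto
  have sq: "square_integrable M (simple_integral B (xs n) t)" if "0 \<le> t" "t \<le> T" for n t
    using that xs by (intro square_integrable_simple_integral)
  show Isq: "square_integrable M (I t)" if "0 \<le> t" "t \<le> T" for t
    using that by (intro L2_limit(1)[OF sq Im lim2]) auto
  have limE: "(\<lambda>n. expectation (\<lambda>\<omega>. (simple_integral B (xs n) t \<omega> - I t \<omega>)\<^sup>2)) \<longlonglongrightarrow> 0" if "0 \<le> t" "t \<le> T" for t
    using that by (intro L2_limit(2)[OF sq Im lim2]) auto
  show "expectation (\<lambda>\<omega>. X \<omega> * (I t1 \<omega> - I t0 \<omega>)) = 0"
    if t: "0 \<le> t0" "t0 \<le> t1" "t1 \<le> T" and X: "X \<in> borel_measurable (F t0)" "square_integrable M X" for X t0 t1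
  proof -
    have t': "0 \<le> t1" "t0 \<le> T" using t by auto
    have "(\<lambda>n. expectation (\<lambda>\<omega>. X \<omega> * simple_integral B (xs n) t1 \<omega>) - expectation (\<lambda>\<omega>. X \<omega> * simple_integral B (xs n) t0 \<omega>))
      \<longlonglongrightarrow> expectation (\<lambda>\<omega>. X \<omega> * I t1 \<omega>) - expectation (\<lambda>\<omega>. X \<omega> * I t0 \<omega>)"
      using t t' by (intro tendsto_diff tendsto_integral_mult_L2 sq Isq X limE)
    moreover have "expectation (\<lambda>\<omega>. X \<omega> * simple_integral B (xs n) t1 \<omega>) - expectation (\<lambda>\<omega>. X \<omega> * simple_integral B (xs n) t0 \<omega>) = 0" for n
      using expectation_mult_simple_integral[OF t xs X, of n]
        integrable_mult_square_integrable[OF X(2) sq[OF t'(1) t(3)], of n] integrable_mult_square_integrable[OF X(2) sq[OF t(1) t'(2)], of n]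
      by (simp add: right_diff_distrib)
    ultimately have "expectation (\<lambda>\<omega>. X \<omega> * I t1 \<omega>) - expectation (\<lambda>\<omega>. X \<omega> * I t0 \<omega>) = 0"
      by (simp add: LIMSEQ_const_iff)
    then show ?thesis
      using integrable_mult_square_integrable[OF X(2) Isq[OF t'(1) t(3)]] integrable_mult_square_integrable[OF X(2) Isq[OF t(1) t'(2)]]
      by (simp add: right_diff_distrib)
  qed
  show "energy M {t0<..t1} Z \<le> 4 * ennreal (expectation (\<lambda>\<omega>. (I t1 \<omega> - I t0 \<omega>)\<^sup>2))"
    if Z: "jointly_measurable M {0..T} Z" and t: "0 \<le> t0" "t0 \<le> t1" "t1 \<le> T" for t0 t1
  proof -
    have t': "0 \<le> t1" "t0 \<le> T" using t by auto
    define e where "e t n = expectation (\<lambda>\<omega>. (simple_integral B (xs n) t \<omega> - I t \<omega>)\<^sup>2)" for t n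
    define E where "E = expectation (\<lambda>\<omega>. (I t1 \<omega> - I t0 \<omega>)\<^sup>2)"
    define N where "N n = energy M {0..T} (\<lambda>s \<omega>. simple_process (xs n) s \<omega> - Z s \<omega>)" for n
    have sqd: "square_integrable M (\<lambda>\<omega>. simple_integral B (xs n) t1 \<omega> - I t1 \<omega>)" "square_integrable M (\<lambda>\<omega>. simple_integral B (xs n) t0 \<omega> - I t0 \<omega>)"
      "square_integrable M (\<lambda>\<omega>. I t1 \<omega> - I t0 \<omega>)"
      for n using t t' by (intro square_integrable_diff sq Isq; simp)+
    \<comment> \<open>One factor 2 comes from replacing \<open>Z\<close> by a simple process,
      another from replacing the increment of \<open>I\<close> by that of the simple integral;
      together they give the constant 4 in the limit.\<close>
    have le: "energy M {t0<..t1} Z \<le> 2 * ennreal (2 * E + 4 * e t1 n + 4 * e t0 n) + 2 * N n" for n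
    proof -
      have jZ: "jointly_measurable M {t0<..t1} Z" using t by (intro jointly_measurable_subset[OF Z]) auto
      have js: "jointly_measurable M {t0<..t1} (simple_process (xs n))" by (rule jointly_measurable_simple_process[OF xs]) simp
      have "energy M {t0<..t1} Z = energy M {t0<..t1} (\<lambda>s \<omega>. simple_process (xs n) s \<omega> + (Z s \<omega> - simple_process (xs n) s \<omega>))"
        by simp
      also have "\<dots> \<le> 2 * energy M {t0<..t1} (simple_process (xs n)) + 2 * energy M {t0<..t1} (\<lambda>s \<omega>. Z s \<omega> - simple_process (xs n) s \<omega>)"
        by (rule energy_add_le[OF js jointly_measurable_diff[OF jZ js]])
      also have "\<dots> \<le> 2 * ennreal (2 * E + 4 * e t1 n + 4 * e t0 n) + 2 * N n"
      proof (intro add_mono mult_left_mono)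
        have "energy M {t0<..t1} (\<lambda>s \<omega>. Z s \<omega> - simple_process (xs n) s \<omega>) \<le> energy M {0..T} (\<lambda>s \<omega>. Z s \<omega> - simple_process (xs n) s \<omega>)"
          using t by (intro energy_mono) auto
        then show "energy M {t0<..t1} (\<lambda>s \<omega>. Z s \<omega> - simple_process (xs n) s \<omega>) \<le> N n"
          by (simp add: N_def norm_minus_commute)
        have "expectation (\<lambda>\<omega>. (simple_integral B (xs n) t1 \<omega> - simple_integral B (xs n) t0 \<omega>)\<^sup>2) \<le>
          expectation (\<lambda>\<omega>. 2 * (I t1 \<omega> - I t0 \<omega>)\<^sup>2 + 4 * (simple_integral B (xs n) t1 \<omega> - I t1 \<omega>)\<^sup>2 + 4 * (simple_integral B (xs n) t0 \<omega> - I t0 \<omega>)\<^sup>2)"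
        proof (rule integral_mono)
          have *: "(a - b)\<^sup>2 \<le> 2 * (c - d)\<^sup>2 + 4 * (a - c)\<^sup>2 + 4 * (b - d)\<^sup>2" for a b c d :: real
          proof -
            have "(a - b)\<^sup>2 \<le> 2 * (c - d)\<^sup>2 + 2 * ((a - c) - (b - d))\<^sup>2"
              using norm_add_square_le[of "c - d" "(a - c) - (b - d)"] by simp
            moreover have "((a - c) - (b - d))\<^sup>2 \<le> 2 * (a - c)\<^sup>2 + 2 * (b - d)\<^sup>2"
              by (rule diff_square_le)
            ultimately show ?thesis by linarith
          qed
          show "(simple_integral B (xs n) t1 \<omega> - simple_integral B (xs n) t0 \<omega>)\<^sup>2 \<le> 
            2 * (I t1 \<omega> - I t0 \<omega>)\<^sup>2 + 4 * (simple_integral B (xs n) t1 \<omega> - I t1 \<omega>)\<^sup>2 + 4 * (simple_integral B (xs n) t0 \<omega> - I t0 \<omega>)\<^sup>2" for \<omega>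
            by (rule *)
        qed (use sqd square_integrable_simple_integral_diff[OF t xs] in \<open>auto simp: square_integrable_def\<close>)
        also have "\<dots> = 2 * E + 4 * e t1 n + 4 * e t0 n"
          unfolding E_def e_def using sqd by (simp add: square_integrable_def)
        finally show "energy M {t0<..t1} (simple_process (xs n)) \<le> ennreal (2 * E + 4 * e t1 n + 4 * e t0 n)"
          unfolding simple_integral_isometry[OF t xs] by (rule ennreal_leI)
      qed auto
      finally show ?thesis .
    qed
    have "(\<lambda>n. 2 * ennreal (2 * E + 4 * e t1 n + 4 * e t0 n) + 2 * N n) \<longlonglongrightarrow> 2 * ennreal (2 * E + 4 * 0 + 4 * 0) + 2 * 0"
      unfolding N_def e_def using t t' by (intro tendsto_add ennreal_tendsto_cmult tendsto_ennrealI tendsto_intros limE lim1) auto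
    then have "energy M {t0<..t1} Z \<le> 2 * ennreal (2 * E + 4 * 0 + 4 * 0) + 2 * 0"
      using le by (intro LIMSEQ_le_const) auto
    also have "\<dots> = 4 * ennreal E"
      using ennreal_mult'[of 2 "2 * E"] ennreal_mult'[of 4 E] by simp
    finally show ?thesis unfolding E_def .
  qed
qed

text \<open>As overlapping intervals are allowed, the difference of two simple integrands is a
  concatenation of lists, with the coefficients of the second negated.\<close>

lemma has_ito_integral_diff:
  fixes Z Z' :: "real \<Rightarrow> 'w \<Rightarrow> real ^ 'd"
  assumes I: "has_ito_integral M T F B Z I" and I': "has_ito_integral M T F B Z' I'"
    and Z: "jointly_measurable M {0..T} Z" and Z': "jointly_measurable M {0..T} Z'"
  shows "has_ito_integral M T F B (\<lambda>s \<omega>. Z s \<omega> - Z' s \<omega>) (\<lambda>t \<omega>. I t \<omega> - I' t \<omega>)"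
proof -
  obtain xs :: "nat \<Rightarrow> ('w, 'd) simple_integrand" where xs: "\<And>n. is_simple_integrand M T F (xs n)"
    and lim1: "(\<lambda>n. energy M {0..T} (\<lambda>s \<omega>. simple_process (xs n) s \<omega> - Z s \<omega>)) \<longlonglongrightarrow> 0"
    and lim2: "\<And>t. t \<in> {0..T} \<Longrightarrow> (\<lambda>n. \<integral>\<^sup>+\<omega>. ennreal ((simple_integral B (xs n) t \<omega> - I t \<omega>)\<^sup>2) \<partial>M) \<longlonglongrightarrow> 0"
    using I unfolding has_ito_integral_def by blast
  obtain ys :: "nat \<Rightarrow> ('w, 'd) simple_integrand" where ys: "\<And>n. is_simple_integrand M T F (ys n)"
    and lim1': "(\<lambda>n. energy M {0..T} (\<lambda>s \<omega>. simple_process (ys n) s \<omega> - Z' s \<omega>)) \<longlonglongrightarrow> 0"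
    and lim2': "\<And>t. t \<in> {0..T} \<Longrightarrow> (\<lambda>n. \<integral>\<^sup>+\<omega>. ennreal ((simple_integral B (ys n) t \<omega> - I' t \<omega>)\<^sup>2) \<partial>M) \<longlonglongrightarrow> 0"
    using I' unfolding has_ito_integral_def by blast
  define neg :: "('w, 'd) simple_integrand \<Rightarrow> ('w, 'd) simple_integrand"
    where "neg = map (\<lambda>(s, u, H). (s, u, \<lambda>\<omega>. - H \<omega>))"
  have neg_p: "simple_process (neg zs) s \<omega> = - simple_process zs s \<omega>" for zs s \<omega>
    unfolding simple_process_def neg_def by (induction zs) auto
  have neg_i: "simple_integral B (neg zs) s \<omega> = - simple_integral B zs s \<omega>" for zs s \<omega>
    unfolding simple_integral_def neg_def by (induction zs) auto
  define zs where "zs n = xs n @ neg (ys n)" for n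
  have zs_p: "simple_process (zs n) s \<omega> = simple_process (xs n) s \<omega> - simple_process (ys n) s \<omega>" for n s \<omega>
    using neg_p[of "ys n"] by (simp add: zs_def simple_process_def)
  have zs_i: "simple_integral B (zs n) s \<omega> = simple_integral B (xs n) s \<omega> - simple_integral B (ys n) s \<omega>" for n s \<omega>
    using neg_i[of "ys n"] by (simp add: zs_def simple_integral_def)
  have zs: "is_simple_integrand M T F (zs n)" for n
    using xs[of n] ys[of n] unfolding is_simple_integrand_def zs_def neg_def by fastforce
  have js: "jointly_measurable M {0..T} (simple_process (xs n))" "jointly_measurable M {0..T} (simple_process (ys n))" for n
    by (rule jointly_measurable_simple_process[OF xs] jointly_measurable_simple_process[OF ys]; simp)+
  have Im: "I t \<in> borel_measurable M" "I' t \<in> borel_measurable M" if "t \<in> {0..T}" for t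
    using I I' that unfolding has_ito_integral_def adapted_process_def
    by (auto intro!: measurable_F_M[of "I t" t] measurable_F_M[of "I' t" t])
  have sm: "simple_integral B (xs n) t \<in> borel_measurable M" "simple_integral B (ys n) t \<in> borel_measurable M" if "t \<in> {0..T}" for n t
    using square_integrable_simple_integral[OF _ _ xs] square_integrable_simple_integral[OF _ _ ys] that by (auto simp: square_integrable_def)
  have "(\<lambda>n. energy M {0..T} (\<lambda>s \<omega>. simple_process (zs n) s \<omega> - (Z s \<omega> - Z' s \<omega>))) \<longlonglongrightarrow> 0"
  proof (rule tendsto_sandwich[OF _ _ tendsto_const])
    show "\<forall>\<^sub>F n in sequentially. energy M {0..T} (\<lambda>s \<omega>. simple_process (zs n) s \<omega> - (Z s \<omega> - Z' s \<omega>)) \<le>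
      2 * energy M {0..T} (\<lambda>s \<omega>. simple_process (xs n) s \<omega> - Z s \<omega>) + 2 * energy M {0..T} (\<lambda>s \<omega>. simple_process (ys n) s \<omega> - Z' s \<omega>)"
    proof (rule always_eventually, rule allI)
      fix n
      have "energy M {0..T} (\<lambda>s \<omega>. simple_process (zs n) s \<omega> - (Z s \<omega> - Z' s \<omega>)) =
        energy M {0..T} (\<lambda>s \<omega>. (simple_process (xs n) s \<omega> - Z s \<omega>) + (Z' s \<omega> - simple_process (ys n) s \<omega>))"
        unfolding zs_p by (simp add: algebra_simps)
      also have "\<dots> \<le> 2 * energy M {0..T} (\<lambda>s \<omega>. simple_process (xs n) s \<omega> - Z s \<omega>) + 2 * energy M {0..T} (\<lambda>s \<omega>. Z' s \<omega> - simple_process (ys n) s \<omega>)"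
        by (intro energy_add_le jointly_measurable_diff js Z Z')
      finally show "energy M {0..T} (\<lambda>s \<omega>. simple_process (zs n) s \<omega> - (Z s \<omega> - Z' s \<omega>)) \<le>
      2 * energy M {0..T} (\<lambda>s \<omega>. simple_process (xs n) s \<omega> - Z s \<omega>) + 2 * energy M {0..T} (\<lambda>s \<omega>. simple_process (ys n) s \<omega> - Z' s \<omega>)"
        by (simp add: norm_minus_commute)
    qed
    have "(\<lambda>n. 2 * energy M {0..T} (\<lambda>s \<omega>. simple_process (xs n) s \<omega> - Z s \<omega>) + 2 * energy M {0..T} (\<lambda>s \<omega>. simple_process (ys n) s \<omega> - Z' s \<omega>)) \<longlonglongrightarrow> 2 * 0 + 2 * 0"
      by (intro tendsto_add ennreal_tendsto_cmult lim1 lim1') auto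
    then show "(\<lambda>n. 2 * energy M {0..T} (\<lambda>s \<omega>. simple_process (xs n) s \<omega> - Z s \<omega>) + 2 * energy M {0..T} (\<lambda>s \<omega>. simple_process (ys n) s \<omega> - Z' s \<omega>)) \<longlonglongrightarrow> 0"
      by simp
  qed simp
  moreover have "(\<lambda>n. \<integral>\<^sup>+\<omega>. ennreal ((simple_integral B (zs n) t \<omega> - (I t \<omega> - I' t \<omega>))\<^sup>2) \<partial>M) \<longlonglongrightarrow> 0" if t: "t \<in> {0..T}" for t
  proof (rule tendsto_sandwich[OF _ _ tendsto_const])
    let ?a = "\<lambda>n \<omega>. simple_integral B (xs n) t \<omega> - I t \<omega>" and ?b = "\<lambda>n \<omega>. simple_integral B (ys n) t \<omega> - I' t \<omega>"
    note [measurable] = sm[OF t] Im[OF t]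
    show "\<forall>\<^sub>F n in sequentially. (\<integral>\<^sup>+\<omega>. ennreal ((simple_integral B (zs n) t \<omega> - (I t \<omega> - I' t \<omega>))\<^sup>2) \<partial>M) \<le>
      2 * (\<integral>\<^sup>+\<omega>. ennreal ((?a n \<omega>)\<^sup>2) \<partial>M) + 2 * (\<integral>\<^sup>+\<omega>. ennreal ((?b n \<omega>)\<^sup>2) \<partial>M)"
    proof (rule always_eventually, rule allI)
      fix n
      have "(\<integral>\<^sup>+\<omega>. ennreal ((simple_integral B (zs n) t \<omega> - (I t \<omega> - I' t \<omega>))\<^sup>2) \<partial>M) \<le> (\<integral>\<^sup>+\<omega>. 2 * ennreal ((?a n \<omega>)\<^sup>2) + 2 * ennreal ((?b n \<omega>)\<^sup>2) \<partial>M)"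
      proof (intro nn_integral_mono)
        fix \<omega>
        have "simple_integral B (zs n) t \<omega> - (I t \<omega> - I' t \<omega>) = ?a n \<omega> - ?b n \<omega>" by (simp add: zs_i)
        then show "ennreal ((simple_integral B (zs n) t \<omega> - (I t \<omega> - I' t \<omega>))\<^sup>2) \<le> 2 * ennreal ((?a n \<omega>)\<^sup>2) + 2 * ennreal ((?b n \<omega>)\<^sup>2)"
          by (simp only: ennreal_diff_square_le)
      qed
      also have "\<dots> = 2 * (\<integral>\<^sup>+\<omega>. ennreal ((?a n \<omega>)\<^sup>2) \<partial>M) + 2 * (\<integral>\<^sup>+\<omega>. ennreal ((?b n \<omega>)\<^sup>2) \<partial>M)"
        by (subst nn_integral_add) (auto simp: nn_integral_cmult)
      finally show "(\<integral>\<^sup>+\<omega>. ennreal ((simple_integral B (zs n) t \<omega> - (I t \<omega> - I' t \<omega>))\<^sup>2) \<partial>M) \<le> \<dots>" .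
    qed
    have "(\<lambda>n. 2 * (\<integral>\<^sup>+\<omega>. ennreal ((?a n \<omega>)\<^sup>2) \<partial>M) + 2 * (\<integral>\<^sup>+\<omega>. ennreal ((?b n \<omega>)\<^sup>2) \<partial>M)) \<longlonglongrightarrow> 2 * 0 + 2 * 0"
      by (intro tendsto_add ennreal_tendsto_cmult lim2[OF t] lim2'[OF t]) auto
    then show "(\<lambda>n. 2 * (\<integral>\<^sup>+\<omega>. ennreal ((?a n \<omega>)\<^sup>2) \<partial>M) + 2 * (\<integral>\<^sup>+\<omega>. ennreal ((?b n \<omega>)\<^sup>2) \<partial>M)) \<longlonglongrightarrow> 0" by simp
  qed simp
  moreover have "adapted_process T F (\<lambda>t \<omega>. I t \<omega> - I' t \<omega>)"
    using I I' unfolding has_ito_integral_def adapted_process_def by (intro ballI borel_measurable_diff) blast+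
  moreover have "AE \<omega> in M. continuous_on {0..T} (\<lambda>t. I t \<omega> - I' t \<omega>)"
    using I I' unfolding has_ito_integral_def by (auto elim!: eventually_elim2 intro: continuous_on_diff)
  ultimately show ?thesis
    unfolding has_ito_integral_def using zs by blast
qed

end

section \<open>Processes dominated in \<open>L\<^sup>2\<close>\<close>

text \<open>The predictable and progressive algebras live on the strip
  \<open>space M \<times> {0..T}\<close>. In this form measurability can be brought over from them
  by composition.\<close>

lemma jointly_measurable_iff:
  fixes f :: "real \<Rightarrow> 'w \<Rightarrow> 'b::{real_normed_vector, second_countable_topology}"
  assumes "A \<in> sets borel"
  shows "jointly_measurable M A f \<longleftrightarrow> (\<lambda>(\<omega>, s). f s \<omega>) \<in> borel_measurable (restrict_space (M \<Otimes>\<^sub>M lborel) (space M \<times> A))"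
proof -
  have "space M \<times> A \<inter> space (M \<Otimes>\<^sub>M lborel) \<in> sets (M \<Otimes>\<^sub>M lborel)"
    using assms by auto
  then have "(\<lambda>(\<omega>, s). f s \<omega>) \<in> borel_measurable (restrict_space (M \<Otimes>\<^sub>M lborel) (space M \<times> A)) \<longleftrightarrow>
    (\<lambda>p. indicat_real (space M \<times> A) p *\<^sub>R (\<lambda>(\<omega>, s). f s \<omega>) p) \<in> borel_measurable (M \<Otimes>\<^sub>M lborel)"
    by (rule borel_measurable_restrict_space_iff)
  also have "\<dots> \<longleftrightarrow> jointly_measurable M A f"
    unfolding jointly_measurable_def
    by (intro measurable_cong) (auto simp: space_pair_measure indicator_def)
  finally show ?thesis ..
qed

lemma space_restrict_strip: "space (restrict_space (M \<Otimes>\<^sub>M lborel) (space M \<times> A)) = space M \<times> A"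
  by (auto simp: space_restrict_space space_pair_measure)

text \<open>Inclusion of sigma-algebras, phrased for the identity map so that it can be used with
  \<open>measurable_compose\<close>.\<close>

lemma measurable_sigma_strip:
  assumes A: "A \<in> sets borel" and C: "\<And>X. X \<in> \<C> \<Longrightarrow> X \<subseteq> space M \<times> A" "\<And>X. X \<in> \<C> \<Longrightarrow> X \<in> sets (M \<Otimes>\<^sub>M lborel)"
  shows "(\<lambda>x. x) \<in> measurable (restrict_space (M \<Otimes>\<^sub>M lborel) (space M \<times> A)) (sigma (space M \<times> A) \<C>)"
proof (rule measurable_measure_of)
  show "\<C> \<subseteq> Pow (space M \<times> A)" using C by auto
  fix X assume "X \<in> \<C>"
  moreover have "space M \<times> A \<inter> space (M \<Otimes>\<^sub>M lborel) \<in> sets (M \<Otimes>\<^sub>M lborel)"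
    using A by auto
  ultimately have "X \<in> sets (restrict_space (M \<Otimes>\<^sub>M lborel) (space M \<times> A))"
    using C[of X] by (subst sets_restrict_space_iff) auto
  then show "(\<lambda>x. x) -` X \<inter> space (restrict_space (M \<Otimes>\<^sub>M lborel) (space M \<times> A)) \<in> sets (restrict_space (M \<Otimes>\<^sub>M lborel) (space M \<times> A))"
    using C(1)[OF \<open>X \<in> \<C>\<close>] by (simp add: space_restrict_strip Int_absorb2)
qed (auto simp: space_restrict_strip)

text \<open>For varying \<open>n\<close> and \<open>i\<close> these times form a countable dense
  subset of \<open>[0,T]\<close>. Clipping makes every integer index admissible, and
  \<open>n + 1\<close> keeps the denominator positive.\<close>

definition grid :: "real \<Rightarrow> nat \<Rightarrow> int \<Rightarrow> real" where
  "grid T n i = max 0 (min T (of_int i / (real n + 1)))"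

lemma grid_mem: "0 \<le> T \<Longrightarrow> grid T n i \<in> {0..T}"
  by (auto simp: grid_def)

lemma grid_tendsto:
  assumes "t \<in> {0..T}"
  shows "(\<lambda>n. grid T n \<lfloor>(real n + 1) * t\<rfloor>) \<longlonglongrightarrow> t"
proof -
  have "(\<lambda>n. of_int \<lfloor>(real n + 1) * t\<rfloor> / (real n + 1)) \<longlonglongrightarrow> t"
  proof (rule tendsto_sandwich)
    show "\<forall>\<^sub>F n in sequentially. t - 1 / (real n + 1) \<le> of_int \<lfloor>(real n + 1) * t\<rfloor> / (real n + 1)"
    proof (rule always_eventually, rule allI)
      fix n :: nat
      have "(real n + 1) * t - 1 \<le> of_int \<lfloor>(real n + 1) * t\<rfloor>" by linarith
      then have "((real n + 1) * t - 1) / (real n + 1) \<le> of_int \<lfloor>(real n + 1) * t\<rfloor> / (real n + 1)"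
        by (intro divide_right_mono) auto
      then show "t - 1 / (real n + 1) \<le> of_int \<lfloor>(real n + 1) * t\<rfloor> / (real n + 1)"
        by (simp add: diff_divide_distrib)
    qed
    show "\<forall>\<^sub>F n in sequentially. of_int \<lfloor>(real n + 1) * t\<rfloor> / (real n + 1) \<le> t"
      by (intro always_eventually allI) (auto simp: pos_divide_le_eq mult.commute)
    have "(\<lambda>n. t - 1 / (real n + 1)) \<longlonglongrightarrow> t - 0"
      by (intro tendsto_diff tendsto_const LIMSEQ_ignore_initial_segment) (use LIMSEQ_inverse_real_of_nat in \<open>simp add: inverse_eq_divide add.commute\<close>)
    then show "(\<lambda>n. t - 1 / (real n + 1)) \<longlonglongrightarrow> t" by simp
  qed simp
  then have "(\<lambda>n. grid T n \<lfloor>(real n + 1) * t\<rfloor>) \<longlonglongrightarrow> max 0 (min T t)"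
    unfolding grid_def by (intro tendsto_intros)
  moreover have "max 0 (min T t) = t" using assms by auto
  ultimately show ?thesis by simp
qed

context brownian_motion begin

lemma jointly_measurable_predictable:
  fixes Z :: "real \<Rightarrow> 'w \<Rightarrow> 'b::{real_normed_vector, second_countable_topology}"
  assumes "(\<lambda>(\<omega>, t). Z t \<omega>) \<in> borel_measurable (predictable_algebra (space M) T F)"
  shows "jointly_measurable M {0..T} Z"
proof -
  have "(\<lambda>x. x) \<in> measurable (restrict_space (M \<Otimes>\<^sub>M lborel) (space M \<times> {0..T})) (predictable_algebra (space M) T F)"
    unfolding predictable_algebra_def
  proof (rule measurable_sigma_strip)
    fix X assume X: "X \<in> {A \<times> {0} | A. A \<in> sets (F 0)} \<union> {A \<times> {s<..u} | A s u. 0 \<le> s \<and> s \<le> u \<and> u \<le> T \<and> A \<in> sets (F s)}"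
    have FM: "A \<in> events" if "A \<in> sets (F s)" for A s using sets_F_subset that by blast
    show "X \<subseteq> space M \<times> {0..T}"
      using X T_pos FM[THEN sets.sets_into_space] by fastforce
    show "X \<in> sets (M \<Otimes>\<^sub>M lborel)"
      using X FM by auto
  qed auto
  from measurable_compose[OF this assms] show ?thesis
    by (subst jointly_measurable_iff) auto
qed

text \<open>The progressive condition at the final time \<open>t = T\<close> already yields
  measurability for the product with \<open>F T\<close>, hence with \<open>M\<close>.\<close>

lemma measurable_progressive:
  "(\<lambda>x. x) \<in> measurable (restrict_space (M \<Otimes>\<^sub>M lborel) (space M \<times> {0..T})) (progressive_algebra (space M) T F)"
  unfolding progressive_algebra_def
proof (rule measurable_sigma_strip)
  fix X assume X: "X \<in> {C. C \<subseteq> space M \<times> {0..T} \<and> (\<forall>t\<in>{0..T}. C \<inter> (space M \<times> {0..t}) \<in> sets (F t \<Otimes>\<^sub>M restrict_space borel {0..t}))}"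
  then show "X \<subseteq> space M \<times> {0..T}" by auto
  then have "X \<inter> (space M \<times> {0..T}) = X" by auto
  with X T_pos have "X \<in> sets (F T \<Otimes>\<^sub>M restrict_space borel {0..T})" by (auto dest!: bspec[where x=T])
  also have "\<dots> \<subseteq> sets (restrict_space (M \<Otimes>\<^sub>M lborel) (space M \<times> {0..T}))"
  proof -
    have sp: "space (F T) \<times> space (restrict_space borel {0..T}) = space (restrict_space (M \<Otimes>\<^sub>M lborel) (space M \<times> {0..T}))"
      by (auto simp: space_restrict_space space_pair_measure)
    show ?thesis
      unfolding sets_pair_measure sp
    proof (rule sets.sigma_sets_subset, clarify)
      fix a b assume a: "a \<in> sets (F T)" and b: "b \<in> sets (restrict_space borel {0..T})"
      have a': "a \<in> events" using a sets_F_subset by blast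
      have b': "b \<subseteq> {0..T}" "b \<in> sets borel"
        using b by (auto simp: sets_restrict_space_iff)
      show "a \<times> b \<in> sets (restrict_space (M \<Otimes>\<^sub>M lborel) (space M \<times> {0..T}))"
        using a' b' sets.sets_into_space[OF a'] by (subst sets_restrict_space_iff) auto
    qed
  qed
  also have "\<dots> \<subseteq> sets (M \<Otimes>\<^sub>M lborel)"
    by (auto simp: sets_restrict_space)
  finally show "X \<in> sets (M \<Otimes>\<^sub>M lborel)" .
qed auto

lemma jointly_measurable_driver:
  fixes f :: "'w \<Rightarrow> real \<Rightarrow> real \<Rightarrow> real ^ 'd \<Rightarrow> real"
  assumes f: "(\<lambda>((\<omega>, t), y, z). f \<omega> t y z) \<in> borel_measurable (progressive_algebra (space M) T F \<Otimes>\<^sub>M (borel \<Otimes>\<^sub>M borel))"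
    and Y: "jointly_measurable M {0..T} Y" and Z: "jointly_measurable M {0..T} Z"
  shows "jointly_measurable M {0..T} (\<lambda>t \<omega>. f \<omega> t (Y t \<omega>) (Z t \<omega>))"
proof -
  let ?R = "restrict_space (M \<Otimes>\<^sub>M lborel) (space M \<times> {0..T})"
  have "(\<lambda>p. (p, ((\<lambda>(\<omega>, s). Y s \<omega>) p, (\<lambda>(\<omega>, s). Z s \<omega>) p))) \<in> measurable ?R (progressive_algebra (space M) T F \<Otimes>\<^sub>M (borel \<Otimes>\<^sub>M borel))"
    using Y Z by (intro measurable_Pair measurable_progressive) (auto simp: jointly_measurable_iff)
  from measurable_compose[OF this f] show ?thesis
    by (subst jointly_measurable_iff) (auto simp: split_def)
qed

text \<open>The working form of \<open>S2\<close>: an integrable dominating variable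
  \<open>W\<close> replaces the supremum over uncountably many times, which need not be
  measurable.\<close>

definition regular :: "(real \<Rightarrow> 'w \<Rightarrow> real) \<Rightarrow> bool" where
  "regular Y \<longleftrightarrow> adapted_process T F Y \<and> (AE \<omega> in M. continuous_on {0..T} (\<lambda>t. Y t \<omega>)) \<and>
    (\<exists>W. integrable M W \<and> (AE \<omega> in M. \<forall>t\<in>{0..T}. (Y t \<omega>)\<^sup>2 \<le> W \<omega>))"

lemma regular_measurable_F: "regular Y \<Longrightarrow> t \<in> {0..T} \<Longrightarrow> Y t \<in> borel_measurable (F t)"
  by (auto simp: regular_def adapted_process_def)

lemma regular_measurable: "regular Y \<Longrightarrow> t \<in> {0..T} \<Longrightarrow> Y t \<in> borel_measurable M"
  by (blast intro: measurable_F_M regular_measurable_F)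

text \<open>The supremum \<open>V\<close> over the countable grid is measurable and lies below the
  one in \<open>S2\<close>, so its integral is finite. By path continuity it still bounds the square
  at every time, almost surely.\<close>

lemma regular_S2:
  assumes "Y \<in> S2 M T F"
  shows "regular Y"
proof -
  have ad: "adapted_process T F Y" and cont: "AE \<omega> in M. continuous_on {0..T} (\<lambda>t. Y t \<omega>)"
    and fin: "(\<integral>\<^sup>+\<omega>. (\<Squnion>t\<in>{0..T}. ennreal (\<bar>Y t \<omega>\<bar>\<^sup>2)) \<partial>M) < \<infinity>"
    using assms by (auto simp: S2_def)
  have Ym: "Y t \<in> borel_measurable M" if "t \<in> {0..T}" for t
    using ad that unfolding adapted_process_def by (intro measurable_F_M[of "Y t" t]) auto
  define V where "V \<omega> = (\<Squnion>(n, i)\<in>UNIV. ennreal (\<bar>Y (grid T n i) \<omega>\<bar>\<^sup>2))" for \<omega>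
  have gm: "grid T n i \<in> {0..T}" for n i using T_pos by (intro grid_mem) simp
  have Vm[measurable]: "V \<in> borel_measurable M"
    unfolding V_def[abs_def] using Ym[OF gm] by (intro borel_measurable_SUP) (auto simp: split_def)
  have "(\<integral>\<^sup>+\<omega>. V \<omega> \<partial>M) \<le> (\<integral>\<^sup>+\<omega>. (\<Squnion>t\<in>{0..T}. ennreal (\<bar>Y t \<omega>\<bar>\<^sup>2)) \<partial>M)"
    unfolding V_def using gm by (intro nn_integral_mono SUP_least) (auto intro!: SUP_upper)
  with fin have Vfin: "(\<integral>\<^sup>+\<omega>. V \<omega> \<partial>M) < \<infinity>" by (rule le_less_trans[rotated])
  have AEfin: "AE \<omega> in M. V \<omega> \<noteq> \<infinity>"
    using Vfin by (intro nn_integral_PInf_AE) auto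
  define W where "W \<omega> = enn2real (V \<omega>)" for \<omega>
  have "(\<integral>\<^sup>+\<omega>. ennreal (W \<omega>) \<partial>M) = (\<integral>\<^sup>+\<omega>. V \<omega> \<partial>M)"
    using AEfin by (intro nn_integral_cong_AE) (auto simp: W_def top.not_eq_extremum)
  then have "integrable M W"
    using Vfin by (intro integrableI_nonneg) (auto simp: W_def[abs_def])
  moreover have "AE \<omega> in M. \<forall>t\<in>{0..T}. (Y t \<omega>)\<^sup>2 \<le> W \<omega>"
    using AEfin cont
  proof eventually_elim
    case (elim \<omega>)
    show ?case
    proof
      fix t assume t: "t \<in> {0..T}"
      have "(\<lambda>n. Y (grid T n \<lfloor>(real n + 1) * t\<rfloor>) \<omega>) \<longlonglongrightarrow> Y t \<omega>"
        using gm by (intro continuous_on_tendsto_compose[OF elim(2) grid_tendsto[OF t] t]) auto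
      then have "(\<lambda>n. (Y (grid T n \<lfloor>(real n + 1) * t\<rfloor>) \<omega>)\<^sup>2) \<longlonglongrightarrow> (Y t \<omega>)\<^sup>2"
        by (intro tendsto_power)
      moreover have "(Y (grid T n i) \<omega>)\<^sup>2 \<le> W \<omega>" for n i
      proof -
        have "ennreal (\<bar>Y (grid T n i) \<omega>\<bar>\<^sup>2) \<le> V \<omega>"
          unfolding V_def by (rule SUP_upper2[of "(n, i)"]) auto
        also have "\<dots> = ennreal (W \<omega>)"
          using elim(1) by (simp add: W_def top.not_eq_extremum)
        finally show ?thesis by (simp add: W_def)
      qed
      ultimately show "(Y t \<omega>)\<^sup>2 \<le> W \<omega>"
        by (intro LIMSEQ_le_const2) auto
    qed
  qed
  ultimately show ?thesis using ad cont unfolding regular_def by blast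
qed

lemma regular_diff:
  assumes X: "regular X" and Y: "regular Y"
  shows "regular (\<lambda>t \<omega>. X t \<omega> - Y t \<omega>)"
proof -
  obtain W where W: "integrable M W" "AE \<omega> in M. \<forall>t\<in>{0..T}. (X t \<omega>)\<^sup>2 \<le> W \<omega>"
    using X by (auto simp: regular_def)
  obtain W' where W': "integrable M W'" "AE \<omega> in M. \<forall>t\<in>{0..T}. (Y t \<omega>)\<^sup>2 \<le> W' \<omega>"
    using Y by (auto simp: regular_def)
  have "AE \<omega> in M. \<forall>t\<in>{0..T}. (X t \<omega> - Y t \<omega>)\<^sup>2 \<le> 2 * W \<omega> + 2 * W' \<omega>"
    using W(2) W'(2)
  proof eventually_elim
    case (elim \<omega>)
    then show ?case by (auto intro!: order_trans[OF diff_square_le] add_mono)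
  qed
  moreover have "integrable M (\<lambda>\<omega>. 2 * W \<omega> + 2 * W' \<omega>)" using W W' by auto
  moreover have "adapted_process T F (\<lambda>t \<omega>. X t \<omega> - Y t \<omega>)"
    using X Y unfolding regular_def adapted_process_def by (intro ballI borel_measurable_diff) blast+
  moreover have "AE \<omega> in M. continuous_on {0..T} (\<lambda>t. X t \<omega> - Y t \<omega>)"
    using X Y unfolding regular_def by (auto elim!: eventually_elim2 intro: continuous_on_diff)
  ultimately show ?thesis unfolding regular_def by blast
qed

lemma regular_dominated:
  assumes "regular Y"
  obtains W where "square_integrable M W" "AE \<omega> in M. \<forall>t\<in>{0..T}. \<bar>Y t \<omega>\<bar> \<le> W \<omega>"
proof -
  obtain V where V: "integrable M V" "AE \<omega> in M. \<forall>t\<in>{0..T}. (Y t \<omega>)\<^sup>2 \<le> V \<omega>"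
    using assms by (auto simp: regular_def)
  have [measurable]: "V \<in> borel_measurable M" using V by auto
  have "integrable M (\<lambda>\<omega>. (sqrt \<bar>V \<omega>\<bar>)\<^sup>2)" using V by simp
  then have "square_integrable M (\<lambda>\<omega>. sqrt \<bar>V \<omega>\<bar>)" by (simp add: square_integrable_def)
  moreover have "AE \<omega> in M. \<forall>t\<in>{0..T}. \<bar>Y t \<omega>\<bar> \<le> sqrt \<bar>V \<omega>\<bar>"
    using V(2) by eventually_elim (auto intro!: real_le_rsqrt intro: order_trans)
  ultimately show thesis by (rule that)
qed

lemma regular_square_integrable:
  assumes "regular Y" "t \<in> {0..T}"
  shows "square_integrable M (Y t)"
proof -
  obtain W where W: "integrable M W" "AE \<omega> in M. \<forall>t\<in>{0..T}. (Y t \<omega>)\<^sup>2 \<le> W \<omega>"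
    using assms by (auto simp: regular_def)
  have m: "Y t \<in> borel_measurable M" using assms by (rule regular_measurable)
  have "integrable M (\<lambda>\<omega>. (Y t \<omega>)\<^sup>2)"
  proof (rule Bochner_Integration.integrable_bound[OF W(1)])
    show "AE \<omega> in M. norm ((Y t \<omega>)\<^sup>2) \<le> norm (W \<omega>)"
      using W(2) by eventually_elim (use assms(2) in fastforce)
  qed (use m in auto)
  then show ?thesis using m by (simp add: square_integrable_def)
qed

lemma continuous_on_expectation:
  assumes X: "\<And>t. t \<in> {0..T} \<Longrightarrow> X t \<in> borel_measurable M" and W: "integrable M W"
    and cont: "AE \<omega> in M. continuous_on {0..T} (\<lambda>t. X t \<omega>)"
    and dom: "AE \<omega> in M. \<forall>t\<in>{0..T}. \<bar>X t \<omega>\<bar> \<le> W \<omega>"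
  shows "continuous_on {0..T} (\<lambda>t. expectation (X t) :: real)"
  unfolding continuous_on_sequentially comp_def
proof (intro allI ballI impI, elim conjE)
  fix x :: "nat \<Rightarrow> real" and a assume a: "a \<in> {0..T}" and x: "\<forall>n. x n \<in> {0..T}" "x \<longlonglongrightarrow> a"
  show "(\<lambda>n. expectation (X (x n))) \<longlonglongrightarrow> expectation (X a)"
  proof (rule integral_dominated_convergence[where w=W])
    show "AE \<omega> in M. (\<lambda>n. X (x n) \<omega>) \<longlonglongrightarrow> X a \<omega>"
      using cont by eventually_elim (use a x in \<open>auto intro: continuous_on_tendsto_compose\<close>)
    show "AE \<omega> in M. norm (X (x n) \<omega>) \<le> W \<omega>" for n
      using dom by eventually_elim (use x in auto)
  qed (use X W a x in auto)
qed

lemma regular_continuous_expectation: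
  assumes "regular Y"
  shows "continuous_on {0..T} (\<lambda>t. expectation (Y t))"
proof -
  obtain W where "square_integrable M W" "AE \<omega> in M. \<forall>t\<in>{0..T}. \<bar>Y t \<omega>\<bar> \<le> W \<omega>"
    using regular_dominated[OF assms] .
  then show ?thesis
    using assms by (intro continuous_on_expectation[of Y W] square_integrable_integrable regular_measurable) (auto simp: regular_def)
qed

text \<open>Paths are set to zero on a null set that contains all discontinuous ones. The remaining
  paths are limits of their values at grid times, and for fixed \<open>n\<close> these values run
  through countably many functions of the outcome, which gives joint measurability.\<close>

lemma regular_modification:
  assumes Y: "regular Y"
  obtains Y' where "jointly_measurable M {0..T} Y'" "AE \<omega> in M. \<forall>t\<in>{0..T}. Y' t \<omega> = Y t \<omega>"
proof -
  from Y have "AE \<omega> in M. continuous_on {0..T} (\<lambda>t. Y t \<omega>)" by (simp add: regular_def)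
  then obtain N where N: "{\<omega> \<in> space M. \<not> continuous_on {0..T} (\<lambda>t. Y t \<omega>)} \<subseteq> N" "emeasure M N = 0" "N \<in> events"
    by (rule AE_E)
  define Y' where "Y' t \<omega> = indicat_real (- N) \<omega> * Y t \<omega>" for t \<omega>
  have gm: "grid T n i \<in> {0..T}" for n i using T_pos by (intro grid_mem) simp
  note [measurable] = regular_measurable[OF Y gm] N(3)
  have Nc: "(\<lambda>\<omega>. indicat_real (- N) \<omega>) \<in> borel_measurable M"
    using N(3) by (simp add: borel_measurable_indicator_iff Compl_eq_Diff_UNIV Int_Diff sets.Diff[OF sets.top])
  have "(\<lambda>p. indicat_real {0..T} (snd p) * Y' (snd p) (fst p)) \<in> borel_measurable (M \<Otimes>\<^sub>M lborel)"
  proof (rule borel_measurable_LIMSEQ_real)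
    fix n
    have "(\<lambda>p. (\<lambda>i p. indicat_real {0..T} (snd p) * Y' (grid T n i) (fst p)) (\<lfloor>(real n + 1) * snd p\<rfloor>) p) \<in> borel_measurable (M \<Otimes>\<^sub>M lborel)"
    proof (rule measurable_compose_countable)
      show "(\<lambda>p. \<lfloor>(real n + 1) * snd p\<rfloor>) \<in> measurable (M \<Otimes>\<^sub>M lborel) (count_space UNIV)"
        by measurable
      show "(\<lambda>p. indicat_real {0..T} (snd p) * Y' (grid T n i) (fst p)) \<in> borel_measurable (M \<Otimes>\<^sub>M lborel)" for i
        unfolding Y'_def using measurable_compose[OF measurable_fst Nc] by measurable
    qed
    then show "(\<lambda>p. indicat_real {0..T} (snd p) * Y' (grid T n \<lfloor>(real n + 1) * snd p\<rfloor>) (fst p)) \<in> borel_measurable (M \<Otimes>\<^sub>M lborel)" .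
  next
    fix p :: "'w \<times> real" assume p: "p \<in> space (M \<Otimes>\<^sub>M lborel)"
    obtain \<omega> t where pt: "p = (\<omega>, t)" "\<omega> \<in> space M" using p by (cases p) (auto simp: space_pair_measure)
    show "(\<lambda>n. indicat_real {0..T} (snd p) * Y' (grid T n \<lfloor>(real n + 1) * snd p\<rfloor>) (fst p)) \<longlonglongrightarrow> indicat_real {0..T} (snd p) * Y' (snd p) (fst p)"
    proof (cases "t \<in> {0..T} \<and> \<omega> \<notin> N")
      case True
      then have "continuous_on {0..T} (\<lambda>t. Y t \<omega>)" using N(1) pt by auto
      then have "(\<lambda>n. Y (grid T n \<lfloor>(real n + 1) * t\<rfloor>) \<omega>) \<longlonglongrightarrow> Y t \<omega>"
        using gm True by (intro continuous_on_tendsto_compose[OF _ grid_tendsto]) auto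
      then show ?thesis using True by (simp add: pt Y'_def)
    qed (auto simp: pt Y'_def)
  qed
  then have "jointly_measurable M {0..T} Y'"
    by (simp add: jointly_measurable_def split_def)
  moreover have "AE \<omega> in M. \<omega> \<notin> N" using N by (intro AE_not_in) auto
  then have "AE \<omega> in M. \<forall>t\<in>{0..T}. Y' t \<omega> = Y t \<omega>" by eventually_elim (simp add: Y'_def)
  ultimately show thesis by (rule that)
qed

end

section \<open>The difference of two solutions is deterministic\<close>

lemma energy_union_le:
  assumes "jointly_measurable M A f" "jointly_measurable M A' f" "jointly_measurable M (A \<union> A') f"
  shows "energy M (A \<union> A') f \<le> energy M A f + energy M A' f"
proof -
  note [measurable] = jointly_measurable_nn_integrand[OF assms(1)] jointly_measurable_nn_integrand[OF assms(2)]
  have "energy M (A \<union> A') f \<le> (\<integral>\<^sup>+p. (\<lambda>(\<omega>, s). ennreal ((norm (f s \<omega>))\<^sup>2) * indicator A s) p + (\<lambda>(\<omega>, s). ennreal ((norm (f s \<omega>))\<^sup>2) * indicator A' s) p \<partial>(M \<Otimes>\<^sub>M lborel))"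
    unfolding energy_eq_pair[OF assms(3)] by (intro nn_integral_mono) (auto split: split_indicator)
  also have "\<dots> = energy M A f + energy M A' f"
    unfolding energy_eq_pair[OF assms(1)] energy_eq_pair[OF assms(2)] by (rule nn_integral_add) simp_all
  finally show ?thesis .
qed

lemma jointly_measurable_deterministic:
  assumes "continuous_on A m" "A \<in> sets borel"
  shows "jointly_measurable M A (\<lambda>s \<omega>. m s :: real)"
proof -
  have [measurable]: "(\<lambda>s. indicat_real A s *\<^sub>R m s) \<in> borel_measurable borel"
    by (rule borel_measurable_continuous_on_indicator) (use assms in auto)
  have "(\<lambda>p. (\<lambda>s. indicat_real A s *\<^sub>R m s) (snd p)) \<in> borel_measurable (M \<Otimes>\<^sub>M lborel)"
    by measurable
  then show ?thesis by (simp add: jointly_measurable_def split_def)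
qed

context brownian_motion begin

lemma energy_Fubini:
  fixes y :: "real \<Rightarrow> 'w \<Rightarrow> real"
  assumes y: "jointly_measurable M A y"
  shows "energy M A y = (\<integral>\<^sup>+s\<in>A. (\<integral>\<^sup>+\<omega>. ennreal ((y s \<omega>)\<^sup>2) \<partial>M) \<partial>lborel)"
proof -
  interpret pair_sigma_finite M lborel ..
  have "energy M A y = (\<integral>\<^sup>+(\<omega>, s). ennreal ((norm (y s \<omega>))\<^sup>2) * indicator A s \<partial>(M \<Otimes>\<^sub>M lborel))"
    by (rule energy_eq_pair[OF y])
  also have "\<dots> = (\<integral>\<^sup>+s. (\<integral>\<^sup>+\<omega>. ennreal ((norm (y s \<omega>))\<^sup>2) * indicator A s \<partial>M) \<partial>lborel)"
    using nn_integral_snd[OF jointly_measurable_nn_integrand[OF y]] by simp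
  also have "\<dots> = (\<integral>\<^sup>+s\<in>A. (\<integral>\<^sup>+\<omega>. ennreal ((y s \<omega>)\<^sup>2) \<partial>M) \<partial>lborel)"
    by (intro nn_integral_cong) (auto split: split_indicator)
  finally show ?thesis .
qed

text \<open>Pythagoras for three mutually orthogonal summands, the third being constant.\<close>

lemma expectation_square_orthogonal:
  assumes V: "square_integrable M V" and Q: "square_integrable M Q"
    and "expectation V = 0" "expectation Q = 0" "expectation (\<lambda>\<omega>. V \<omega> * Q \<omega>) = 0"
  shows "expectation (\<lambda>\<omega>. (V \<omega> + Q \<omega> + k)\<^sup>2) = expectation (\<lambda>\<omega>. (V \<omega>)\<^sup>2) + expectation (\<lambda>\<omega>. (Q \<omega>)\<^sup>2) + k\<^sup>2"
proof -
  have int: "integrable M (\<lambda>\<omega>. (V \<omega>)\<^sup>2)" "integrable M (\<lambda>\<omega>. (Q \<omega>)\<^sup>2)" "integrable M (\<lambda>\<omega>. V \<omega> * Q \<omega>)"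
    "integrable M V" "integrable M Q"
    by (intro square_integrable_integrable_square square_integrable_integrable integrable_mult_square_integrable V Q)+
  have "expectation (\<lambda>\<omega>. (V \<omega> + Q \<omega> + k)\<^sup>2) =
    expectation (\<lambda>\<omega>. (V \<omega>)\<^sup>2 + (Q \<omega>)\<^sup>2 + 2 * (V \<omega> * Q \<omega>) + (2 * k) * V \<omega> + (2 * k) * Q \<omega> + k\<^sup>2)"
    by (intro Bochner_Integration.integral_cong) (auto simp: power2_eq_square algebra_simps)
  also have "\<dots> = expectation (\<lambda>\<omega>. (V \<omega>)\<^sup>2) + expectation (\<lambda>\<omega>. (Q \<omega>)\<^sup>2) + k\<^sup>2"
    using int assms(3-5) by (simp add: prob_space)
  finally show ?thesis .
qed

section \<open>Absorption of the variance on short intervals\<close>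

context
  fixes D :: "real \<Rightarrow> 'w \<Rightarrow> real" and J :: "real \<Rightarrow> 'w \<Rightarrow> real" and z :: "real \<Rightarrow> 'w \<Rightarrow> real ^ 'd" and C :: real
    and c :: "real \<Rightarrow> real \<Rightarrow> real" and m :: "real \<Rightarrow> real"
  defines "m \<equiv> \<lambda>t. expectation (D t)"
  assumes D: "regular D" and J: "has_ito_integral M T F B z J" and z: "jointly_measurable M {0..T} z"
    and C: "0 \<le> C"
    and increment_bound: "\<And>t r. 0 \<le> t \<Longrightarrow> t \<le> r \<Longrightarrow> r \<le> T \<Longrightarrow> AE \<omega> in M.
      ennreal ((D t \<omega> - D r \<omega> + (J r \<omega> - J t \<omega>) - c t r)\<^sup>2) \<le> ennreal (C * (r - t)) *
        (\<integral>\<^sup>+s\<in>{t<..r}. (ennreal ((D s \<omega> - m s)\<^sup>2) + ennreal ((norm (z s \<omega>))\<^sup>2)) \<partial>lborel)"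
begin

text \<open>As \<open>D r\<close> equals \<open>m r\<close>, the quantity squared in
  \<open>increment_bound\<close> is \<open>V + Q + k\<close> with \<open>V = D t - m t\<close>,
  \<open>Q = J r - J t\<close> and the constant \<open>k = m t - m r - c t r\<close>. Here
  \<open>V\<close> is centred and measurable at time \<open>t\<close>, so \<open>Q\<close> is
  orthogonal to it and the second moment splits into the three squares on the left.\<close>

lemma variance_estimate:
  assumes t: "0 \<le> t" "t \<le> r" "r \<le> T" and r: "AE \<omega> in M. D r \<omega> = m r"
    and S: "0 \<le> S" "\<And>s. s \<in> {t..r} \<Longrightarrow> variance (D s) \<le> S"
  shows "ennreal (variance (D t) + expectation (\<lambda>\<omega>. (J r \<omega> - J t \<omega>)\<^sup>2) + (m t - m r - c t r)\<^sup>2) \<le>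
    ennreal (C * (r - t)) * (ennreal (S * (r - t)) + energy M {t<..r} z)"
proof -
  have tT: "t \<in> {0..T}" "r \<in> {0..T}" using t by auto
  note c = increment_bound[OF t]
  \<comment> \<open>Fubini is applied to this modification, as \<open>D\<close> itself need not be
    jointly measurable.\<close>
  obtain D' where D': "jointly_measurable M {0..T} D'" "AE \<omega> in M. \<forall>t\<in>{0..T}. D' t \<omega> = D t \<omega>"
    using regular_modification[OF D] .
  have mc: "continuous_on {0..T} m" unfolding m_def by (rule regular_continuous_expectation[OF D])
  define y where "y s \<omega> = D' s \<omega> - m s" for s \<omega>
  have y0: "jointly_measurable M {0..T} y"
    unfolding y_def by (intro jointly_measurable_diff D' jointly_measurable_deterministic mc) simp
  have y: "jointly_measurable M {t<..r} y" and z': "jointly_measurable M {t<..r} z"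
    using t by (auto intro: jointly_measurable_subset[OF y0] jointly_measurable_subset[OF z])
  let ?V = "\<lambda>\<omega>. D t \<omega> - m t" and ?Q = "\<lambda>\<omega>. J r \<omega> - J t \<omega>"
  define k where "k = m t - m r - c t r"
  have Dsq: "square_integrable M (D s)" if "s \<in> {0..T}" for s by (rule regular_square_integrable[OF D that])
  have V: "square_integrable M ?V" using Dsq[OF tT(1)] by (intro square_integrable_diff) auto
  have Jsq: "square_integrable M (J t)" "square_integrable M (J r)"
    using square_integrable_ito_integral[OF J] t by auto
  then have Q: "square_integrable M ?Q" by (intro square_integrable_diff)
  have EV: "expectation ?V = 0"
    using square_integrable_integrable[OF Dsq[OF tT(1)]] by (simp add: m_def prob_space)
  have "expectation (\<lambda>\<omega>. 1 * ?Q \<omega>) = 0"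
    by (rule expectation_mult_ito_integral[OF J t]) auto
  then have EQ: "expectation ?Q = 0" by simp
  have EVQ: "expectation (\<lambda>\<omega>. ?V \<omega> * ?Q \<omega>) = 0"
    by (rule expectation_mult_ito_integral[OF J t _ V]) (use regular_measurable_F[OF D tT(1)] in auto)
  have sq: "square_integrable M (\<lambda>\<omega>. ?V \<omega> + ?Q \<omega> + k)"
    by (intro square_integrable_add V Q square_integrable_const)
  have "ennreal (variance (D t) + expectation (\<lambda>\<omega>. (?Q \<omega>)\<^sup>2) + (m t - m r - c t r)\<^sup>2) = ennreal (expectation (\<lambda>\<omega>. (?V \<omega> + ?Q \<omega> + k)\<^sup>2))"
    unfolding expectation_square_orthogonal[OF V Q EV EQ EVQ] by (simp only: k_def m_def)
  also have "\<dots> = (\<integral>\<^sup>+\<omega>. ennreal ((?V \<omega> + ?Q \<omega> + k)\<^sup>2) \<partial>M)"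
    by (rule nn_integral_square_eq[OF sq, symmetric])
  also have "\<dots> \<le> (\<integral>\<^sup>+\<omega>. ennreal (C * (r - t)) * ((\<integral>\<^sup>+s\<in>{t<..r}. ennreal ((norm (y s \<omega>))\<^sup>2) \<partial>lborel) + (\<integral>\<^sup>+s\<in>{t<..r}. ennreal ((norm (z s \<omega>))\<^sup>2) \<partial>lborel)) \<partial>M)"
  proof (rule nn_integral_mono_AE)
    show "AE \<omega> in M. ennreal ((?V \<omega> + ?Q \<omega> + k)\<^sup>2) \<le> ennreal (C * (r - t)) * ((\<integral>\<^sup>+s\<in>{t<..r}. ennreal ((norm (y s \<omega>))\<^sup>2) \<partial>lborel) + (\<integral>\<^sup>+s\<in>{t<..r}. ennreal ((norm (z s \<omega>))\<^sup>2) \<partial>lborel))"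
      using AE_space c r D'(2)
    proof eventually_elim
      case (elim \<omega>)
      have eq: "(?V \<omega> + ?Q \<omega> + k) = (D t \<omega> - D r \<omega> + (J r \<omega> - J t \<omega>) - c t r)"
        using elim(3) by (simp add: k_def)
      have "ennreal ((?V \<omega> + ?Q \<omega> + k)\<^sup>2) \<le> ennreal (C * (r - t)) *
        (\<integral>\<^sup>+s\<in>{t<..r}. (ennreal ((D s \<omega> - m s)\<^sup>2) + ennreal ((norm (z s \<omega>))\<^sup>2)) \<partial>lborel)"
        unfolding eq by (rule elim(2))
      also have "(\<integral>\<^sup>+s\<in>{t<..r}. (ennreal ((D s \<omega> - m s)\<^sup>2) + ennreal ((norm (z s \<omega>))\<^sup>2)) \<partial>lborel) =
        (\<integral>\<^sup>+s. ennreal ((norm (y s \<omega>))\<^sup>2) * indicator {t<..r} s + ennreal ((norm (z s \<omega>))\<^sup>2) * indicator {t<..r} s \<partial>lborel)"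
        using elim(4) t by (intro nn_integral_cong) (auto simp: y_def split: split_indicator)
      also have "\<dots> = (\<integral>\<^sup>+s\<in>{t<..r}. ennreal ((norm (y s \<omega>))\<^sup>2) \<partial>lborel) + (\<integral>\<^sup>+s\<in>{t<..r}. ennreal ((norm (z s \<omega>))\<^sup>2) \<partial>lborel)"
        using measurable_compose[OF measurable_Pair1'[OF elim(1)] jointly_measurable_nn_integrand[OF y]]
          measurable_compose[OF measurable_Pair1'[OF elim(1)] jointly_measurable_nn_integrand[OF z']]
        by (intro nn_integral_add) auto
      finally show ?case .
    qed
  qed
  also have "\<dots> = ennreal (C * (r - t)) * (energy M {t<..r} y + energy M {t<..r} z)"
    using lborel.borel_measurable_nn_integral_fst[OF jointly_measurable_nn_integrand[OF y]]
      lborel.borel_measurable_nn_integral_fst[OF jointly_measurable_nn_integrand[OF z']]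
    by (simp add: nn_integral_cmult nn_integral_add)
  also have "energy M {t<..r} y \<le> ennreal (S * (r - t))"
  proof -
    have "(\<integral>\<^sup>+\<omega>. ennreal ((y s \<omega>)\<^sup>2) \<partial>M) \<le> ennreal S" if s: "s \<in> {t<..r}" for s
    proof -
      have sT: "s \<in> {0..T}" using s t by auto
      have "(\<integral>\<^sup>+\<omega>. ennreal ((y s \<omega>)\<^sup>2) \<partial>M) = (\<integral>\<^sup>+\<omega>. ennreal ((D s \<omega> - m s)\<^sup>2) \<partial>M)"
        using D'(2) by (intro nn_integral_cong_AE) (auto simp: y_def elim!: eventually_mono dest!: bspec[OF _ sT])
      also have "\<dots> = ennreal (variance (D s))"
        unfolding m_def using Dsq[OF sT] by (intro nn_integral_square_eq square_integrable_diff) auto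
      also have "\<dots> \<le> ennreal S" using S(2)[of s] s by (intro ennreal_leI) auto
      finally show ?thesis .
    qed
    then have "energy M {t<..r} y \<le> (\<integral>\<^sup>+s. ennreal S * indicator {t<..r} s \<partial>lborel)"
      unfolding energy_Fubini[OF y] by (intro nn_integral_mono) (auto split: split_indicator)
    also have "\<dots> = ennreal (S * (r - t))"
      using t S by (simp add: nn_integral_cmult_indicator ennreal_mult')
    finally show ?thesis .
  qed
  finally show ?thesis by (simp add: mult_left_mono add_right_mono)
qed

text \<open>Let \<open>S\<close> be the supremum of the variances over \<open>[t0,r]\<close>,
  \<open>E\<close> the energy of \<open>z\<close> there and \<open>e\<close> the second moment of
  \<open>J r - J t0\<close>. Then \<open>S\<close> and \<open>e\<close> are at most
  \<open>C * \<delta> * (S + E)\<close> by \<open>variance_estimate\<close>, and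
  \<open>E \<le> 4 * e\<close> by the half isometry, so
  \<open>S + E \<le> 5 * (C * \<delta>) * (S + E)\<close>, which is at most half of
  \<open>S + E\<close>. The condition \<open>\<delta> \<le> 1\<close> serves to drop the factor
  \<open>r - t\<close> next to \<open>S\<close>.\<close>

lemma zero_variance_step:
  assumes r: "0 \<le> r" "r \<le> T" "AE \<omega> in M. D r \<omega> = m r"
    and \<delta>: "0 < \<delta>" "\<delta> \<le> 1" "10 * (C * \<delta>) \<le> 1" and t0: "t0 = max 0 (r - \<delta>)"
  shows "\<And>t. t \<in> {t0..r} \<Longrightarrow> AE \<omega> in M. D t \<omega> = m t" and "energy M {t0<..r} z = 0"
proof -
  have t0r: "0 \<le> t0" "t0 \<le> r" "r - t0 \<le> \<delta>" using r \<delta> t0 by auto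
  have Dsq: "square_integrable M (D s)" if "s \<in> {0..T}" for s by (rule regular_square_integrable[OF D that])
  obtain W where W: "integrable M W" "AE \<omega> in M. \<forall>t\<in>{0..T}. (D t \<omega>)\<^sup>2 \<le> W \<omega>"
    using D by (auto simp: regular_def)
  \<comment> \<open>A bound that is uniform in \<open>s\<close>: absorption requires
    \<open>S\<close> to be finite beforehand.\<close>
  have vb: "variance (D s) \<le> expectation W" if "s \<in> {0..T}" for s
  proof -
    have "variance (D s) = expectation (\<lambda>\<omega>. (D s \<omega>)\<^sup>2) - (expectation (D s))\<^sup>2"
      using Dsq[OF that] by (intro variance_eq square_integrable_integrable square_integrable_integrable_square)
    also have "\<dots> \<le> expectation (\<lambda>\<omega>. (D s \<omega>)\<^sup>2)" by simp
    also have "\<dots> \<le> expectation W"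
      using W Dsq[OF that] that by (intro integral_mono_AE) (auto simp: square_integrable_def)
    finally show ?thesis .
  qed
  define S where "S = (SUP s\<in>{t0..r}. variance (D s))"
  have bdd: "bdd_above ((\<lambda>s. variance (D s)) ` {t0..r})"
    using vb t0r r by (intro bdd_aboveI2[of _ _ "expectation W"]) auto
  have vS: "variance (D s) \<le> S" if "s \<in> {t0..r}" for s
    unfolding S_def using bdd that by (intro cSUP_upper) auto
  have S0: "0 \<le> S" using order_trans[OF variance_positive vS[of r]] t0r by simp
  define e where "e = expectation (\<lambda>\<omega>. (J r \<omega> - J t0 \<omega>)\<^sup>2)"
  have Ele: "energy M {t0<..r} z \<le> 4 * ennreal e"
    unfolding e_def using t0r r by (intro energy_le_ito_integral[OF J z]) auto
  have Efin: "energy M {t0<..r} z < \<infinity>"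
    by (rule le_less_trans[OF Ele]) (auto simp: ennreal_mult_less_top)
  define E where "E = enn2real (energy M {t0<..r} z)"
  have E: "energy M {t0<..r} z = ennreal E" "0 \<le> E" using Efin by (auto simp: E_def)
  have e0: "0 \<le> e" by (simp add: e_def)
  have "ennreal E \<le> ennreal (4 * e)" using Ele E e0 by (simp add: ennreal_mult)
  then have Ee: "E \<le> 4 * e" using e0 by simp
  have est: "variance (D t) + expectation (\<lambda>\<omega>. (J r \<omega> - J t \<omega>)\<^sup>2) \<le> C * \<delta> * (S + E)" if t: "t \<in> {t0..r}" for t
  proof -
    have t': "0 \<le> t" "t \<le> r" "r - t \<le> \<delta>" using t t0r by auto
    have "ennreal (variance (D t) + expectation (\<lambda>\<omega>. (J r \<omega> - J t \<omega>)\<^sup>2) + (m t - m r - c t r)\<^sup>2) \<le>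
        ennreal (C * (r - t)) * (ennreal (S * (r - t)) + energy M {t<..r} z)"
    proof (rule variance_estimate[OF t'(1,2) r(2,3) S0])
      show "variance (D s) \<le> S" if "s \<in> {t..r}" for s using that t by (intro vS) auto
    qed
    also have "\<dots> \<le> ennreal (C * \<delta>) * (ennreal S + ennreal E)"
    proof (rule mult_mono[OF ennreal_leI add_mono[OF ennreal_leI]])
      show "C * (r - t) \<le> C * \<delta>" using C t' by (intro mult_left_mono) auto
      show "S * (r - t) \<le> S" using S0 t' \<delta> by (intro mult_left_le) auto
      show "energy M {t<..r} z \<le> ennreal E" unfolding E(1)[symmetric] using t by (intro energy_mono) auto
    qed auto
    also have "\<dots> = ennreal (C * \<delta> * (S + E))"
      using C \<delta> S0 E by (simp add: ennreal_mult ennreal_plus)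
    finally have "variance (D t) + expectation (\<lambda>\<omega>. (J r \<omega> - J t \<omega>)\<^sup>2) + (m t - m r - c t r)\<^sup>2 \<le> C * \<delta> * (S + E)"
      using C \<delta> S0 E by (subst (asm) ennreal_le_iff) auto
    then show ?thesis using zero_le_power2[of "m t - m r - c t r"] by linarith
  qed
  have "S \<le> C * \<delta> * (S + E)"
    unfolding S_def[symmetric]
  proof (subst S_def, rule cSUP_least)
    show "variance (D s) \<le> C * \<delta> * (S + E)" if "s \<in> {t0..r}" for s
    proof -
      have "0 \<le> expectation (\<lambda>\<omega>. (J r \<omega> - J s \<omega>)\<^sup>2)" by simp
      then show ?thesis using est[OF that] by linarith
    qed
  qed (use t0r in auto)
  moreover have "e \<le> C * \<delta> * (S + E)"
  proof -
    have "variance (D t0) + e \<le> C * \<delta> * (S + E)"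
      unfolding e_def using t0r by (intro est) auto
    then show ?thesis using variance_positive[of "D t0"] by linarith
  qed
  ultimately have "S + E \<le> 5 * (C * \<delta>) * (S + E)" using Ee by (simp add: algebra_simps)
  also have "\<dots> \<le> 1 / 2 * (S + E)" using \<delta>(3) S0 E by (intro mult_right_mono) auto
  finally have SE: "S = 0" "E = 0" using S0 E by auto
  show "energy M {t0<..r} z = 0" using E SE by simp
  fix t assume t: "t \<in> {t0..r}"
  then have tT: "t \<in> {0..T}" using t0r r by auto
  have "expectation (\<lambda>\<omega>. (D t \<omega> - m t)\<^sup>2) = 0"
    using vS[OF t] SE variance_positive[of "D t"] by (simp add: m_def)
  moreover have "integrable M (\<lambda>\<omega>. (D t \<omega> - m t)\<^sup>2)"
    using square_integrable_diff[OF Dsq[OF tT] square_integrable_const[of "m t"]] by (simp add: square_integrable_def)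
  ultimately have "AE \<omega> in M. (D t \<omega> - m t)\<^sup>2 = 0"
    by (subst (asm) integral_nonneg_eq_0_iff_AE) auto
  then show "AE \<omega> in M. D t \<omega> = m t" by eventually_elim simp
qed

lemma zero_variance:
  assumes DT: "AE \<omega> in M. D T \<omega> = m T"
  shows "\<And>t. t \<in> {0..T} \<Longrightarrow> AE \<omega> in M. D t \<omega> = m t" and "energy M {0<..T} z = 0"
proof -
  \<comment> \<open>This length satisfies both conditions of \<open>zero_variance_step\<close>, also
    for \<open>C = 0\<close>. It depends on \<open>C\<close> alone, so finitely many steps lead from
    \<open>T\<close> back to \<open>0\<close>.\<close>
  define \<delta> where "\<delta> = 1 / (10 * C + 10)"
  have \<delta>: "0 < \<delta>" "\<delta> \<le> 1" "10 * (C * \<delta>) \<le> 1" using C by (auto simp: \<delta>_def field_simps)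
  have *: "(\<forall>t\<in>{max 0 (T - real n * \<delta>)..T}. AE \<omega> in M. D t \<omega> = m t) \<and> energy M {max 0 (T - real n * \<delta>)<..T} z = 0" for n
  proof (induction n)
    case 0
    have "{max 0 T<..T} = {}" by auto
    then show ?case using DT T_pos by (auto simp: max_def)
  next
    case (Suc n)
    define r where "r = max 0 (T - real n * \<delta>)"
    define t0 where "t0 = max 0 (r - \<delta>)"
    have t0: "t0 = max 0 (T - real (Suc n) * \<delta>)" using \<delta> by (auto simp: t0_def r_def algebra_simps max_def)
    have r: "0 \<le> r" "r \<le> T" using T_pos \<delta> by (auto simp: r_def)
    have IH: "\<And>t. t \<in> {r..T} \<Longrightarrow> AE \<omega> in M. D t \<omega> = m t" "energy M {r<..T} z = 0"
      using Suc.IH by (auto simp: r_def)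
    have rr: "AE \<omega> in M. D r \<omega> = m r" using IH(1)[of r] r by simp
    note step = zero_variance_step[OF r rr \<delta> t0_def]
    have t0r: "0 \<le> t0" "t0 \<le> r" using \<delta> r by (auto simp: t0_def)
    have U: "{t0<..T} = {t0<..r} \<union> {r<..T}" using t0r r by auto
    have "energy M ({t0<..r} \<union> {r<..T}) z \<le> energy M {t0<..r} z + energy M {r<..T} z"
      using t0r r by (intro energy_union_le jointly_measurable_subset[OF z]) auto
    then have "energy M {t0<..T} z = 0" using step(2) IH(2) by (simp add: U)
    moreover have "AE \<omega> in M. D t \<omega> = m t" if "t \<in> {t0..T}" for t
      using step(1)[of t] IH(1)[of t] that by (cases "t \<le> r") auto
    ultimately show ?case unfolding t0[symmetric] by blast
  qed
  obtain n where "T / \<delta> \<le> real n" using real_arch_simple by blast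
  then have "max 0 (T - real n * \<delta>) = 0" using \<delta> by (simp add: divide_le_eq)
  with *[of n] show "\<And>t. t \<in> {0..T} \<Longrightarrow> AE \<omega> in M. D t \<omega> = m t" "energy M {0<..T} z = 0" by auto
qed

text \<open>With \<open>S = 0\<close> and zero energy the right-hand side of
  \<open>variance_estimate\<close> vanishes, and with it the square that was kept on the
  left.\<close>

lemma deterministic_increment:
  assumes DT: "AE \<omega> in M. D T \<omega> = m T" and t: "0 \<le> t" "t \<le> r" "r \<le> T"
  shows "m t - m r = c t r"
proof -
  note Dm = zero_variance(1)[OF DT]
  have v0: "variance (D s) \<le> 0" if "s \<in> {0..T}" for s
  proof -
    have "variance (D s) = expectation (\<lambda>\<omega>. 0)"
      using Dm[OF that] regular_measurable[OF D that] by (intro integral_cong_AE) (auto simp: m_def)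
    then show ?thesis by simp
  qed
  have "energy M {t<..r} z \<le> energy M {0<..T} z" using t by (intro energy_mono) auto
  then have "energy M {t<..r} z = 0" using zero_variance(2)[OF DT] by simp
  then have "ennreal (variance (D t) + expectation (\<lambda>\<omega>. (J r \<omega> - J t \<omega>)\<^sup>2) + (m t - m r - c t r)\<^sup>2) \<le> 0"
    using variance_estimate[OF t Dm[of r], of 0] t v0 by simp
  then have "variance (D t) + expectation (\<lambda>\<omega>. (J r \<omega> - J t \<omega>)\<^sup>2) + (m t - m r - c t r)\<^sup>2 \<le> 0"
    by (simp only: le_zero_eq ennreal_eq_0_iff)
  moreover have "0 \<le> expectation (\<lambda>\<omega>. (J r \<omega> - J t \<omega>)\<^sup>2)" by simp
  ultimately have "(m t - m r - c t r)\<^sup>2 \<le> 0"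
    using variance_positive[of "D t"] by linarith
  then show ?thesis by simp
qed

end
end

section \<open>Minimality\<close>

text \<open>A Gronwall argument by maxima. The hypothesis is stated with an upper bound
  \<open>b\<close> of \<open>m\<close> in place of an integral, so that it can be applied from a
  maximiser of \<open>m\<close> close to the zero \<open>r\<close>.\<close>

lemma nonpositive_of_increment_bound:
  fixes m :: "real \<Rightarrow> real"
  assumes cont: "continuous_on {0..T} m" and mT: "m T = 0"
    and A: "0 \<le> A"
    and bound: "\<And>t r b. 0 \<le> t \<Longrightarrow> t \<le> r \<Longrightarrow> r \<le> T \<Longrightarrow> (\<And>s. s \<in> {t..<r} \<Longrightarrow> 0 < m s) \<Longrightarrow>
      m r = 0 \<Longrightarrow> (\<And>s. s \<in> {t..r} \<Longrightarrow> m s \<le> b) \<Longrightarrow> m t \<le> A * b * (r - t)"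
    and t: "t \<in> {0..T}"
  shows "m t \<le> 0"
proof (rule ccontr)
  assume "\<not> m t \<le> 0"
  then have mt: "0 < m t" by simp
  define Z where "Z = {s\<in>{t..T}. m s = 0}"
  have ct: "continuous_on {t..T} m" by (rule continuous_on_subset[OF cont]) (use t in auto)
  have Zc: "closed Z" unfolding Z_def
    by (rule continuous_closed_preimage_constant[OF ct]) simp
  have Zn: "Z \<noteq> {}" using mT t by (auto simp: Z_def)
  have Zb: "bdd_below Z" by (auto simp: Z_def intro: bdd_belowI[of _ t])
  define r where "r = Inf Z"
  have rZ: "r \<in> Z" unfolding r_def by (rule closed_contains_Inf[OF Zn Zb Zc])
  then have r: "t \<le> r" "r \<le> T" "m r = 0" by (auto simp: Z_def)
  have pos: "0 < m s" if s: "s \<in> {t..<r}" for s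
  proof (rule ccontr)
    assume "\<not> 0 < m s"
    moreover have "continuous_on {t..s} m" by (rule continuous_on_subset[OF ct]) (use s r in auto)
    ultimately have "\<exists>x\<ge>t. x \<le> s \<and> m x = 0"
      using mt s by (intro IVT2') auto
    then obtain x where x: "t \<le> x" "x \<le> s" "m x = 0" by blast
    then have "x \<in> Z" using s r by (auto simp: Z_def)
    then have "r \<le> x" unfolding r_def by (rule cInf_lower[OF _ Zb])
    then show False using x s by auto
  qed
  have tr: "t < r" using r mt by (cases "t = r") auto
  \<comment> \<open>Close enough to \<open>r\<close> that \<open>A * (r - u) \<le> 1 / 2\<close>;
    the summand 1 covers the case \<open>A = 0\<close>.\<close>
  define u where "u = max t (r - 1 / (2 * (A + 1)))"
  have u: "t \<le> u" "u < r" using A tr by (auto simp: u_def)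
  have "r - u \<le> 1 / (2 * (A + 1))" by (auto simp: u_def)
  then have "A * (r - u) \<le> A * (1 / (2 * (A + 1)))" using A by (rule mult_left_mono)
  also have "\<dots> \<le> 1 / 2" using A by (simp add: field_simps)
  finally have Au: "A * (r - u) \<le> 1 / 2" .
  \<comment> \<open>At a maximiser the bound \<open>b\<close> may be taken to be \<open>m x\<close>
    itself, and the estimate becomes \<open>m x \<le> m x / 2\<close>.\<close>
  obtain x where x: "x \<in> {u..r}" "\<And>s. s \<in> {u..r} \<Longrightarrow> m s \<le> m x"
  proof -
    have "continuous_on {u..r} m" by (rule continuous_on_subset[OF ct]) (use u r in auto)
    then have "\<exists>x\<in>{u..r}. \<forall>s\<in>{u..r}. m s \<le> m x"
      using u by (intro continuous_attains_sup) auto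
    then show thesis using that by blast
  qed
  have mx: "0 < m x" using x(2)[of u] pos[of u] u by auto
  have "m x \<le> A * m x * (r - x)"
    using x u r t pos by (intro bound) auto
  also have "\<dots> \<le> A * m x * (r - u)" using x mx A by (intro mult_left_mono) auto
  also have "\<dots> \<le> 1 / 2 * m x" using mult_right_mono[OF Au, of "m x"] mx by (simp add: mult_ac)
  finally show False using mx by simp
qed

text \<open>A nonnegative function with integral zero vanishes almost everywhere, so the Stieltjes
  measure does not charge the times at which \<open>L\<close> is positive.\<close>

lemma interval_measure_flat:
  fixes K L :: "real \<Rightarrow> real"
  assumes T: "0 < T" and K: "continuous_on {0..T} K" "mono_on {0..T} K"
    and L: "continuous_on {0..T} L" "\<And>t. t \<in> {0..T} \<Longrightarrow> 0 \<le> L t"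
    and flat: "(LINT t:{0..T}|interval_measure (\<lambda>t. K (max 0 (min t T))). L t) = 0"
    and tr: "0 \<le> t" "t \<le> r" "r \<le> T" and pos: "\<And>s. s \<in> {t..<r} \<Longrightarrow> 0 < L s"
  shows "K r = K t"
proof (cases "t = r")
  case False
  define G where "G t = K (max 0 (min t T))" for t
  let ?\<mu> = "interval_measure G"
  have Gm: "G x \<le> G y" if "x \<le> y" for x y
    unfolding G_def using T that by (intro mono_onD[OF K(2)]) auto
  have Gc: "continuous_on UNIV G"
    unfolding G_def by (intro continuous_on_compose2[OF K(1)] continuous_intros) (use T in auto)
  have em: "emeasure ?\<mu> {a..b} = G b - G a" if "a \<le> b" for a b
    by (rule emeasure_interval_measure_Icc[OF that Gm Gc])
  have Lb: "\<exists>b. \<forall>t\<in>{0..T}. norm (L t) \<le> b"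
    using compact_imp_bounded[OF compact_continuous_image[OF L(1)]] by (auto simp: bounded_iff)
  then obtain b where "\<forall>t\<in>{0..T}. norm (L t) \<le> b" ..
  then have b: "\<bar>L t\<bar> \<le> b" if "t \<in> {0..T}" for t using that by auto
  have Lm: "(\<lambda>t. indicat_real {0..T} t *\<^sub>R L t) \<in> borel_measurable ?\<mu>"
    using borel_measurable_continuous_on_indicator[OF _ L(1)] by (simp cong: measurable_cong_sets)
  \<comment> \<open>Essential here: the Bochner integral of a nonintegrable function is zero by
    convention, and flatness would then carry no information.\<close>
  have Li: "integrable ?\<mu> (\<lambda>t. indicat_real {0..T} t *\<^sub>R L t)"
  proof (rule integrableI_bounded_set[where A="{0..T}" and B=b])
    show "emeasure ?\<mu> {0..T} < \<infinity>" using em[of 0 T] T by simp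
    show "AE x in ?\<mu>. x \<in> {0..T} \<longrightarrow> norm (indicat_real {0..T} x *\<^sub>R L x) \<le> b"
      using b order_trans[OF abs_ge_zero b[of 0]] T by (intro AE_I2) (auto split: split_indicator)
  qed (use Lm in auto)
  have "AE t in ?\<mu>. indicat_real {0..T} t *\<^sub>R L t = 0"
    using flat Li L(2) unfolding set_lebesgue_integral_def G_def[symmetric]
    by (subst integral_nonneg_eq_0_iff_AE[symmetric]) (auto split: split_indicator)
  then have null: "AE s in ?\<mu>. s \<notin> {t..<r}"
  proof eventually_elim
    case (elim s)
    show ?case
    proof
      assume s: "s \<in> {t..<r}"
      then have "indicat_real {0..T} s = 1" using tr by simp
      then show False using elim pos[OF s] by simp
    qed
  qed
  \<comment> \<open>Only \<open>s < r\<close> can be treated in this way, since \<open>L\<close> may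
    vanish at \<open>r\<close>; the value at \<open>r\<close> follows from left continuity.\<close>
  have eq: "G s = G t" if s: "s \<in> {t..<r}" for s
  proof -
    have "AE x in ?\<mu>. x \<notin> {t..s}" using null by eventually_elim (use s in auto)
    then have "emeasure ?\<mu> {t..s} = 0"
      by (subst (asm) AE_iff_measurable[of "{t..s}"]) auto
    then show ?thesis using em[of t s] s Gm[of t s] by (simp add: ennreal_eq_0_iff)
  qed
  have "isCont G r" using Gc by (simp add: continuous_on_eq_continuous_at)
  then have left: "(G \<longlongrightarrow> G r) (at_left r)"
    unfolding isCont_def by (rule tendsto_within_subset) simp
  have "t < r" using False tr by simp
  then have "\<forall>\<^sub>F s in at_left r. G s = G t"
    unfolding eventually_at_left_field by (intro exI[of _ t] conjI allI impI eq) simp_all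
  then have "(G \<longlongrightarrow> G t) (at_left r)" by (rule tendsto_eventually)
  then have "G r = G t" by (rule tendsto_unique[OF trivial_limit_at_left_real left])
  moreover have "G s = K s" if "0 \<le> s" "s \<le> T" for s
  proof -
    have "max 0 (min s T) = s" using that by linarith
    then show ?thesis unfolding G_def by (rule arg_cong)
  qed
  ultimately show ?thesis using tr by (metis order_trans)
qed simp

section \<open>Integrability of drivers and losses\<close>

context brownian_motion begin

lemma A2D_D:
  assumes "K \<in> A2D M T F"
  shows "continuous_on {0..T} K" "mono_on {0..T} K"
  using assms by (auto simp: A2D_def A2_def S2_def)

lemma nn_square_finite_imp_set_integrable:
  fixes g :: "real \<Rightarrow> 'b::{real_normed_vector, second_countable_topology}"
  assumes g: "(\<lambda>s. indicat_real {0..T} s *\<^sub>R g s) \<in> borel_measurable lborel"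
    and fin: "(\<integral>\<^sup>+s\<in>{0..T}. ennreal ((norm (g s))\<^sup>2) \<partial>lborel) < \<infinity>"
  shows "set_integrable lborel {0..T} (\<lambda>s. norm (g s))"
proof -
  have m: "(\<lambda>s. indicat_real {0..T} s * norm (g s)) \<in> borel_measurable lborel"
    using measurable_compose[OF g borel_measurable_norm] by (simp add: abs_mult)
  have "(\<integral>\<^sup>+s. ennreal (indicat_real {0..T} s * norm (g s)) \<partial>lborel) \<le>
    (\<integral>\<^sup>+s. indicator {0..T} s + ennreal ((norm (indicat_real {0..T} s *\<^sub>R g s))\<^sup>2) \<partial>lborel)"
  proof (rule nn_integral_mono)
    fix s
    have "x \<le> 1 + x\<^sup>2" for x :: real using sum_squares_bound[of x 1] zero_le_power2[of x] by (simp, smt (verit))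
    from ennreal_leI[OF this] show "ennreal (indicat_real {0..T} s * norm (g s)) \<le> indicator {0..T} s + ennreal ((norm (indicat_real {0..T} s *\<^sub>R g s))\<^sup>2)"
      by (auto split: split_indicator simp: ennreal_plus)
  qed
  also have "\<dots> = emeasure lborel {0..T} + (\<integral>\<^sup>+s. ennreal ((norm (indicat_real {0..T} s *\<^sub>R g s))\<^sup>2) \<partial>lborel)"
    using measurable_compose[OF measurable_compose[OF g borel_measurable_norm], of "\<lambda>x. ennreal (x\<^sup>2)" borel]
    by (subst nn_integral_add) auto
  also have "(\<integral>\<^sup>+s. ennreal ((norm (indicat_real {0..T} s *\<^sub>R g s))\<^sup>2) \<partial>lborel) = (\<integral>\<^sup>+s\<in>{0..T}. ennreal ((norm (g s))\<^sup>2) \<partial>lborel)"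
    by (intro nn_integral_cong) (auto split: split_indicator)
  also have "emeasure lborel {0..T} + (\<integral>\<^sup>+s\<in>{0..T}. ennreal ((norm (g s))\<^sup>2) \<partial>lborel) < \<infinity>"
    using fin T_pos by (simp add: less_top)
  finally show ?thesis
    unfolding set_integrable_def using m by (intro integrableI_nonneg) auto
qed

lemma AE_energy_finite:
  assumes g: "jointly_measurable M {0..T} g" and fin: "energy M {0..T} g < \<infinity>"
  shows "AE \<omega> in M. set_integrable lborel {0..T} (\<lambda>s. norm (g s \<omega>))"
proof -
  have "AE \<omega> in M. (\<integral>\<^sup>+s\<in>{0..T}. ennreal ((norm (g s \<omega>))\<^sup>2) \<partial>lborel) \<noteq> \<infinity>"
    using fin lborel.borel_measurable_nn_integral_fst[OF jointly_measurable_nn_integrand[OF g]]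
    by (intro nn_integral_PInf_AE) auto
  then show ?thesis
    using AE_space
  proof eventually_elim
    case (elim \<omega>)
    have "(\<lambda>s. indicat_real {0..T} s *\<^sub>R g s \<omega>) \<in> borel_measurable lborel"
      using measurable_compose[OF measurable_Pair1'[OF elim(2)] g[unfolded jointly_measurable_def]] by simp
    then show ?case
      using elim(1) by (intro nn_square_finite_imp_set_integrable) (auto simp: less_top)
  qed
qed

text \<open>Needed to split the time integral of the equation at an intermediate time. The Lipschitz
  condition dominates the driver by its value at zero, \<open>Y\<close> and \<open>Z\<close>: the
  first and the last are square integrable in time for almost every outcome, and \<open>Y\<close>
  has continuous paths.\<close>

lemma AE_driver_integrable:
  fixes f :: "'w \<Rightarrow> real \<Rightarrow> real \<Rightarrow> real ^ 'd \<Rightarrow> real"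
  assumes f: "H_f M T F f" and Y: "regular Y" and Z: "Z \<in> H2 M T F"
  shows "AE \<omega> in M. set_integrable lborel {0..T} (\<lambda>s. f \<omega> s (Y s \<omega>) (Z s \<omega>))"
proof -
  have fm: "(\<lambda>((\<omega>, t), y, z). f \<omega> t y z) \<in> borel_measurable (progressive_algebra (space M) T F \<Otimes>\<^sub>M (borel \<Otimes>\<^sub>M borel))"
    and f0: "energy M {0..T} (\<lambda>t \<omega>. f \<omega> t 0 0) < \<infinity>"
    using f by (auto simp: H_f_def)
  obtain \<Lambda> where \<Lambda>: "0 \<le> \<Lambda>" "AE \<omega> in M. \<forall>t\<in>{0..T}. \<forall>y p z q. \<bar>f \<omega> t y z - f \<omega> t p q\<bar> \<le> \<Lambda> * (\<bar>y - p\<bar> + norm (z - q))"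
    using f by (auto simp: H_f_def)
  have Zj: "jointly_measurable M {0..T} Z" and Zf: "energy M {0..T} Z < \<infinity>"
    using Z jointly_measurable_predictable by (auto simp: H2_def)
  obtain Y' where Y': "jointly_measurable M {0..T} Y'" "AE \<omega> in M. \<forall>t\<in>{0..T}. Y' t \<omega> = Y t \<omega>"
    using regular_modification[OF Y] .
  have f0j: "jointly_measurable M {0..T} (\<lambda>t \<omega>. f \<omega> t 0 0)"
    by (rule jointly_measurable_driver[OF fm]) (auto simp: jointly_measurable_def)
  note fj = jointly_measurable_driver[OF fm Y'(1) Zj]
  have cont: "AE \<omega> in M. continuous_on {0..T} (\<lambda>t. Y t \<omega>)" using Y by (simp add: regular_def)
  show ?thesis
    using AE_space AE_energy_finite[OF f0j f0] AE_energy_finite[OF Zj Zf] \<Lambda>(2) Y'(2) cont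
  proof eventually_elim
    case (elim \<omega>)
    have m: "(\<lambda>s. indicat_real {0..T} s *\<^sub>R f \<omega> s (Y s \<omega>) (Z s \<omega>)) \<in> borel_measurable lborel"
    proof -
      have "(\<lambda>s. indicat_real {0..T} s *\<^sub>R f \<omega> s (Y' s \<omega>) (Z s \<omega>)) \<in> borel_measurable lborel"
        using measurable_compose[OF measurable_Pair1'[OF elim(1)] fj[unfolded jointly_measurable_def]] by simp
      also have "(\<lambda>s. indicat_real {0..T} s *\<^sub>R f \<omega> s (Y' s \<omega>) (Z s \<omega>)) = (\<lambda>s. indicat_real {0..T} s *\<^sub>R f \<omega> s (Y s \<omega>) (Z s \<omega>))"
        using elim(5) by (auto simp: fun_eq_iff split: split_indicator)
      finally show ?thesis .
    qed
    have Yi: "set_integrable lborel {0..T} (\<lambda>s. norm (Y s \<omega>))"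
      by (intro borel_integrable_atLeastAtMost' continuous_intros elim)
    have "set_integrable lborel {0..T} (\<lambda>s. norm (f \<omega> s 0 0) + \<Lambda> * (norm (Y s \<omega>) + norm (Z s \<omega>)))"
      using elim(2,3) Yi by (intro set_integral_add set_integrable_mult_right)
    then show ?case
      unfolding set_integrable_def
    proof (rule Bochner_Integration.integrable_bound[OF _ m])
      have "norm (f \<omega> s (Y s \<omega>) (Z s \<omega>)) \<le> norm (f \<omega> s 0 0) + \<Lambda> * (norm (Y s \<omega>) + norm (Z s \<omega>))" if "s \<in> {0..T}" for s
      proof -
        have "\<bar>f \<omega> s (Y s \<omega>) (Z s \<omega>) - f \<omega> s 0 0\<bar> \<le> \<Lambda> * (\<bar>Y s \<omega> - 0\<bar> + norm (Z s \<omega> - 0))"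
          using elim(4) that by blast
        then show ?thesis by simp
      qed
      moreover have "0 \<le> norm (f \<omega> s 0 0) + \<Lambda> * (norm (Y s \<omega>) + norm (Z s \<omega>))" for s
        using \<Lambda>(1) by auto
      ultimately show "AE s in lborel. norm (indicat_real {0..T} s *\<^sub>R f \<omega> s (Y s \<omega>) (Z s \<omega>)) \<le>
        norm (indicat_real {0..T} s *\<^sub>R (norm (f \<omega> s 0 0) + \<Lambda> * (norm (Y s \<omega>) + norm (Z s \<omega>))))"
        by (intro AE_I2) (auto split: split_indicator)
    qed
  qed
qed

text \<open>Linear growth carries the domination of \<open>Y\<close> over to the loss, and dominated
  convergence gives continuity in time. The strict comparison of losses and the flatness argument
  rely on these two facts.\<close>

lemma loss_expectation:
  assumes l: "H_l M T F l" and Y: "regular Y"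
  shows "\<And>t. t \<in> {0..T} \<Longrightarrow> integrable M (\<lambda>\<omega>. l \<omega> t (Y t \<omega>))"
    and "continuous_on {0..T} (\<lambda>t. expectation (\<lambda>\<omega>. l \<omega> t (Y t \<omega>)))"
proof -
  have lm: "(\<lambda>(\<omega>, t, y). l \<omega> t y) \<in> borel_measurable (F T \<Otimes>\<^sub>M (restrict_space borel {0..T} \<Otimes>\<^sub>M borel))"
    and lc: "AE \<omega> in M. continuous_on ({0..T} \<times> UNIV) (\<lambda>(t, y). l \<omega> t y)"
    using l by (auto simp: H_l_def)
  obtain C where C: "0 \<le> C" "AE \<omega> in M. \<forall>t\<in>{0..T}. \<forall>y. \<bar>l \<omega> t y\<bar> \<le> C * (1 + \<bar>y\<bar>)"
    using l by (auto simp: H_l_def)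
  obtain W where W: "square_integrable M W" "AE \<omega> in M. \<forall>t\<in>{0..T}. \<bar>Y t \<omega>\<bar> \<le> W \<omega>"
    using regular_dominated[OF Y] .
  have m: "(\<lambda>\<omega>. l \<omega> t (Y t \<omega>)) \<in> borel_measurable M" if t: "t \<in> {0..T}" for t
  proof -
    have id: "(\<lambda>\<omega>. \<omega>) \<in> measurable M (F T)" by (rule measurable_F_M[of _ T]) simp
    have "(\<lambda>\<omega>. (\<omega>, t, Y t \<omega>)) \<in> measurable M (F T \<Otimes>\<^sub>M (restrict_space borel {0..T} \<Otimes>\<^sub>M borel))"
      using t regular_measurable[OF Y t] by (intro measurable_Pair id) (auto simp: space_restrict_space)
    from measurable_compose[OF this lm] show ?thesis by simp
  qed
  have dom: "AE \<omega> in M. \<forall>t\<in>{0..T}. \<bar>l \<omega> t (Y t \<omega>)\<bar> \<le> C * (1 + W \<omega>)"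
    using C(2) W(2)
  proof eventually_elim
    case (elim \<omega>)
    show ?case
    proof
      fix t assume t: "t \<in> {0..T}"
      have "\<bar>l \<omega> t (Y t \<omega>)\<bar> \<le> C * (1 + \<bar>Y t \<omega>\<bar>)" using elim(1) t by blast
      also have "\<dots> \<le> C * (1 + W \<omega>)" using elim(2) t C(1) by (intro mult_left_mono) auto
      finally show "\<bar>l \<omega> t (Y t \<omega>)\<bar> \<le> C * (1 + W \<omega>)" .
    qed
  qed
  have Wi: "integrable M (\<lambda>\<omega>. C * (1 + W \<omega>))"
    using square_integrable_integrable[OF W(1)] by auto
  show "integrable M (\<lambda>\<omega>. l \<omega> t (Y t \<omega>))" if t: "t \<in> {0..T}" for t
  proof (rule Bochner_Integration.integrable_bound[OF Wi m[OF t]])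
    show "AE \<omega> in M. norm (l \<omega> t (Y t \<omega>)) \<le> norm (C * (1 + W \<omega>))"
      using dom by eventually_elim (use t in fastforce)
  qed
  have cont: "AE \<omega> in M. continuous_on {0..T} (\<lambda>t. Y t \<omega>)" using Y by (simp add: regular_def)
  show "continuous_on {0..T} (\<lambda>t. expectation (\<lambda>\<omega>. l \<omega> t (Y t \<omega>)))"
  proof (rule continuous_on_expectation[OF m Wi _ dom])
    show "AE \<omega> in M. continuous_on {0..T} (\<lambda>t. l \<omega> t (Y t \<omega>))"
      using lc cont
    proof eventually_elim
      case (elim \<omega>)
      have "continuous_on {0..T} (\<lambda>t. (\<lambda>(t, y). l \<omega> t y) (t, Y t \<omega>))"
        by (rule continuous_on_compose2[OF elim(1)]) (auto intro!: continuous_intros elim(2))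
      then show ?case by simp
    qed
  qed
qed

end

text \<open>Cauchy-Schwarz in time against the constant 1 produces the factor \<open>r - t\<close>,
  on which the absorption rests; the constants come from
  \<open>(p + q)\<^sup>2 \<le> 2 * p\<^sup>2 + 2 * q\<^sup>2\<close>.\<close>

lemma square_set_integral_bound:
  fixes \<psi> y w :: "real \<Rightarrow> real"
  assumes tr: "t \<le> r" and \<psi>: "set_integrable lborel {t..r} \<psi>"
    and y: "(\<lambda>s. indicat_real {t<..r} s *\<^sub>R y s) \<in> borel_measurable lborel"
    and w: "(\<lambda>s. indicat_real {t<..r} s *\<^sub>R w s) \<in> borel_measurable lborel"
    and bound: "\<And>s. s \<in> {t<..r} \<Longrightarrow> \<bar>\<psi> s\<bar> \<le> A * \<bar>y s\<bar> + \<Lambda> * \<bar>w s\<bar>"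
  shows "ennreal ((LINT s:{t..r}|lborel. \<psi> s)\<^sup>2) \<le> ennreal ((2 * A\<^sup>2 + 2 * \<Lambda>\<^sup>2) * (r - t)) *
    (\<integral>\<^sup>+s\<in>{t<..r}. (ennreal ((y s)\<^sup>2) + ennreal ((w s)\<^sup>2)) \<partial>lborel)"
proof -
  let ?i = "indicat_real {t<..r}"
  define C where "C = 2 * A\<^sup>2 + 2 * \<Lambda>\<^sup>2"
  have C: "0 \<le> C" by (simp add: C_def)
  define y' where "y' s = ?i s *\<^sub>R y s" for s
  define w' where "w' s = ?i s *\<^sub>R w s" for s
  have [measurable]: "y' \<in> borel_measurable lborel" "w' \<in> borel_measurable lborel"
    using y w by (auto simp: y'_def[abs_def] w'_def[abs_def])
  define u where "u s = \<bar>A * \<bar>y' s\<bar> + \<Lambda> * \<bar>w' s\<bar>\<bar>" for s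
  have [measurable]: "u \<in> borel_measurable lborel" unfolding u_def[abs_def] by measurable
  have u2: "(u s)\<^sup>2 \<le> C * ((y' s)\<^sup>2 + (w' s)\<^sup>2)" for s
  proof -
    have "(u s)\<^sup>2 \<le> 2 * (A * \<bar>y' s\<bar>)\<^sup>2 + 2 * (\<Lambda> * \<bar>w' s\<bar>)\<^sup>2"
      using norm_add_square_le[of "A * \<bar>y' s\<bar>" "\<Lambda> * \<bar>w' s\<bar>"] by (simp add: u_def)
    also have "\<dots> = 2 * A\<^sup>2 * (y' s)\<^sup>2 + 2 * \<Lambda>\<^sup>2 * (w' s)\<^sup>2" by (simp add: power_mult_distrib)
    also have "\<dots> \<le> C * (y' s)\<^sup>2 + C * (w' s)\<^sup>2"
      unfolding C_def by (intro add_mono mult_right_mono) auto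
    finally show ?thesis by (simp add: algebra_simps)
  qed
  have "ennreal \<bar>LINT s:{t..r}|lborel. \<psi> s\<bar> \<le> (\<integral>\<^sup>+s. ennreal (norm (indicat_real {t..r} s *\<^sub>R \<psi> s)) \<partial>lborel)"
    using integral_norm_bound_ennreal[OF \<psi>[unfolded set_integrable_def]] unfolding set_lebesgue_integral_def by simp
  also have "\<dots> \<le> (\<integral>\<^sup>+s. ennreal (u s) * indicator {t<..r} s \<partial>lborel)"
  proof (rule nn_integral_mono_AE)
    show "AE s in lborel. ennreal (norm (indicat_real {t..r} s *\<^sub>R \<psi> s)) \<le> ennreal (u s) * indicator {t<..r} s"
      using AE_lborel_singleton[of t]
    proof eventually_elim
      case (elim s)
      show ?case
      proof (cases "s \<in> {t<..r}")
        case True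
        then have "\<bar>\<psi> s\<bar> \<le> u s" using bound[OF True] by (simp add: u_def y'_def w'_def)
        then show ?thesis using True by (simp add: ennreal_leI)
      next
        case False
        then have "s \<notin> {t..r}" using elim by auto
        then show ?thesis by simp
      qed
    qed
  qed
  finally have "(ennreal \<bar>LINT s:{t..r}|lborel. \<psi> s\<bar>)\<^sup>2 \<le> (\<integral>\<^sup>+s. ennreal (u s) * indicator {t<..r} s \<partial>lborel)\<^sup>2"
    by (rule power_mono) simp
  also have "\<dots> \<le> (\<integral>\<^sup>+s. (ennreal (u s))\<^sup>2 \<partial>lborel) * (\<integral>\<^sup>+s. (indicator {t<..r} s)\<^sup>2 \<partial>lborel)"
    by (rule Cauchy_Schwarz_nn_integral) auto
  also have "(\<integral>\<^sup>+s. (indicator {t<..r} s)\<^sup>2 \<partial>lborel) = (\<integral>\<^sup>+s. indicator {t<..r} s \<partial>lborel)"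
    by (intro nn_integral_cong) (auto split: split_indicator)
  also have "\<dots> = ennreal (r - t)" using tr by simp
  also have "(\<integral>\<^sup>+s. (ennreal (u s))\<^sup>2 \<partial>lborel) \<le> (\<integral>\<^sup>+s. ennreal C * ennreal ((y' s)\<^sup>2 + (w' s)\<^sup>2) \<partial>lborel)"
  proof (rule nn_integral_mono)
    fix s
    have "(ennreal (u s))\<^sup>2 = ennreal ((u s)\<^sup>2)" by (simp add: ennreal_power u_def)
    also have "\<dots> \<le> ennreal (C * ((y' s)\<^sup>2 + (w' s)\<^sup>2))" by (rule ennreal_leI[OF u2])
    finally show "(ennreal (u s))\<^sup>2 \<le> ennreal C * ennreal ((y' s)\<^sup>2 + (w' s)\<^sup>2)"
      using C by (simp add: ennreal_mult)
  qed
  also have "\<dots> = ennreal C * (\<integral>\<^sup>+s. ennreal ((y' s)\<^sup>2 + (w' s)\<^sup>2) \<partial>lborel)"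
    by (rule nn_integral_cmult) measurable
  also have "(\<integral>\<^sup>+s. ennreal ((y' s)\<^sup>2 + (w' s)\<^sup>2) \<partial>lborel) = (\<integral>\<^sup>+s\<in>{t<..r}. (ennreal ((y s)\<^sup>2) + ennreal ((w s)\<^sup>2)) \<partial>lborel)"
    by (intro nn_integral_cong) (auto simp: y'_def w'_def ennreal_plus split: split_indicator)
  finally have "(ennreal \<bar>LINT s:{t..r}|lborel. \<psi> s\<bar>)\<^sup>2 \<le>
     ennreal C * (\<integral>\<^sup>+s\<in>{t<..r}. (ennreal ((y s)\<^sup>2) + ennreal ((w s)\<^sup>2)) \<partial>lborel) * ennreal (r - t)"
    by (simp add: mult_right_mono)
  moreover have "(ennreal \<bar>LINT s:{t..r}|lborel. \<psi> s\<bar>)\<^sup>2 = ennreal ((LINT s:{t..r}|lborel. \<psi> s)\<^sup>2)"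
    by (simp add: ennreal_power)
  ultimately show ?thesis
    using C tr unfolding C_def[symmetric] by (simp add: ennreal_mult mult_ac)
qed

lemma set_integral_split:
  fixes g :: "real \<Rightarrow> real"
  assumes "set_integrable lborel {a..b} g" "a \<le> t" "t \<le> r" "r \<le> b"
  shows "(LINT s:{t..b}|lborel. g s) = (LINT s:{t..r}|lborel. g s) + (LINT s:{r..b}|lborel. g s)"
proof -
  have U: "{t..b} = {t..r} \<union> {r..b}" using assms by auto
  show ?thesis
    unfolding U
  proof (rule set_integral_Un_AE)
    show "AE s in lborel. \<not> (s \<in> {t..r} \<and> s \<in> {r..b})"
      using AE_lborel_singleton[of r] by eventually_elim auto
  qed (use assms in \<open>auto intro: set_integrable_subset\<close>)
qed

section \<open>Comparison of the two solutions\<close>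

context brownian_motion begin

text \<open>The exceptional null set in the hypothesis depends on \<open>t\<close>. The countably
  many grid times share one null set, and path continuity extends the inequality to all
  times.\<close>

lemma AE_regular_nonpositive:
  assumes D: "regular D" and le: "\<And>t. t \<in> {0..T} \<Longrightarrow> AE \<omega> in M. D t \<omega> \<le> 0"
  shows "AE \<omega> in M. \<forall>t\<in>{0..T}. D t \<omega> \<le> 0"
proof -
  have gm: "grid T n i \<in> {0..T}" for n i using T_pos by (intro grid_mem) simp
  have "AE \<omega> in M. \<forall>n i. D (grid T n i) \<omega> \<le> 0"
    unfolding AE_all_countable using le[OF gm] by blast
  moreover have "AE \<omega> in M. continuous_on {0..T} (\<lambda>t. D t \<omega>)" using D by (simp add: regular_def)
  ultimately show ?thesis
  proof eventually_elim
    case (elim \<omega>)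
    show ?case
    proof
      fix t assume t: "t \<in> {0..T}"
      have "(\<lambda>n. D (grid T n \<lfloor>(real n + 1) * t\<rfloor>) \<omega>) \<longlonglongrightarrow> D t \<omega>"
        using gm by (intro continuous_on_tendsto_compose[OF elim(2) grid_tendsto[OF t] t]) auto
      then show "D t \<omega> \<le> 0" using elim(1) by (intro LIMSEQ_le_const2) auto
    qed
  qed
qed

lemma deterministic_flat_solution_minimal:
  fixes f :: "'w \<Rightarrow> real \<Rightarrow> real \<Rightarrow> real ^ 'd \<Rightarrow> real"
  assumes f: "H_f M T F f" and l: "H_l M T F l"
    and a: "a \<in> borel_measurable (restrict_space borel {0..T})" "bounded (a ` {0..T})"
    and fa: "\<forall>\<omega>\<in>space M. \<forall>t\<in>{0..T}. \<forall>y z. f \<omega> t y z = a t * y + h \<omega> t z"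
    and sol: "deterministic_solution M T F B \<xi> f l Y Z K" and flat: "flat M T l Y K"
    and sol': "deterministic_solution M T F B \<xi> f l Y' Z' K'"
  shows "AE \<omega> in M. \<forall>t\<in>{0..T}. Y t \<omega> \<le> Y' t \<omega>"
proof -
  obtain I where I: "has_ito_integral M T F B Z I" and eq: "AE \<omega> in M. \<forall>t\<in>{0..T}.
    Y t \<omega> = \<xi> \<omega> + (LINT s:{t..T}|lborel. f \<omega> s (Y s \<omega>) (Z s \<omega>)) - (I T \<omega> - I t \<omega>) + K T - K t"
    using sol unfolding deterministic_solution_def by blast
  obtain I' where I': "has_ito_integral M T F B Z' I'" and eq': "AE \<omega> in M. \<forall>t\<in>{0..T}.
    Y' t \<omega> = \<xi> \<omega> + (LINT s:{t..T}|lborel. f \<omega> s (Y' s \<omega>) (Z' s \<omega>)) - (I' T \<omega> - I' t \<omega>) + K' T - K' t"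
    using sol' unfolding deterministic_solution_def by blast
  have Y: "regular Y" and Y': "regular Y'" and Z: "Z \<in> H2 M T F" and Z': "Z' \<in> H2 M T F"
    using sol sol' regular_S2 by (auto simp: deterministic_solution_def)
  have K: "continuous_on {0..T} K" "mono_on {0..T} K" and K': "mono_on {0..T} K'"
    using sol sol' A2D_D by (auto simp: deterministic_solution_def)
  have Lpos: "0 \<le> expectation (\<lambda>\<omega>. l \<omega> t (Y t \<omega>))" "0 \<le> expectation (\<lambda>\<omega>. l \<omega> t (Y' t \<omega>))" if "t \<in> {0..T}" for t
    using sol sol' that by (auto simp: deterministic_solution_def)
  have Zj: "jointly_measurable M {0..T} Z" "jointly_measurable M {0..T} Z'"
    using Z Z' jointly_measurable_predictable by (auto simp: H2_def)
  define D where "D t \<omega> = Y t \<omega> - Y' t \<omega>" for t \<omega>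
  define J where "J t \<omega> = I t \<omega> - I' t \<omega>" for t \<omega>
  define z where "z s \<omega> = Z s \<omega> - Z' s \<omega>" for s \<omega>
  define m where "m t = expectation (D t)" for t
  have D: "regular D" unfolding D_def[abs_def] by (rule regular_diff[OF Y Y'])
  have J: "has_ito_integral M T F B z J"
    unfolding J_def[abs_def] z_def[abs_def] by (rule has_ito_integral_diff[OF I I' Zj])
  have z: "jointly_measurable M {0..T} z"
    unfolding z_def[abs_def] by (rule jointly_measurable_diff[OF Zj])
  have mc: "continuous_on {0..T} m"
    unfolding m_def[abs_def] by (rule regular_continuous_expectation[OF D])
  obtain \<Lambda> where \<Lambda>: "0 \<le> \<Lambda>" "AE \<omega> in M. \<forall>t\<in>{0..T}. \<forall>y p z q. \<bar>f \<omega> t y z - f \<omega> t p q\<bar> \<le> \<Lambda> * (\<bar>y - p\<bar> + norm (z - q))"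
    using f by (auto simp: H_f_def)
  obtain A where "\<forall>x\<in>a ` {0..T}. norm x \<le> A"
    using a(2) unfolding bounded_iff by blast
  then have A: "\<bar>a t\<bar> \<le> A" if "t \<in> {0..T}" for t using that by auto
  have A0: "0 \<le> A" using A[of 0] T_pos by auto
  have am: "set_integrable lborel {0..T} (\<lambda>s. a s * m s)"
    unfolding set_integrable_def
  proof (rule Bochner_Integration.integrable_bound)
    have "set_integrable lborel {0..T} (\<lambda>s. A * m s)"
      by (intro borel_integrable_atLeastAtMost' continuous_intros mc)
    then show "integrable lborel (\<lambda>s. indicat_real {0..T} s *\<^sub>R (A * m s))" by (simp add: set_integrable_def)
    have "(\<lambda>s. indicat_real {0..T} s *\<^sub>R a s) \<in> borel_measurable borel"
      using a(1) by (subst (asm) borel_measurable_restrict_space_iff) auto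
    moreover have "(\<lambda>s. indicat_real {0..T} s *\<^sub>R m s) \<in> borel_measurable borel"
      by (rule borel_measurable_continuous_on_indicator[OF _ mc]) simp
    ultimately have "(\<lambda>s. (indicat_real {0..T} s *\<^sub>R a s) * (indicat_real {0..T} s *\<^sub>R m s)) \<in> borel_measurable borel"
      by (rule borel_measurable_times)
    also have "(\<lambda>s. (indicat_real {0..T} s *\<^sub>R a s) * (indicat_real {0..T} s *\<^sub>R m s)) = (\<lambda>s. indicat_real {0..T} s *\<^sub>R (a s * m s))"
      by (auto simp: fun_eq_iff split: split_indicator)
    finally show "(\<lambda>s. indicat_real {0..T} s *\<^sub>R (a s * m s)) \<in> borel_measurable lborel" by simp
    show "AE s in lborel. norm (indicat_real {0..T} s *\<^sub>R (a s * m s)) \<le> norm (indicat_real {0..T} s *\<^sub>R (A * m s))"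
      using A A0 by (intro AE_I2) (auto simp: abs_mult intro!: mult_right_mono split: split_indicator)
  qed
  \<comment> \<open>The deterministic contributions to the increment: the mean of the linear drift
    and the two reflections.\<close>
  define c where "c t r = (LINT s:{t..r}|lborel. a s * m s) + ((K r - K t) - (K' r - K' t))" for t r
  have increment: "AE \<omega> in M. ennreal ((D t \<omega> - D r \<omega> + (J r \<omega> - J t \<omega>) - c t r)\<^sup>2) \<le> ennreal ((2 * A\<^sup>2 + 2 * \<Lambda>\<^sup>2) * (r - t)) *
        (\<integral>\<^sup>+s\<in>{t<..r}. (ennreal ((D s \<omega> - m s)\<^sup>2) + ennreal ((norm (z s \<omega>))\<^sup>2)) \<partial>lborel)"
    if t: "0 \<le> t" "t \<le> r" "r \<le> T" for t r
  proof -
    obtain D' where D': "jointly_measurable M {0..T} D'" "AE \<omega> in M. \<forall>t\<in>{0..T}. D' t \<omega> = D t \<omega>"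
      using regular_modification[OF D] .
    have y: "jointly_measurable M {t<..r} (\<lambda>s \<omega>. D' s \<omega> - m s)"
      using t by (intro jointly_measurable_subset[OF jointly_measurable_diff[OF D'(1) jointly_measurable_deterministic[OF mc]]]) auto
    have zj: "jointly_measurable M {t<..r} z"
      using t by (intro jointly_measurable_subset[OF z]) auto
    show ?thesis
      using AE_space D'(2) \<Lambda>(2) eq eq' AE_driver_integrable[OF f Y Z] AE_driver_integrable[OF f Y' Z']
    proof eventually_elim
      case (elim \<omega>)
      let ?f = "\<lambda>s. f \<omega> s (Y s \<omega>) (Z s \<omega>)" and ?f' = "\<lambda>s. f \<omega> s (Y' s \<omega>) (Z' s \<omega>)"
      have tT: "t \<in> {0..T}" "r \<in> {0..T}" and sub: "{t..r} \<subseteq> {0..T}" using t by auto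
      \<comment> \<open>With \<open>a m\<close> moved into \<open>c\<close>, what remains of the
        drift is \<open>a (D - m)\<close> plus a term bounded by a multiple of the norm of
        \<open>z\<close>.\<close>
      define \<psi> where "\<psi> s = ?f s - ?f' s - a s * m s" for s
      have i: "set_integrable lborel {t..r} ?f" "set_integrable lborel {t..r} ?f'" "set_integrable lborel {t..r} (\<lambda>s. a s * m s)"
        using elim(6,7) am sub by (auto intro: set_integrable_subset)
      have \<psi>i: "set_integrable lborel {t..r} \<psi>"
        unfolding \<psi>_def[abs_def] by (intro set_integral_diff i)
      have "(LINT s:{t..r}|lborel. \<psi> s) = (LINT s:{t..r}|lborel. ?f s) - (LINT s:{t..r}|lborel. ?f' s) - (LINT s:{t..r}|lborel. a s * m s)"
        unfolding \<psi>_def using i by (simp add: set_integral_diff)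
      moreover have "D t \<omega> - D r \<omega> + (J r \<omega> - J t \<omega>) =
        (LINT s:{t..r}|lborel. ?f s) - (LINT s:{t..r}|lborel. ?f' s) + ((K r - K t) - (K' r - K' t))"
        using bspec[OF elim(4) tT(1)] bspec[OF elim(4) tT(2)] bspec[OF elim(5) tT(1)] bspec[OF elim(5) tT(2)]
          set_integral_split[OF elim(6) t] set_integral_split[OF elim(7) t]
        unfolding D_def J_def by linarith
      ultimately have inc: "D t \<omega> - D r \<omega> + (J r \<omega> - J t \<omega>) - c t r = (LINT s:{t..r}|lborel. \<psi> s)"
        by (simp add: c_def)
      have "ennreal ((LINT s:{t..r}|lborel. \<psi> s)\<^sup>2) \<le> ennreal ((2 * A\<^sup>2 + 2 * \<Lambda>\<^sup>2) * (r - t)) *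
        (\<integral>\<^sup>+s\<in>{t<..r}. (ennreal ((D' s \<omega> - m s)\<^sup>2) + ennreal ((norm (z s \<omega>))\<^sup>2)) \<partial>lborel)"
      proof (rule square_set_integral_bound[OF t(2) \<psi>i])
        show "(\<lambda>s. indicat_real {t<..r} s *\<^sub>R (D' s \<omega> - m s)) \<in> borel_measurable lborel"
          using measurable_compose[OF measurable_Pair1'[OF elim(1)] y[unfolded jointly_measurable_def]] by simp
        have "(\<lambda>s. norm (indicat_real {t<..r} s *\<^sub>R z s \<omega>)) \<in> borel_measurable lborel"
          using measurable_compose[OF measurable_compose[OF measurable_Pair1'[OF elim(1)] zj[unfolded jointly_measurable_def]] borel_measurable_norm]
          by simp
        then show "(\<lambda>s. indicat_real {t<..r} s *\<^sub>R norm (z s \<omega>)) \<in> borel_measurable lborel" by simp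
        fix s assume "s \<in> {t<..r}"
        then have s: "s \<in> {0..T}" using t by auto
        \<comment> \<open>At equal \<open>z\<close> the random part \<open>h\<close>
          cancels.\<close>
        have "?f s - f \<omega> s (Y' s \<omega>) (Z s \<omega>) = a s * D s \<omega>"
          using fa elim(1) s by (simp add: D_def right_diff_distrib)
        then have "\<psi> s = a s * (D s \<omega> - m s) + (f \<omega> s (Y' s \<omega>) (Z s \<omega>) - ?f' s)"
          by (simp add: \<psi>_def right_diff_distrib)
        also have "\<bar>\<dots>\<bar> \<le> \<bar>a s * (D s \<omega> - m s)\<bar> + \<bar>f \<omega> s (Y' s \<omega>) (Z s \<omega>) - ?f' s\<bar>" by (rule abs_triangle_ineq)
        also have "\<bar>a s * (D s \<omega> - m s)\<bar> \<le> A * \<bar>D s \<omega> - m s\<bar>"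
          unfolding abs_mult using A[OF s] by (intro mult_right_mono) auto
        also have "\<bar>f \<omega> s (Y' s \<omega>) (Z s \<omega>) - ?f' s\<bar> \<le> \<Lambda> * norm (z s \<omega>)"
        proof -
          \<comment> \<open>The Lipschitz condition is used at equal \<open>y\<close>, so that the
            difference of the integrands alone appears.\<close>
          have "\<bar>f \<omega> s (Y' s \<omega>) (Z s \<omega>) - ?f' s\<bar> \<le> \<Lambda> * (\<bar>Y' s \<omega> - Y' s \<omega>\<bar> + norm (Z s \<omega> - Z' s \<omega>))"
            using elim(3) s by blast
          then show ?thesis by (simp add: z_def)
        qed
        finally show "\<bar>\<psi> s\<bar> \<le> A * \<bar>D' s \<omega> - m s\<bar> + \<Lambda> * \<bar>norm (z s \<omega>)\<bar>"
          using elim(2) s by simp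
      qed
      also have "(\<integral>\<^sup>+s\<in>{t<..r}. (ennreal ((D' s \<omega> - m s)\<^sup>2) + ennreal ((norm (z s \<omega>))\<^sup>2)) \<partial>lborel) =
        (\<integral>\<^sup>+s\<in>{t<..r}. (ennreal ((D s \<omega> - m s)\<^sup>2) + ennreal ((norm (z s \<omega>))\<^sup>2)) \<partial>lborel)"
        using elim(2) t by (intro nn_integral_cong) (auto split: split_indicator)
      finally show ?case unfolding inc .
    qed
  qed
  \<comment> \<open>At the final time the drift integral runs over a single point, so both solutions
    end in \<open>\<xi>\<close>.\<close>
  have sing: "(LINT s:{T..T}|lborel. g s) = 0" for g :: "real \<Rightarrow> real"
    unfolding set_lebesgue_integral_def
    by (rule integral_eq_zero_AE) (use AE_lborel_singleton[of T] in eventually_elim, auto)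
  have DT0: "AE \<omega> in M. D T \<omega> = 0"
    using eq eq'
  proof eventually_elim
    case (elim \<omega>)
    then show ?case using bspec[OF elim(1), of T] bspec[OF elim(2), of T] T_pos unfolding sing by (simp add: D_def)
  qed
  have mT: "m T = 0"
  proof -
    have "expectation (D T) = expectation (\<lambda>\<omega>. 0)"
      using DT0 regular_measurable[OF D, of T] T_pos by (intro integral_cong_AE) auto
    then show ?thesis by (simp add: m_def)
  qed
  have C0: "0 \<le> 2 * A\<^sup>2 + 2 * \<Lambda>\<^sup>2" by simp
  have DT: "AE \<omega> in M. D T \<omega> = expectation (D T)" using DT0 mT by (simp add: m_def)
  note increment = increment[unfolded m_def]
  have Dm: "AE \<omega> in M. D t \<omega> = m t" if "t \<in> {0..T}" for t
    using zero_variance(1)[OF D J z C0 increment DT that] by (simp add: m_def)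
  have mc_eq: "m t - m r = c t r" if "0 \<le> t" "t \<le> r" "r \<le> T" for t r
    using deterministic_increment[OF D J z C0 increment DT that] by (simp add: m_def)
  have "m t \<le> 0" if t: "t \<in> {0..T}" for t
  proof (rule nonpositive_of_increment_bound[OF mc mT A0 _ t])
    fix t r b assume t: "0 \<le> t" "t \<le> r" "r \<le> T" and pos: "\<And>s. s \<in> {t..<r} \<Longrightarrow> 0 < m s"
      and mr: "m r = 0" and b: "\<And>s. s \<in> {t..r} \<Longrightarrow> m s \<le> b"
    have "K r = K t"
    proof (rule interval_measure_flat[OF T_pos K loss_expectation(2)[OF l Y] Lpos(1) flat[unfolded flat_def] t])
      fix s assume s: "s \<in> {t..<r}"
      then have sT: "s \<in> {0..T}" using t by auto
      have sm: "AE \<omega> in M. \<forall>t\<in>{0..T}. strict_mono (l \<omega> t)" using l by (simp add: H_l_def)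
      \<comment> \<open>Almost surely \<open>Y s - Y' s\<close> is the positive number
        \<open>m s\<close>, so the strictly increasing loss is larger at \<open>Y\<close>. The
        constraint on \<open>Y'\<close> then makes the constraint on \<open>Y\<close>
        strict.\<close>
      have "expectation (\<lambda>\<omega>. l \<omega> s (Y' s \<omega>)) < expectation (\<lambda>\<omega>. l \<omega> s (Y s \<omega>))"
      proof (rule integral_less_AE_space)
        show "AE \<omega> in M. l \<omega> s (Y' s \<omega>) < l \<omega> s (Y s \<omega>)"
          using sm Dm[OF sT]
        proof eventually_elim
          case (elim \<omega>)
          then have "Y' s \<omega> < Y s \<omega>" using pos[OF s] by (simp add: D_def)
          then show ?case using elim(1) sT by (auto intro: strict_monoD)
        qed
      qed (use loss_expectation(1)[OF l Y sT] loss_expectation(1)[OF l Y' sT] emeasure_space_1 in auto)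
      then show "0 < expectation (\<lambda>\<omega>. l \<omega> s (Y s \<omega>))" using Lpos(2)[OF sT] by linarith
    qed
    \<comment> \<open>\<open>K'\<close> enters \<open>c t r\<close> with a minus sign, so its
      increase can only lower \<open>m t\<close>; the contribution of \<open>K\<close> has been
      removed by flatness.\<close>
    moreover have "K' t \<le> K' r" using t by (intro mono_onD[OF K']) auto
    ultimately have "m t \<le> (LINT s:{t..r}|lborel. a s * m s)"
      using mc_eq[OF t] mr by (simp add: c_def)
    also have "\<dots> \<le> (LINT s:{t..r}|lborel. A * b)"
    proof (rule set_integral_mono)
      show "set_integrable lborel {t..r} (\<lambda>s. a s * m s)" using am t by (intro set_integrable_subset[OF am]) auto
      show "set_integrable lborel {t..r} (\<lambda>s. A * b)" by (intro borel_integrable_atLeastAtMost' continuous_intros)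
      fix s assume s: "s \<in> {t..r}"
      have m0: "0 \<le> m s" using pos[of s] mr s by (cases "s = r") (auto intro: less_imp_le)
      have "a s * m s \<le> A * m s" using A[of s] s t m0 by (intro mult_right_mono) auto
      also have "\<dots> \<le> A * b" using b[OF s] A0 by (intro mult_left_mono)
      finally show "a s * m s \<le> A * b" .
    qed
    also have "\<dots> = A * b * (r - t)"
      using t by (simp add: set_lebesgue_integral_def)
    finally show "m t \<le> A * b * (r - t)" .
  qed
  then have "AE \<omega> in M. D t \<omega> \<le> 0" if "t \<in> {0..T}" for t
    using Dm[OF that] that by (auto elim: eventually_mono)
  from AE_regular_nonpositive[OF D this] show ?thesis
    by (simp add: D_def)
qed

end

theorem theorem12:
  fixes M :: "'w measure"
    and T :: real
    and B :: "real \<Rightarrow> 'w \<Rightarrow> real ^ 'd::finite"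
    and F :: "real \<Rightarrow> 'w measure"
    and \<xi> :: "'w \<Rightarrow> real"
    and f :: "'w \<Rightarrow> real \<Rightarrow> real \<Rightarrow> real ^ 'd \<Rightarrow> real"
    and l :: "'w \<Rightarrow> real \<Rightarrow> real \<Rightarrow> real"
    and a :: "real \<Rightarrow> real"
    and h :: "'w \<Rightarrow> real \<Rightarrow> real ^ 'd \<Rightarrow> real"
    and Y :: "real \<Rightarrow> 'w \<Rightarrow> real"
    and Z :: "real \<Rightarrow> 'w \<Rightarrow> real ^ 'd"
    and K :: "real \<Rightarrow> real"
  assumes "0 < T"
    and "prob_space M" and "complete_measure M"
    and "standard_brownian_motion M T B"
    and "F = usual_filtration M T B"
    and "H_f M T F f"
    and "H_xi M T F l \<xi>"
    and "H_l M T F l"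
    and "a \<in> borel_measurable (restrict_space borel {0..T})"
    and "bounded (a ` {0..T})"
    and "\<forall>\<omega>\<in>space M. \<forall>t\<in>{0..T}. \<forall>y z. f \<omega> t y z = a t * y + h \<omega> t z"
    and "deterministic_flat_solution M T F B \<xi> f l Y Z K"
  shows "\<forall>Y' Z' K'. deterministic_solution M T F B \<xi> f l Y' Z' K' \<longrightarrow>
           (AE \<omega> in M. \<forall>t\<in>{0..T}. Y t \<omega> \<le> Y' t \<omega>)"
proof -
  interpret brownian_motion M T B
    using assms(1,2,4) by (intro brownian_motion.intro brownian_motion_axioms.intro)
  have sol: "deterministic_solution M T F B \<xi> f l Y Z K" "flat M T l Y K"
    using assms(12) by (auto simp: deterministic_flat_solution_def)
  show ?thesis
    using deterministic_flat_solution_minimal[OF assms(6,8)[unfolded assms(5)] assms(9-11) sol[unfolded assms(5)]]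
    unfolding assms(5) by blast
qed

end
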